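(* Let $b(t)=\sum_{n=-r}^{s} b_n t^n$ be a Laurent polynomial with $r,s$ positive integers and $b_{-r}\neq 0$, $b_s\neq 0$. Let $0<\rho_l\le\rho_h<\infty$ be such that $\Lambda(b)=\bigcap_{\rho\in[\rho_l,\rho_h]}\operatorname{sp} T(b_\rho)$. Then $$\lim_{\Delta_\rho,\Delta_v\to 0}\Biggl[\ \sup_{\boldsymbol{\rho}\in\mathcal{P}(\Delta_\rho),\ \boldsymbol{v}\in\mathcal{P}(\Delta_v)} d_H\Biggl(\bigcap_{j=0}^{n}\operatorname{sp} T(b_{\rho_j}^D),\ \Lambda(b)\Biggr)\Biggr]=0,$$ where $\boldsymbol{\rho}=(\rho_j)_{j=0}^{n}$, $\mathcal{P}(\Delta_\rho)=\mathcal{P}_{[\rho_l,\rho_h]}(\Delta_\rho)$, $\boldsymbol{v}=(v_j)_{j=0}^{m}$, $\mathcal{P}(\Delta_v)=\mathcal{P}_{[0,2\pi]}(\Delta_v)$, and $b_{\rho_j}^D$ is the polygon discretization of $b_{\rho_j}$ with respect to $\boldsymbol{v}$.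
   Context: $\mathbb{T}$ is the unit circle in $\mathbb{C}$. For a continuous function (symbol) $a:\mathbb{T}\to\mathbb{C}$ with Fourier coefficients $(a_k)_{k\in\mathbb{Z}}$, $T(a)=(a_{j-k})_{j,k=0}^{\infty}$ is the Toeplitz operator on $\ell^2(\mathbb{N})$, a bounded operator, and $\operatorname{sp} T(a)$ is its spectrum. It is known (Gohberg) that $\operatorname{sp} T(a)=a(\mathbb{T})\cup\{\lambda\in\mathbb{C}\setminus a(\mathbb{T}):\operatorname{wind}(a-\lambda)\ne 0\}$, where $\operatorname{wind}(a-\lambda)$ is the winding number of the closed curve $v\mapsto a(e^{iv})$, $v\in[0,2\pi]$, around $\lambda$. For $\rho>0$, $b_\rho(t):=b(\rho t)$, $t\in\mathbb{T}$. The limit set: for $\lambda\in\mathbb{C}$ let $z_1(\lambda),\dots,z_{r+s}(\lambda)$ be the zeros, with multiplicity, of $z\mapsto z^r(b(z)-\lambda)$, ordered so that $|z_j(\lambda)|\le|z_{j+1}(\lambda)|$. Then $\Lambda(b):=\{\lambda\in\mathbb{C}: |z_r(\lambda)|=|z_{r+1}(\lambda)|\}$. It is a known theorem of Schmidt and Spitzer that $\Lambda(b)=\bigcap_{\rho\in(0,\infty)}\operatorname{sp} T(b_\rho)$. A partition of $[\alpha,\beta]$ is a finite sequence $\alpha=x_0<x_1<\dots<x_n=\beta$ (with $n$ arbitrary); its granularity is $\max_{0\le j\le n-1}(x_{j+1}-x_j)$. (If $\alpha=\beta$ the only partition is the single point $x_0=\alpha$, with granularity $0$.) $\mathcal{P}_{[\alpha,\beta]}(\Delta)$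 is the set of all partitions of $[\alpha,\beta]$ with granularity $\le\Delta$. Polygon discretization: given a partition $0=v_0<v_1<\dots<v_m=2\pi$ of $[0,2\pi]$ and $\rho>0$, $b_\rho^D:\mathbb{T}\to\mathbb{C}$ is the continuous symbol $$b_\rho^D(e^{iv}):=\frac{v-v_j}{v_{j+1}-v_j}\bigl(b_\rho(e^{iv_{j+1}})-b_\rho(e^{iv_j})\bigr)+b_\rho(e^{iv_j}),\qquad v\in[v_j,v_{j+1}).$$ $d_H$ is the Hausdorff metric on the set $\mathcal{C}$ of non-empty closed bounded subsets of $\mathbb{C}$: $d_H(A,B):=\inf\{\epsilon: A\subset(B)_\epsilon,\ B\subset(A)_\epsilon\}$, where $(X)_\epsilon:=\bigcup_{x\in X}\{z\in\mathbb{C}:|z-x|\le\epsilon\}$. *)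

theory Defs
  imports "HOL-Analysis.Analysis" "HOL-Computational_Algebra.Polynomial"
begin

section \<open>Bounded operators on \<open>\<ell>\<^sup>2(\<nat>)\<close> and their spectra\<close>

definition l2 :: "(nat \<Rightarrow> complex) set" where
  "l2 = {x. summable (\<lambda>k. (cmod (x k))\<^sup>2)}"

definition l2_norm :: "(nat \<Rightarrow> complex) \<Rightarrow> real" where
  "l2_norm x = sqrt (\<Sum>k. (cmod (x k))\<^sup>2)"

text \<open>Operators on \<open>\<ell>\<^sup>2(\<nat>)\<close> are represented by functions on all sequences, of which only the
  values on \<^const>\<open>l2\<close> matter.\<close>

definition bounded_operator_l2 :: "((nat \<Rightarrow> complex) \<Rightarrow> (nat \<Rightarrow> complex)) \<Rightarrow> bool" where
  "bounded_operator_l2 A \<longleftrightarrow>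
     (\<forall>x\<in>l2. A x \<in> l2) \<and>
     (\<forall>x\<in>l2. \<forall>y\<in>l2. A (\<lambda>k. x k + y k) = (\<lambda>k. A x k + A y k)) \<and>
     (\<forall>x\<in>l2. \<forall>c. A (\<lambda>k. c * x k) = (\<lambda>k. c * A x k)) \<and>
     (\<exists>K. \<forall>x\<in>l2. l2_norm (A x) \<le> K * l2_norm x)"

definition spectrum_l2 :: "((nat \<Rightarrow> complex) \<Rightarrow> (nat \<Rightarrow> complex)) \<Rightarrow> complex set" where
  "spectrum_l2 A =
     {\<mu>. \<not> (\<exists>S. bounded_operator_l2 S \<and>
             (\<forall>x\<in>l2. S (\<lambda>k. A x k - \<mu> * x k) = x \<and>
                     (\<lambda>k. A (S x) k - \<mu> * S x k) = x))}"

section \<open>Toeplitz operators\<close>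

text \<open>A symbol is a function on \<^typ>\<open>complex\<close> of which only the values on the unit circle
  are used.\<close>

definition fourier_coeff :: "(complex \<Rightarrow> complex) \<Rightarrow> int \<Rightarrow> complex" where
  "fourier_coeff a k =
     integral {0..2 * pi} (\<lambda>v. a (cis v) * cis (- (of_int k * v))) / of_real (2 * pi)"

definition toeplitz :: "(complex \<Rightarrow> complex) \<Rightarrow> (nat \<Rightarrow> complex) \<Rightarrow> (nat \<Rightarrow> complex)" where
  "toeplitz a x = (\<lambda>j. \<Sum>k. fourier_coeff a (int j - int k) * x k)"

definition dilate :: "(complex \<Rightarrow> complex) \<Rightarrow> real \<Rightarrow> complex \<Rightarrow> complex" where
  "dilate b \<rho> t = b (of_real \<rho> * t)"

section \<open>Laurent polynomials and the limit set\<close>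

definition laurent :: "nat \<Rightarrow> nat \<Rightarrow> (int \<Rightarrow> complex) \<Rightarrow> complex \<Rightarrow> complex" where
  "laurent r s c t = (\<Sum>n = - int r..int s. c n * t powi n)"

text \<open>The polynomial \<open>z\<^sup>r (b(z) - \<mu>)\<close>, where \<open>b\<close> is \<^term>\<open>laurent r s c\<close>.\<close>

definition shifted_poly :: "nat \<Rightarrow> nat \<Rightarrow> (int \<Rightarrow> complex) \<Rightarrow> complex \<Rightarrow> complex poly" where
  "shifted_poly r s c \<mu> = (\<Sum>n = - int r..int s. monom (c n) (nat (n + int r))) - monom \<mu> r"

lemma poly_shifted_poly:
  assumes "z \<noteq> 0"
  shows "poly (shifted_poly r s c \<mu>) z = z ^ r * (laurent r s c z - \<mu>)"
proof -
  have "c n * z ^ nat (n + int r) = z ^ r * (c n * z powi n)" if "n \<in> {- int r..int s}" for n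
  proof -
    have "z ^ nat (n + int r) = z powi (n + int r)"
      using that by (simp add: power_int_def)
    also have "\<dots> = z powi n * z ^ r"
      using assms by (simp add: power_int_add)
    finally show ?thesis by simp
  qed
  then have "(\<Sum>n = - int r..int s. c n * z ^ nat (n + int r)) = z ^ r * laurent r s c z"
    unfolding laurent_def sum_distrib_left by (intro sum.cong) auto
  then show ?thesis
    by (simp add: shifted_poly_def poly_sum poly_monom algebra_simps)
qed

text \<open>The zeros are listed with multiplicity by non-decreasing modulus. Lists are indexed from 0,
  so \<open>z\<^sub>r\<close> and \<open>z\<^sub>r\<^sub>+\<^sub>1\<close> are the entries \<open>r - 1\<close> and \<open>r\<close>.\<close>

definition limit_set :: "nat \<Rightarrow> nat \<Rightarrow> (int \<Rightarrow> complex) \<Rightarrow> complex set" where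
  "limit_set r s c =
     {\<mu>. \<exists>zs. mset zs = proots (shifted_poly r s c \<mu>) \<and> sorted (map cmod zs) \<and>
              cmod (zs ! (r - 1)) = cmod (zs ! r)}"

section \<open>Partitions and polygon discretization\<close>

text \<open>The inserted \<open>0\<close> only matters for the one-point partition.\<close>

definition granularity :: "real list \<Rightarrow> real" where
  "granularity xs = Max (insert 0 {xs ! Suc j - xs ! j | j. Suc j < length xs})"

definition partitions :: "real \<Rightarrow> real \<Rightarrow> real \<Rightarrow> real list set" where
  "partitions \<alpha> \<beta> \<Delta> =
     {xs. xs \<noteq> [] \<and> hd xs = \<alpha> \<and> last xs = \<beta> \<and> sorted_wrt (<) xs \<and> granularity xs \<le> \<Delta>}"

definition polygon :: "(complex \<Rightarrow> complex) \<Rightarrow> real list \<Rightarrow> complex \<Rightarrow> complex" where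
  "polygon f vs t =
     (let v = Arg2pi t;
          j = (THE j. Suc j < length vs \<and> vs ! j \<le> v \<and> v < vs ! Suc j)
      in of_real ((v - vs ! j) / (vs ! Suc j - vs ! j)) *
           (f (cis (vs ! Suc j)) - f (cis (vs ! j))) + f (cis (vs ! j)))"

lemma polygon_cis:
  assumes vs: "vs \<in> partitions 0 (2 * pi) \<Delta>" and j: "Suc j < length vs"
    and v: "vs ! j \<le> v" "v < vs ! Suc j"
  shows "polygon f vs (cis v) =
     of_real ((v - vs ! j) / (vs ! Suc j - vs ! j)) *
       (f (cis (vs ! Suc j)) - f (cis (vs ! j))) + f (cis (vs ! j))"
proof -
  have lt: "vs ! i < vs ! k" if "i < k" "k < length vs" for i k
    using vs that by (auto simp: partitions_def sorted_wrt_iff_nth_less)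
  have le: "vs ! i \<le> vs ! k" if "i \<le> k" "k < length vs" for i k
    using lt[of i k] that by (cases "i = k") auto
  have ends: "vs ! 0 = 0" "vs ! (length vs - 1) = 2 * pi"
    using vs by (auto simp: partitions_def hd_conv_nth last_conv_nth)
  have "Suc j \<le> length vs - 1" "length vs - 1 < length vs"
    using j by auto
  then have "0 \<le> v" "v < 2 * pi"
    using le[of 0 j] le[of "Suc j" "length vs - 1"] ends v j by linarith+
  then have arg: "Arg2pi (cis v) = v"
    using Arg2pi_unique[of 1 v] by (simp add: cis_conv_exp)
  have "(THE j. Suc j < length vs \<and> vs ! j \<le> v \<and> v < vs ! Suc j) = j"
  proof (rule the_equality)
    fix i assume i: "Suc i < length vs \<and> vs ! i \<le> v \<and> v < vs ! Suc i"
    show "i = j"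
    proof (rule ccontr)
      assume "i \<noteq> j"
      then consider "Suc i \<le> j" | "Suc j \<le> i" by linarith
      then show False
        using i j v le[of "Suc i" j] le[of "Suc j" i] by cases auto
    qed
  qed (use j v in auto)
  then show ?thesis by (simp add: polygon_def arg)
qed

section \<open>Hausdorff distance\<close>

text \<open>The infimum is taken in \<^typ>\<open>ennreal\<close>, so that the distance between a non-empty set and the
  empty set is \<open>\<infinity>\<close>. On non-empty bounded sets this is the usual real-valued infimum.\<close>

definition hausdorff_distance :: "complex set \<Rightarrow> complex set \<Rightarrow> ennreal" where
  "hausdorff_distance A B =
     (INF \<epsilon>\<in>{\<epsilon>::real. 0 \<le> \<epsilon> \<and> A \<subseteq> (\<Union>x\<in>B. cball x \<epsilon>) \<and> B \<subseteq> (\<Union>x\<in>A. cball x \<epsilon>)}. ennreal \<epsilon>)"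

end

theory Submission
  imports Defs "HOL-Complex_Analysis.Complex_Analysis"
    "HOL-Computational_Algebra.Fundamental_Theorem_Algebra"
begin

text \<open>Let \<open>b\<close> be the Laurent polynomial and \<open>\<Lambda>\<close> its limit set. For a fixed partition of the circle the
discretized symbols of all radii fit together into one function \<open>b + E\<close> on an annulus, where \<open>E\<close> at
the point \<open>\<rho> t\<close> is the interpolation error of \<open>b\<^sub>\<rho>\<close> at \<open>t\<close>. Linear interpolation of a smooth
function has a small error in the Lipschitz sense, not only in the supremum norm: on an annulus both
the supremum and the Lipschitz constant of \<open>E\<close> are \<open>O(\<Delta>\<^sub>v)\<close> (\<open>polygon_error_lipschitz\<close>). The two
inclusions that bound the Hausdorff distance use this with different strength.

\<^item> The intersection of the discretized spectra lies near \<open>\<Lambda>\<close> by a soft argument. A point \<open>\<mu>\<close> off \<open>\<Lambda>\<close>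
  is outside the spectrum of \<open>T(b\<^sub>\<rho>)\<close> for some \<open>\<rho>\<close> by hypothesis, invertibility is stable under small
  changes of \<open>\<mu>\<close>, \<open>\<rho>\<close> and the symbol in the supremum norm, and compactness makes this uniform
  (\<open>polygon_spectra_near_intersection\<close>).

\<^item> Near a given \<open>\<mu>\<close> in \<open>\<Lambda>\<close> there must be one point that belongs to the discretized spectra of all
  radii at once, and here the argument depends on the small Lipschitz constant of \<open>E\<close>. By Puiseux
  the zeros of \<open>b - (\<mu> + \<tau>\<^sup>N)\<close> are holomorphic functions \<open>u\<^sub>j(\<tau>)\<close> of \<open>\<tau>\<close> (\<open>puiseux_branches\<close>).
  Call \<open>\<tau>\<close> separated if some circle around \<open>0\<close> has exactly \<open>r\<close> of the zeros inside and none on it;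
  the index set of the inner zeros is then the selection at \<open>\<tau>\<close>. Membership of \<open>\<mu>\<close> in \<open>\<Lambda>\<close> says that
  \<open>\<tau> = 0\<close> is not separated. Separated parameters are dense, by counting orbits of the rotations that
  leave \<open>b\<close> invariant (\<open>separated_dense\<close>), and two different selections occur near \<open>0\<close>: with only one
  selection \<open>S\<close>, density would give \<open>\<bar>u\<^sub>i\<bar> \<le> \<bar>u\<^sub>k\<bar>\<close> for all \<open>i\<close> in \<open>S\<close> and \<open>k\<close> outside, with equality at
  \<open>0\<close> for one pair, and the maximum principle would make this pair equal in modulus everywhere
  (\<open>two_selections\<close>).

  A function \<open>E\<close> with small Lipschitz constant moves each zero only a little, to a continuous function
  \<open>w\<^sub>j\<close> of the parameter (\<open>perturbed_branches\<close>), and \<open>b + E - (\<mu> + \<tau>\<^sup>N)\<close> is \<open>z\<^sup>-\<^sup>r \<Prod> (z - w\<^sub>j)\<close> times a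
  constant times a factor close to \<open>1\<close> (\<open>perturbed_factor\<close>). On a path that joins parameters with
  different selections the selection cannot be locally constant, so at some parameter no circle
  separates exactly \<open>r\<close> of the \<open>w\<^sub>j\<close>. At this parameter the Toeplitz operator is not invertible for any
  radius (\<open>unseparated_not_invertible\<close>).

The last step is an index computation: if the symbol is
\<open>t\<^sup>k \<Prod> (t - u\<^sub>j)\<close> times a factor \<open>a\<close> with \<open>T(a)\<close> invertible, the linear factors can be split off one by
one as invertible operators, and the remaining operator is \<open>T(a)\<close> composed with a power of the shift
or of its adjoint (\<open>toeplitz_invertible_index\<close>).\<close>

section \<open>Square-summable sequences and invertible operators\<close>

lemma l2_norm_nonneg: "x \<in> l2 \<Longrightarrow> 0 \<le> l2_norm x"
  unfolding l2_norm_def l2_def by (simp add: suminf_nonneg)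

lemma l2_norm_partial:
  assumes "x \<in> l2" shows "L2_set (\<lambda>k. cmod (x k)) {..<n} \<le> l2_norm x"
  using assms unfolding l2_norm_def l2_def L2_set_def
  by (auto intro!: sum_le_suminf)

text \<open>The standard way below to show that a pointwise limit is in \<open>\<ell>\<^sup>2\<close>: bounds on finite sections
  pass to the limit.\<close>

lemma l2I:
  assumes "\<And>n. L2_set (\<lambda>k. cmod (x k)) {..<n} \<le> C"
  shows "x \<in> l2" and "l2_norm x \<le> C"
proof -
  have C: "0 \<le> C" using assms[of 0] by simp
  have le: "(\<Sum>k<n. (cmod (x k))\<^sup>2) \<le> C\<^sup>2" for n
  proof -
    have "(L2_set (\<lambda>k. cmod (x k)) {..<n})\<^sup>2 \<le> C\<^sup>2"
      by (intro power_mono assms L2_set_nonneg)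
    then show ?thesis by (simp add: L2_set_def sum_nonneg)
  qed
  have "summable (\<lambda>k. (cmod (x k))\<^sup>2)"
    by (rule summableI_nonneg_bounded[where x = "C\<^sup>2"]) (use le in auto)
  then show "x \<in> l2" by (simp add: l2_def)
  have "(\<Sum>k. (cmod (x k))\<^sup>2) \<le> C\<^sup>2"
    by (rule suminf_le_const) (use \<open>summable _\<close> le in auto)
  then show "l2_norm x \<le> C"
    unfolding l2_norm_def using C by (simp add: real_le_lsqrt)
qed

lemma l2_coord_le:
  assumes "x \<in> l2" shows "cmod (x k) \<le> l2_norm x"
proof -
  have "cmod (x k) \<le> L2_set (\<lambda>k. cmod (x k)) {..<Suc k}"
    by (intro member_le_L2_set) auto
  also have "\<dots> \<le> l2_norm x" by (rule l2_norm_partial[OF assms])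
  finally show ?thesis .
qed

lemma l2_add:
  assumes "x \<in> l2" "y \<in> l2"
  shows "(\<lambda>k. x k + y k) \<in> l2" and "l2_norm (\<lambda>k. x k + y k) \<le> l2_norm x + l2_norm y"
proof -
  have "L2_set (\<lambda>k. cmod (x k + y k)) {..<n} \<le> l2_norm x + l2_norm y" for n
  proof -
    have "L2_set (\<lambda>k. cmod (x k + y k)) {..<n} \<le> L2_set (\<lambda>k. cmod (x k) + cmod (y k)) {..<n}"
      by (intro L2_set_mono) (auto intro: norm_triangle_ineq)
    also have "\<dots> \<le> L2_set (\<lambda>k. cmod (x k)) {..<n} + L2_set (\<lambda>k. cmod (y k)) {..<n}"
      by (rule L2_set_triangle_ineq)
    also have "\<dots> \<le> l2_norm x + l2_norm y"
      by (intro add_mono l2_norm_partial assms)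
    finally show ?thesis .
  qed
  from l2I[of "\<lambda>k. x k + y k", OF this]
  show "(\<lambda>k. x k + y k) \<in> l2" "l2_norm (\<lambda>k. x k + y k) \<le> l2_norm x + l2_norm y"
    by auto
qed

lemma l2_norm_scale: "l2_norm (\<lambda>k. a * x k) = cmod a * l2_norm x" if "x \<in> l2"
  using that unfolding l2_norm_def l2_def
  by (simp add: norm_mult power_mult_distrib suminf_mult real_sqrt_mult)

lemma l2_scale: "x \<in> l2 \<Longrightarrow> (\<lambda>k. a * x k) \<in> l2"
  unfolding l2_def by (simp add: norm_mult power_mult_distrib summable_mult)

lemma l2_diff:
  assumes "x \<in> l2" "y \<in> l2"
  shows "(\<lambda>k. x k - y k) \<in> l2" and "l2_norm (\<lambda>k. x k - y k) \<le> l2_norm x + l2_norm y"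
  using l2_add[OF assms(1) l2_scale[OF assms(2), of "-1"]] l2_norm_scale[OF assms(2), of "-1"]
  by auto

lemma l2_zero: "(\<lambda>k. 0) \<in> l2" "l2_norm (\<lambda>k. 0) = 0"
  by (auto simp: l2_def l2_norm_def)

lemma l2_norm_le_0: "x \<in> l2 \<Longrightarrow> l2_norm x \<le> 0 \<Longrightarrow> x = (\<lambda>k. 0)"
  using l2_coord_le[of x] by (intro ext) (metis norm_le_zero_iff order_trans)

lemma l2_finite_support:
  assumes "\<And>k. k \<ge> n \<Longrightarrow> x k = 0" shows "x \<in> l2"
  unfolding l2_def mem_Collect_eq
  by (rule summable_finite[of "{..<n}"]) (use assms in \<open>auto simp: not_less\<close>)

lemma bounded_opD:
  assumes "bounded_operator_l2 A"
  shows "x \<in> l2 \<Longrightarrow> A x \<in> l2"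
    and "x \<in> l2 \<Longrightarrow> y \<in> l2 \<Longrightarrow> A (\<lambda>k. x k + y k) = (\<lambda>k. A x k + A y k)"
    and "x \<in> l2 \<Longrightarrow> A (\<lambda>k. a * x k) = (\<lambda>k. a * A x k)"
  using assms unfolding bounded_operator_l2_def by auto

lemma bounded_op_diff:
  assumes "bounded_operator_l2 A" "x \<in> l2" "y \<in> l2"
  shows "A (\<lambda>k. x k - y k) = (\<lambda>k. A x k - A y k)"
  using bounded_opD(2)[OF assms(1,2) l2_scale[OF assms(3), of "-1"]]
    bounded_opD(3)[OF assms(1,3), of "-1"] by simp

lemma bounded_op_norm:
  assumes "bounded_operator_l2 A"
  obtains K where "K > 0" "\<And>x. x \<in> l2 \<Longrightarrow> l2_norm (A x) \<le> K * l2_norm x"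
proof -
  obtain K where K: "\<forall>x\<in>l2. l2_norm (A x) \<le> K * l2_norm x"
    using assms unfolding bounded_operator_l2_def by auto
  have "l2_norm (A x) \<le> (\<bar>K\<bar> + 1) * l2_norm x" if "x \<in> l2" for x
  proof -
    have "l2_norm (A x) \<le> K * l2_norm x" using K that by auto
    also have "\<dots> \<le> (\<bar>K\<bar> + 1) * l2_norm x"
      by (intro mult_right_mono l2_norm_nonneg that) auto
    finally show ?thesis .
  qed
  then show ?thesis using that[of "\<bar>K\<bar> + 1"] by auto
qed

lemma bounded_op_comp:
  assumes "bounded_operator_l2 A" "bounded_operator_l2 B"
  shows "bounded_operator_l2 (\<lambda>x. A (B x))"
proof -
  obtain K where K: "K > 0" "\<And>x. x \<in> l2 \<Longrightarrow> l2_norm (A x) \<le> K * l2_norm x"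
    using bounded_op_norm[OF assms(1)] by blast
  obtain L where L: "L > 0" "\<And>x. x \<in> l2 \<Longrightarrow> l2_norm (B x) \<le> L * l2_norm x"
    using bounded_op_norm[OF assms(2)] by blast
  have "l2_norm (A (B x)) \<le> (K * L) * l2_norm x" if "x \<in> l2" for x
  proof -
    have "l2_norm (A (B x)) \<le> K * l2_norm (B x)"
      using K bounded_opD(1)[OF assms(2) that] by auto
    also have "\<dots> \<le> K * (L * l2_norm x)"
      using K L that by (intro mult_left_mono) auto
    finally show ?thesis by simp
  qed
  then show ?thesis
    unfolding bounded_operator_l2_def
    using bounded_opD[OF assms(1)] bounded_opD[OF assms(2)] by auto
qed

lemma bounded_op_lincomb:
  assumes "bounded_operator_l2 A" "bounded_operator_l2 B"
  shows "bounded_operator_l2 (\<lambda>x k. a * A x k + b * B x k)"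
proof -
  obtain K where K: "K > 0" "\<And>x. x \<in> l2 \<Longrightarrow> l2_norm (A x) \<le> K * l2_norm x"
    using bounded_op_norm[OF assms(1)] by blast
  obtain L where L: "L > 0" "\<And>x. x \<in> l2 \<Longrightarrow> l2_norm (B x) \<le> L * l2_norm x"
    using bounded_op_norm[OF assms(2)] by blast
  have "l2_norm (\<lambda>k. a * A x k + b * B x k) \<le> (cmod a * K + cmod b * L) * l2_norm x"
    if "x \<in> l2" for x
  proof -
    note AB = bounded_opD(1)[OF assms(1) that] bounded_opD(1)[OF assms(2) that]
    have "l2_norm (\<lambda>k. a * A x k + b * B x k) \<le> cmod a * l2_norm (A x) + cmod b * l2_norm (B x)"
      using l2_add(2)[OF l2_scale[OF AB(1)] l2_scale[OF AB(2)]] AB by (simp add: l2_norm_scale)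
    also have "\<dots> \<le> cmod a * (K * l2_norm x) + cmod b * (L * l2_norm x)"
      using K L that by (intro add_mono mult_left_mono) auto
    finally show ?thesis by (simp add: algebra_simps)
  qed
  then show ?thesis
    unfolding bounded_operator_l2_def
    using bounded_opD[OF assms(1)] bounded_opD[OF assms(2)]
    by (auto intro!: l2_add l2_scale exI[of _ "cmod a * K + cmod b * L"] simp: algebra_simps)
qed

lemma bounded_op_id: "bounded_operator_l2 (\<lambda>x. x)"
  unfolding bounded_operator_l2_def by (auto intro!: exI[of _ 1])

definition invertible_l2 :: "((nat \<Rightarrow> complex) \<Rightarrow> (nat \<Rightarrow> complex)) \<Rightarrow> bool" where
  "invertible_l2 A \<longleftrightarrow>
     (\<exists>S. bounded_operator_l2 S \<and> (\<forall>x\<in>l2. S (A x) = x \<and> A (S x) = x))"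

lemma not_in_spectrum_iff:
  "\<mu> \<notin> spectrum_l2 A \<longleftrightarrow> invertible_l2 (\<lambda>x k. A x k - \<mu> * x k)"
  unfolding spectrum_l2_def invertible_l2_def by simp

lemma invertible_l2_cong:
  assumes "\<And>x. x \<in> l2 \<Longrightarrow> A x = B x"
  shows "invertible_l2 A \<longleftrightarrow> invertible_l2 B"
proof -
  have "(\<forall>x\<in>l2. S (A x) = x \<and> A (S x) = x) \<longleftrightarrow> (\<forall>x\<in>l2. S (B x) = x \<and> B (S x) = x)"
    if "bounded_operator_l2 S" for S
    using assms bounded_opD(1)[OF that] by auto
  then show ?thesis unfolding invertible_l2_def by blast
qed

lemma invertible_l2_comp:
  assumes A: "invertible_l2 A" and B: "invertible_l2 B" "\<And>x. x \<in> l2 \<Longrightarrow> B x \<in> l2"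
  shows "invertible_l2 (\<lambda>x. A (B x))"
proof -
  obtain S where S: "bounded_operator_l2 S" "\<forall>x\<in>l2. S (A x) = x \<and> A (S x) = x"
    using A unfolding invertible_l2_def by auto
  obtain T where T: "bounded_operator_l2 T" "\<forall>x\<in>l2. T (B x) = x \<and> B (T x) = x"
    using B unfolding invertible_l2_def by auto
  show ?thesis unfolding invertible_l2_def
    by (rule exI[of _ "\<lambda>x. T (S x)"])
      (use S T B bounded_op_comp[OF T(1) S(1)] bounded_opD(1)[OF S(1)] in auto)
qed

lemma invertible_l2_inverse:
  assumes "invertible_l2 A" "bounded_operator_l2 A"
  obtains S where "bounded_operator_l2 S" "invertible_l2 S"
    "\<And>x. x \<in> l2 \<Longrightarrow> S (A x) = x" "\<And>x. x \<in> l2 \<Longrightarrow> A (S x) = x"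
proof -
  obtain S where S: "bounded_operator_l2 S" "\<forall>x\<in>l2. S (A x) = x \<and> A (S x) = x"
    using assms(1) unfolding invertible_l2_def by auto
  have "invertible_l2 S" unfolding invertible_l2_def using S assms(2) by blast
  then show ?thesis using that S by blast
qed

lemma invertible_l2_cancel_right:
  assumes AB: "invertible_l2 (\<lambda>x. A (B x))" and B: "invertible_l2 B" "bounded_operator_l2 B"
  shows "invertible_l2 A"
proof -
  obtain S where S: "bounded_operator_l2 S" "invertible_l2 S"
    "\<And>x. x \<in> l2 \<Longrightarrow> S (B x) = x" "\<And>x. x \<in> l2 \<Longrightarrow> B (S x) = x"
    using invertible_l2_inverse[OF B] by blast
  have "invertible_l2 (\<lambda>x. A (B (S x)))"
    by (rule invertible_l2_comp[OF AB S(2)]) (rule bounded_opD(1)[OF S(1)])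
  then show ?thesis by (subst (asm) invertible_l2_cong[of _ A]) (use S in auto)
qed

lemma invertible_l2_cancel_left:
  assumes AB: "invertible_l2 (\<lambda>x. A (B x))" and A: "invertible_l2 A" "bounded_operator_l2 A"
    and B: "bounded_operator_l2 B"
  shows "invertible_l2 B"
proof -
  obtain S where S: "bounded_operator_l2 S" "invertible_l2 S"
    "\<And>x. x \<in> l2 \<Longrightarrow> S (A x) = x" "\<And>x. x \<in> l2 \<Longrightarrow> A (S x) = x"
    using invertible_l2_inverse[OF A] by blast
  have "invertible_l2 (\<lambda>x. S (A (B x)))"
    by (rule invertible_l2_comp[OF S(2) AB])
      (rule bounded_opD(1)[OF bounded_op_comp[OF A(2) B]])
  then show ?thesis by (subst (asm) invertible_l2_cong[of _ B]) (use S bounded_opD(1)[OF B] in auto)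
qed

text \<open>The form of completeness of \<open>\<ell>\<^sup>2\<close> that the Neumann series needs: the sum is formed
  coordinatewise, and its distance to the partial sums is controlled on finite sections.\<close>

lemma l2_geometric_limit:
  assumes t: "\<And>n. t n \<in> l2" "\<And>n. l2_norm (t n) \<le> C * q ^ n" and q: "0 \<le> q" "q < 1"
  defines "x \<equiv> \<lambda>k. \<Sum>n. t n k"
  shows "x \<in> l2" and "l2_norm (\<lambda>k. x k - (\<Sum>n<N. t n k)) \<le> C * q ^ N / (1 - q)"
proof -
  have C: "0 \<le> C" using t(2)[of 0] l2_norm_nonneg[OF t(1)[of 0]] by simp
  have sum_q: "(\<Sum>n<M. C * q ^ (n + N)) \<le> C * q ^ N / (1 - q)" for M N
  proof -
    have "(\<Sum>n<M. C * q ^ (n + N)) = C * q ^ N * ((1 - q ^ M) / (1 - q))"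
      using q by (simp add: power_add sum_gp_strict sum_distrib_left[symmetric] sum_distrib_right[symmetric])
    also have "\<dots> \<le> C * q ^ N * (1 / (1 - q))"
      using q C by (intro mult_left_mono divide_right_mono) auto
    finally show ?thesis by simp
  qed
  have fin: "(\<lambda>k. \<Sum>n<M. t (n + N) k) \<in> l2 \<and>
      l2_norm (\<lambda>k. \<Sum>n<M. t (n + N) k) \<le> (\<Sum>n<M. C * q ^ (n + N))" for M N
  proof (induction M)
    case (Suc M)
    then show ?case
      using l2_add[OF conjunct1[OF Suc] t(1)[of "M + N"]] t(2)[of "M + N"] by fastforce
  qed (simp add: l2_zero)
  have sm: "summable (\<lambda>n. t n k)" for k
    by (rule summable_comparison_test'[of "\<lambda>n. C * q ^ n"])
      (use q l2_coord_le[OF t(1)] t(2) order_trans in \<open>auto intro!: summable_mult summable_geometric\<close>, blast)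
  have tail: "L2_set (\<lambda>k. cmod (x k - (\<Sum>n<N. t n k))) {..<m} \<le> C * q ^ N / (1 - q)" for m N
  proof (rule LIMSEQ_le_const2)
    have "(\<lambda>M. \<Sum>n<M. t (n + N) k) \<longlonglongrightarrow> x k - (\<Sum>n<N. t n k)" for k
      unfolding x_def suminf_minus_initial_segment[OF sm, symmetric]
      using summable_LIMSEQ[OF summable_ignore_initial_segment[OF sm, of N]] by simp
    then show "(\<lambda>M. L2_set (\<lambda>k. cmod (\<Sum>n<M. t (n + N) k)) {..<m})
        \<longlonglongrightarrow> L2_set (\<lambda>k. cmod (x k - (\<Sum>n<N. t n k))) {..<m}"
      unfolding L2_set_def by (intro tendsto_intros) auto
    have "L2_set (\<lambda>k. cmod (\<Sum>n<M. t (n + N) k)) {..<m} \<le> C * q ^ N / (1 - q)" for M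
      by (rule order_trans[OF l2_norm_partial[OF conjunct1[OF fin]] order_trans[OF conjunct2[OF fin] sum_q]])
    then show "\<exists>M0. \<forall>M\<ge>M0. L2_set (\<lambda>k. cmod (\<Sum>n<M. t (n + N) k)) {..<m} \<le> C * q ^ N / (1 - q)"
      by blast
  qed
  show "l2_norm (\<lambda>k. x k - (\<Sum>n<N. t n k)) \<le> C * q ^ N / (1 - q)"
    by (rule l2I(2)[OF tail])
  show "x \<in> l2" using l2I(1)[OF tail[where N = 0]] by simp
qed

text \<open>The inverse is \<open>S y = \<Sum> B\<^sup>n y\<close>. Once \<open>S y - B (S y) = y\<close> is known, linearity of \<open>S\<close> and the
  other inverse identity follow from injectivity of \<open>1 - B\<close>, because \<open>B\<close> is a strict contraction.\<close>

theorem neumann_invertible: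
  assumes B: "bounded_operator_l2 B" and q: "q < 1"
    and le: "\<And>x. x \<in> l2 \<Longrightarrow> l2_norm (B x) \<le> q * l2_norm x"
  shows "invertible_l2 (\<lambda>x k. x k - B x k)"
proof -
  define p where "p = max q 0"
  have p: "0 \<le> p" "p < 1" using q by (auto simp: p_def)
  have le: "l2_norm (B x) \<le> p * l2_norm x" if "x \<in> l2" for x
    using le[OF that] mult_right_mono[of q p "l2_norm x"] l2_norm_nonneg[OF that] by (simp add: p_def)
  define t where "t y n = (B ^^ n) y" for y :: "nat \<Rightarrow> complex" and n
  have tl: "t y n \<in> l2 \<and> l2_norm (t y n) \<le> l2_norm y * p ^ n" if "y \<in> l2" for y n
  proof (induction n)
    case (Suc n)
    then show ?case using le[of "t y n"] bounded_opD(1)[OF B, of "t y n"]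
        mult_left_mono[of "l2_norm (t y n)" "l2_norm y * p ^ n" p] p
      by (auto simp: t_def algebra_simps)
  qed (use that in \<open>auto simp: t_def\<close>)
  define S where "S y k = (\<Sum>n. t y n k)" for y k
  have Sl2: "S y \<in> l2" and Slim: "l2_norm (\<lambda>k. S y k - (\<Sum>n<N. t y n k)) \<le> l2_norm y * p ^ N / (1 - p)"
    if "y \<in> l2" for y N
    using l2_geometric_limit[of "t y" "l2_norm y" p] tl[OF that] p unfolding S_def by auto
  have Snorm: "l2_norm (S y) \<le> (1 / (1 - p)) * l2_norm y" if "y \<in> l2" for y
    using Slim[OF that, of 0] by simp
  have finl2: "(\<lambda>k. \<Sum>n<N. t y n k) \<in> l2" if "y \<in> l2" for y N
  proof (induction N)
    case (Suc N) then show ?case using l2_add(1)[OF Suc conjunct1[OF tl[OF that]]] by simp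
  qed (simp add: l2_zero)
  have Bfin: "B (\<lambda>k. \<Sum>n<N. t y n k) = (\<lambda>k. (\<Sum>n<Suc N. t y n k) - y k)" if "y \<in> l2" for y N
  proof (induction N)
    case 0 show ?case using bounded_opD(3)[OF B l2_zero(1), of 0] by (simp add: t_def)
  next
    case (Suc N)
    have "B (\<lambda>k. \<Sum>n<Suc N. t y n k) = (\<lambda>k. B (\<lambda>k. \<Sum>n<N. t y n k) k + B (t y N) k)"
      using bounded_opD(2)[OF B finl2[OF that] conjunct1[OF tl[OF that]]] by simp
    also have "B (t y N) = t y (Suc N)" by (simp add: t_def)
    finally show ?case using Suc by auto
  qed
  have lim: "(\<lambda>N. l2_norm y * p ^ N / (1 - p)) \<longlonglongrightarrow> 0" for y
    using p by (auto intro!: tendsto_eq_intros LIMSEQ_realpow_zero)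
  have conv: "(\<lambda>N. \<Sum>n<N. t y n k) \<longlonglongrightarrow> S y k" if "y \<in> l2" for y k
  proof (rule LIM_zero_cancel, rule Lim_null_comparison[OF _ lim[of y]], rule always_eventually, rule allI)
    fix N
    have "cmod (S y k - (\<Sum>n<N. t y n k)) \<le> l2_norm (\<lambda>k. S y k - (\<Sum>n<N. t y n k))"
      by (rule l2_coord_le[OF l2_diff(1)[OF Sl2[OF that] finl2[OF that]]])
    then show "cmod ((\<Sum>n<N. t y n k) - S y k) \<le> l2_norm y * p ^ N / (1 - p)"
      using Slim[OF that, of N] by (simp add: norm_minus_commute)
  qed
  have BS: "B (S y) k = S y k - y k" if y: "y \<in> l2" for y k
  proof (rule LIMSEQ_unique)
    show "(\<lambda>N. (\<Sum>n<Suc N. t y n k) - y k) \<longlonglongrightarrow> S y k - y k"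
      by (intro tendsto_intros LIMSEQ_Suc[OF conv[OF y]])
    have lim': "(\<lambda>N. p * (l2_norm y * p ^ N / (1 - p))) \<longlonglongrightarrow> 0"
      using tendsto_mult_left[OF lim[of y], of p] by simp
    show "(\<lambda>N. (\<Sum>n<Suc N. t y n k) - y k) \<longlonglongrightarrow> B (S y) k"
    proof (rule LIM_zero_cancel, rule Lim_null_comparison[OF _ lim'], rule always_eventually, rule allI)
      fix N
      note d = l2_diff(1)[OF Sl2[OF y] finl2[OF y, of N]]
      have "B (\<lambda>k. S y k - (\<Sum>n<N. t y n k)) = (\<lambda>k. B (S y) k - ((\<Sum>n<Suc N. t y n k) - y k))"
        using bounded_op_diff[OF B Sl2[OF y] finl2[OF y, of N]] Bfin[OF y, of N] by metis
      then have "cmod (B (S y) k - ((\<Sum>n<Suc N. t y n k) - y k)) \<le> l2_norm (B (\<lambda>k. S y k - (\<Sum>n<N. t y n k)))"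
        using l2_coord_le[OF bounded_opD(1)[OF B d], of k] by metis
      also have "\<dots> \<le> p * l2_norm (\<lambda>k. S y k - (\<Sum>n<N. t y n k))"
        by (rule le[OF d])
      also have "\<dots> \<le> p * (l2_norm y * p ^ N / (1 - p))"
        by (intro mult_left_mono Slim y p)
      finally show "cmod ((\<Sum>n<Suc N. t y n k) - y k - B (S y) k) \<le> p * (l2_norm y * p ^ N / (1 - p))"
        by (simp add: norm_minus_commute)
    qed
  qed
  have inj: "x = y" if "x \<in> l2" "y \<in> l2" "(\<lambda>k. x k - B x k) = (\<lambda>k. y k - B y k)" for x y
  proof -
    note d = l2_diff(1)[OF that(1,2)]
    have "B (\<lambda>k. x k - y k) = (\<lambda>k. x k - y k)"
    proof
      fix k
      have "x k - y k = B x k - B y k" using fun_cong[OF that(3), of k] by (simp add: algebra_simps)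
      then show "B (\<lambda>k. x k - y k) k = x k - y k" using bounded_op_diff[OF B that(1,2)] by simp
    qed
    then have "l2_norm (\<lambda>k. x k - y k) \<le> p * l2_norm (\<lambda>k. x k - y k)"
      using le[OF d] by simp
    then have "l2_norm (\<lambda>k. x k - y k) \<le> 0"
      using p l2_norm_nonneg[OF d] by (metis mult_le_cancel_right1 not_le)
    from fun_cong[OF l2_norm_le_0[OF d this]] show ?thesis by auto
  qed
  have Ml2: "(\<lambda>k. x k - B x k) \<in> l2" if "x \<in> l2" for x
    by (intro l2_diff(1) that bounded_opD(1)[OF B])
  have MS: "(\<lambda>k. S y k - B (S y) k) = y" if "y \<in> l2" for y
    using BS[OF that] by auto
  have SM: "S (\<lambda>k. x k - B x k) = x" if "x \<in> l2" for x
    by (rule inj) (use that Sl2 Ml2 MS in auto)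
  have add: "S (\<lambda>k. x k + y k) = (\<lambda>k. S x k + S y k)" if "x \<in> l2" "y \<in> l2" for x y
  proof (rule inj)
    show "(\<lambda>k. S (\<lambda>k. x k + y k) k - B (S (\<lambda>k. x k + y k)) k) =
        (\<lambda>k. S x k + S y k - B (\<lambda>k. S x k + S y k) k)"
      using MS[OF l2_add(1)[OF that]] bounded_opD(2)[OF B Sl2[OF that(1)] Sl2[OF that(2)]]
        fun_cong[OF MS[OF that(1)]] fun_cong[OF MS[OF that(2)]]
      by (auto simp: fun_eq_iff algebra_simps)
  qed (use that Sl2 l2_add(1) in auto)
  have scale: "S (\<lambda>k. a * x k) = (\<lambda>k. a * S x k)" if "x \<in> l2" for x a
  proof (rule inj)
    show "(\<lambda>k. S (\<lambda>k. a * x k) k - B (S (\<lambda>k. a * x k)) k) = (\<lambda>k. a * S x k - B (\<lambda>k. a * S x k) k)"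
      using MS[OF l2_scale[OF that, of a]] bounded_opD(3)[OF B Sl2[OF that], of a]
        fun_cong[OF MS[OF that]]
      by (auto simp: fun_eq_iff right_diff_distrib[symmetric])
  qed (use that Sl2 l2_scale in auto)
  have "bounded_operator_l2 S"
    unfolding bounded_operator_l2_def
    using Sl2 add scale Snorm by blast
  then show ?thesis
    unfolding invertible_l2_def using MS SM by blast
qed

text \<open>With \<open>S = A\<^sup>-\<^sup>1\<close> one has \<open>A' = A (1 - S (A - A'))\<close>, and the second factor is
  a Neumann series as soon as \<open>A - A'\<close> is smaller than \<open>1 / (2 \<parallel>S\<parallel>)\<close>.\<close>

lemma invertible_l2_perturb:
  assumes A: "invertible_l2 A" "bounded_operator_l2 A"
  obtains \<eta> where "\<eta> > 0"
    "\<And>A'. bounded_operator_l2 A' \<Longrightarrow>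
       (\<And>x. x \<in> l2 \<Longrightarrow> l2_norm (\<lambda>k. A x k - A' x k) \<le> \<eta> * l2_norm x) \<Longrightarrow> invertible_l2 A'"
proof -
  obtain S where S: "bounded_operator_l2 S"
    "\<And>x. x \<in> l2 \<Longrightarrow> S (A x) = x" "\<And>x. x \<in> l2 \<Longrightarrow> A (S x) = x"
    using invertible_l2_inverse[OF A] by metis
  obtain K where K: "K > 0" "\<And>x. x \<in> l2 \<Longrightarrow> l2_norm (S x) \<le> K * l2_norm x"
    using bounded_op_norm[OF S(1)] by blast
  have main: "invertible_l2 A'"
    if A': "bounded_operator_l2 A'"
      and le: "\<And>x. x \<in> l2 \<Longrightarrow> l2_norm (\<lambda>k. A x k - A' x k) \<le> 1 / (2 * K) * l2_norm x" for A'
  proof -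
    define D where "D x k = A x k - A' x k" for x k
    have D: "bounded_operator_l2 D"
      using bounded_op_lincomb[OF A(2) A', of 1 "-1"] unfolding D_def[abs_def] by simp
    have "invertible_l2 (\<lambda>x k. x k - S (D x) k)"
    proof (rule neumann_invertible[OF bounded_op_comp[OF S(1) D]])
      fix x assume x: "x \<in> l2"
      have "l2_norm (S (D x)) \<le> K * l2_norm (D x)"
        by (rule K(2)[OF bounded_opD(1)[OF D x]])
      also have "\<dots> \<le> K * (1 / (2 * K) * l2_norm x)"
        using le[OF x] K(1) by (intro mult_left_mono) (auto simp: D_def[abs_def])
      finally show "l2_norm (S (D x)) \<le> 1 / 2 * l2_norm x" using K(1) by simp
    qed simp
    moreover have "(\<lambda>k. x k - S (D x) k) \<in> l2" if "x \<in> l2" for x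
      by (intro l2_diff(1) that bounded_opD(1)[OF S(1)] bounded_opD(1)[OF D])
    ultimately have "invertible_l2 (\<lambda>x. A (\<lambda>k. x k - S (D x) k))"
      using invertible_l2_comp[OF A(1)] by blast
    moreover have "A (\<lambda>k. x k - S (D x) k) = A' x" if x: "x \<in> l2" for x
      using bounded_op_diff[OF A(2) x bounded_opD(1)[OF S(1) bounded_opD(1)[OF D x]]]
        S(3)[OF bounded_opD(1)[OF D x]] by (simp add: D_def)
    ultimately show ?thesis
      using invertible_l2_cong[of "\<lambda>x. A (\<lambda>k. x k - S (D x) k)" A'] by simp
  qed
  show ?thesis
    by (rule that[of "1 / (2 * K)"]) (use K(1) in simp, rule main, simp_all)
qed

section \<open>Fourier coefficients\<close>

lemma circle_cont_cis:
  assumes "continuous_on (sphere 0 1) a" shows "continuous_on S (\<lambda>v. a (cis v))"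
  by (rule continuous_on_compose2[OF assms]) (auto intro!: continuous_intros)

lemma circle_integrable:
  fixes F :: "real \<Rightarrow> 'a::euclidean_space"
  assumes "continuous_on {0..2 * pi} F" shows "F integrable_on {0..2 * pi}"
  by (rule integrable_continuous_interval[OF assms])

lemma fourier_coeff_cong:
  assumes "\<And>t. cmod t = 1 \<Longrightarrow> a t = a' t"
  shows "fourier_coeff a k = fourier_coeff a' k"
  unfolding fourier_coeff_def using assms by simp

lemma toeplitz_cong:
  assumes "\<And>t. cmod t = 1 \<Longrightarrow> a t = a' t"
  shows "toeplitz a = toeplitz a'"
  unfolding toeplitz_def using fourier_coeff_cong[of a a'] assms by presburger

lemma fourier_coeff_lincomb:
  assumes "continuous_on (sphere 0 1) a" "continuous_on (sphere 0 1) a'"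
  shows "fourier_coeff (\<lambda>t. x * a t + y * a' t) k = x * fourier_coeff a k + y * fourier_coeff a' k"
proof -
  have "integral {0..2*pi} (\<lambda>v. (x * a (cis v) + y * a' (cis v)) * cis (- (of_int k * v))) =
        integral {0..2*pi} (\<lambda>v. x * (a (cis v) * cis (- (of_int k * v))) + y * (a' (cis v) * cis (- (of_int k * v))))"
    by (simp add: algebra_simps)
  also have "\<dots> = x * integral {0..2*pi} (\<lambda>v. a (cis v) * cis (- (of_int k * v)))
      + y * integral {0..2*pi} (\<lambda>v. a' (cis v) * cis (- (of_int k * v)))"
    by (subst integral_add)
      ((intro circle_integrable continuous_intros circle_cont_cis assms)+, simp)
  finally show ?thesis by (simp add: fourier_coeff_def field_simps)
qed

lemma fourier_coeff_powi:
  "fourier_coeff (\<lambda>t. t powi m * a t) k = fourier_coeff a (k - m)"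
proof -
  have "cis v powi m * a (cis v) * cis (- (of_int k * v)) = a (cis v) * cis (- (of_int (k - m) * v))" for v
    by (simp add: cis_power_int cis_mult algebra_simps)
  then show ?thesis unfolding fourier_coeff_def by presburger
qed

lemma integral_cis_int:
  "integral {0..2*pi} (\<lambda>v. cis (of_int n * v)) = (if n = 0 then of_real (2 * pi) else 0)"
proof (cases "n = 0")
  case False
  have "((\<lambda>v. cis (of_int n * v)) has_integral
      (cis (of_int n * (2*pi)) / (\<i> * of_int n) - cis (of_int n * 0) / (\<i> * of_int n))) {0..2*pi}"
  proof (rule fundamental_theorem_of_calculus)
    fix v assume "v \<in> {0..2*pi}"
    have "((\<lambda>z. exp (\<i> * of_int n * z) / (\<i> * of_int n)) has_field_derivative exp (\<i> * of_int n * of_real v)) (at (of_real v))"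
      using False by (auto intro!: derivative_eq_intros)
    from has_vector_derivative_real_field[OF this]
    show "((\<lambda>v. cis (of_int n * v) / (\<i> * of_int n)) has_vector_derivative cis (of_int n * v)) (at v within {0..2*pi})"
      by (simp add: cis_conv_exp mult.assoc)
  qed simp
  moreover have "cis (of_int n * (2*pi)) = 1"
    using cis_multiple_2pi[of "of_int n"] by (simp add: mult.commute mult.left_commute)
  ultimately show ?thesis using False by (simp add: integral_unique)
qed (simp add: scaleR_conv_of_real)

lemma fourier_coeff_const: "fourier_coeff (\<lambda>t. c) k = (if k = 0 then c else 0)"
proof -
  have "integral {0..2*pi} (\<lambda>v. c * cis (- (of_int k * v))) = c * integral {0..2*pi} (\<lambda>v. cis (of_int (-k) * v))"
    by simp
  also have "\<dots> = c * (if k = 0 then of_real (2 * pi) else 0)"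
    by (subst integral_cis_int) auto
  finally have "integral {0..2*pi} (\<lambda>v. c * cis (- (of_int k * v))) = c * (if k = 0 then of_real (2 * pi) else 0)" .
  then show ?thesis unfolding fourier_coeff_def by (simp del: integral_mult_right integral_cmul)
qed

section \<open>Bessel's inequality and the norm of a Toeplitz operator\<close>

lemma trig_poly_inner:
  fixes x y :: "nat \<Rightarrow> complex"
  shows "integral {0..2*pi} (\<lambda>v. (\<Sum>k<n. x k * cis (real k * v)) * cnj (\<Sum>k<n. y k * cis (real k * v)))
    = of_real (2*pi) * (\<Sum>k<n. x k * cnj (y k))"
proof -
  have "integral {0..2*pi} (\<lambda>v. (\<Sum>k<n. x k * cis (real k * v)) * cnj (\<Sum>k<n. y k * cis (real k * v)))
     = integral {0..2*pi} (\<lambda>v. \<Sum>k<n. \<Sum>l<n. (x k * cnj (y l)) * cis (of_int (int k - int l) * v))"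
    by (simp add: sum_product cis_cnj cis_mult algebra_simps)
  also have "\<dots> = (\<Sum>k<n. \<Sum>l<n. (x k * cnj (y l)) * integral {0..2*pi} (\<lambda>v. cis (of_int (int k - int l) * v)))"
    by (subst integral_sum, force, intro circle_integrable continuous_intros)
      (intro sum.cong refl, subst integral_sum, force, intro circle_integrable continuous_intros, simp)
  also have "\<dots> = (\<Sum>k<n. \<Sum>l<n. if k = l then (x k * cnj (y l)) * of_real (2*pi) else 0)"
    by (intro sum.cong refl, subst integral_cis_int) auto
  also have "\<dots> = of_real (2*pi) * (\<Sum>k<n. x k * cnj (y k))"
    by (simp add: sum_distrib_left algebra_simps)
  finally show ?thesis .
qed

lemma integral_cmod_square:
  assumes "continuous_on {0..2*pi} F"
  shows "integral {0..2*pi} (\<lambda>v. F v * cnj (F v)) = of_real (integral {0..2*pi} (\<lambda>v. (cmod (F v))\<^sup>2))"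
proof -
  have i: "(\<lambda>v. (cmod (F v))\<^sup>2) integrable_on {0..2*pi}"
    by (intro circle_integrable continuous_intros assms)
  have "((\<lambda>v. of_real ((cmod (F v))\<^sup>2)) has_integral complex_of_real (integral {0..2*pi} (\<lambda>v. (cmod (F v))\<^sup>2))) {0..2*pi}"
    by (intro has_integral_of_real integrable_integral i)
  from integral_unique[OF this] show ?thesis by (simp only: complex_norm_square)
qed

text \<open>The mean square of \<open>F - P\<close> is non-negative, where \<open>P\<close> is the orthogonal projection of \<open>F\<close> to the
  span of the characters \<open>0, \<dots>, m - 1\<close>.\<close>

lemma bessel_inequality:
  assumes F: "continuous_on {0..2*pi} F"
  shows "2 * pi * (\<Sum>j<m. (cmod (integral {0..2*pi} (\<lambda>v. F v * cis (- (real j * v))) / of_real (2*pi)))\<^sup>2)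
    \<le> integral {0..2*pi} (\<lambda>v. (cmod (F v))\<^sup>2)"
proof -
  define y where "y j = integral {0..2*pi} (\<lambda>v. F v * cis (- (real j * v))) / of_real (2*pi)" for j
  define P where "P v = (\<Sum>j<m. y j * cis (real j * v))" for v
  have P: "continuous_on {0..2*pi} P" unfolding P_def by (intro continuous_intros)
  have intF: "integral {0..2*pi} (\<lambda>v. F v * cis (- (real j * v))) = of_real (2*pi) * y j" for j
    by (simp add: y_def)
  have FP: "integral {0..2*pi} (\<lambda>v. F v * cnj (P v)) = of_real (2*pi) * (\<Sum>j<m. y j * cnj (y j))"
  proof -
    have "integral {0..2*pi} (\<lambda>v. F v * cnj (P v)) = integral {0..2*pi} (\<lambda>v. \<Sum>j<m. cnj (y j) * (F v * cis (- (real j * v))))"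
      by (simp add: P_def sum_distrib_left cis_cnj algebra_simps)
    also have "\<dots> = (\<Sum>j<m. cnj (y j) * (of_real (2*pi) * y j))"
      by (subst integral_sum, force, intro circle_integrable continuous_intros F)
        (simp add: intF)
    finally show ?thesis by (simp add: sum_distrib_left algebra_simps)
  qed
  have PF: "integral {0..2*pi} (\<lambda>v. P v * cnj (F v)) = of_real (2*pi) * (\<Sum>j<m. y j * cnj (y j))"
  proof -
    have "integral {0..2*pi} (\<lambda>v. P v * cnj (F v)) = cnj (integral {0..2*pi} (\<lambda>v. F v * cnj (P v)))"
      by (simp add: integral_cnj mult.commute)
    also have "\<dots> = of_real (2*pi) * (\<Sum>j<m. y j * cnj (y j))"
      unfolding FP by (simp add: mult.commute)
    finally show ?thesis .
  qed
  have PP: "integral {0..2*pi} (\<lambda>v. P v * cnj (P v)) = of_real (2*pi) * (\<Sum>j<m. y j * cnj (y j))"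
    unfolding P_def by (rule trig_poly_inner)
  have "of_real (integral {0..2*pi} (\<lambda>v. (cmod (F v - P v))\<^sup>2)) =
      integral {0..2*pi} (\<lambda>v. (F v - P v) * cnj (F v - P v))"
    by (rule integral_cmod_square[symmetric]) (intro continuous_intros F P)
  also have "\<dots> = integral {0..2*pi} (\<lambda>v. F v * cnj (F v) - F v * cnj (P v) - P v * cnj (F v) + P v * cnj (P v))"
    by (simp add: algebra_simps)
  also have "\<dots> = integral {0..2*pi} (\<lambda>v. F v * cnj (F v)) - of_real (2*pi) * (\<Sum>j<m. y j * cnj (y j))"
    by (subst integral_add integral_diff, intro circle_integrable continuous_intros F P,
        intro circle_integrable continuous_intros F P)+ (simp add: FP PF PP)
  also have "\<dots> = of_real (integral {0..2*pi} (\<lambda>v. (cmod (F v))\<^sup>2) - 2*pi * (\<Sum>j<m. (cmod (y j))\<^sup>2))"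
    unfolding integral_cmod_square[OF F] by (simp flip: complex_norm_square)
  finally have "integral {0..2*pi} (\<lambda>v. (cmod (F v - P v))\<^sup>2) =
      integral {0..2*pi} (\<lambda>v. (cmod (F v))\<^sup>2) - 2*pi * (\<Sum>j<m. (cmod (y j))\<^sup>2)"
    using of_real_eq_iff by blast
  moreover have "0 \<le> integral {0..2*pi} (\<lambda>v. (cmod (F v - P v))\<^sup>2)"
    by (intro integral_nonneg circle_integrable continuous_intros F P) auto
  ultimately show ?thesis by (simp add: y_def)
qed

text \<open>The finite sum is the \<open>j\<close>-th Fourier coefficient of \<open>a p\<close>, where \<open>p\<close> is the trigonometric polynomial
  with coefficients \<open>x\<close>. Bessel's inequality for \<open>a p\<close> and Parseval's identity for \<open>p\<close> give the bound.\<close>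

lemma toeplitz_section_bound:
  assumes a: "continuous_on (sphere 0 1) a" and M: "\<And>t. cmod t = 1 \<Longrightarrow> cmod (a t) \<le> M"
  shows "L2_set (\<lambda>j. cmod (\<Sum>k<n. fourier_coeff a (int j - int k) * x k)) {..<m}
    \<le> M * L2_set (\<lambda>k. cmod (x k)) {..<n}"
proof -
  have M0: "0 \<le> M" using M[of 1] norm_ge_zero[of "a 1"] by (simp del: norm_ge_zero)
  define p where "p v = (\<Sum>k<n. x k * cis (real k * v))" for v
  define F where "F v = a (cis v) * p v" for v
  have p: "continuous_on {0..2*pi} p" unfolding p_def by (intro continuous_intros)
  have F: "continuous_on {0..2*pi} F"
    unfolding F_def by (intro continuous_intros p circle_cont_cis a)
  have coeff: "integral {0..2*pi} (\<lambda>v. F v * cis (- (real j * v))) / of_real (2*pi) =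
      (\<Sum>k<n. fourier_coeff a (int j - int k) * x k)" for j
  proof -
    have "integral {0..2*pi} (\<lambda>v. F v * cis (- (real j * v))) =
      integral {0..2*pi} (\<lambda>v. \<Sum>k<n. x k * (a (cis v) * cis (- (of_int (int j - int k) * v))))"
    proof (rule integral_cong)
      fix v
      have "cis (real k * v) * cis (- (real j * v)) = cis (- (of_int (int j - int k) * v))" for k
        by (simp add: cis_mult algebra_simps)
      then have "x k * cis (real k * v) * a (cis v) * cis (- (real j * v)) =
          x k * (a (cis v) * cis (- (of_int (int j - int k) * v)))" for k
        by (metis (no_types, opaque_lifting) mult.assoc mult.commute)
      then show "F v * cis (- (real j * v)) = (\<Sum>k<n. x k * (a (cis v) * cis (- (of_int (int j - int k) * v))))"
        unfolding F_def p_def sum_distrib_left sum_distrib_right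
        by (intro sum.cong refl) (simp add: mult.commute mult.left_commute)
    qed
    also have "\<dots> = (\<Sum>k<n. x k * integral {0..2*pi} (\<lambda>v. a (cis v) * cis (- (of_int (int j - int k) * v))))"
      by (subst integral_sum, force, intro circle_integrable continuous_intros circle_cont_cis a, simp)
    finally show ?thesis
      by (simp add: fourier_coeff_def sum_divide_distrib mult.commute)
  qed
  have "2 * pi * (\<Sum>j<m. (cmod (\<Sum>k<n. fourier_coeff a (int j - int k) * x k))\<^sup>2)
      \<le> integral {0..2*pi} (\<lambda>v. (cmod (F v))\<^sup>2)"
    using bessel_inequality[OF F, of m] unfolding coeff .
  also have "\<dots> \<le> integral {0..2*pi} (\<lambda>v. M\<^sup>2 * (cmod (p v))\<^sup>2)"
  proof (rule integral_le)
    fix v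
    show "(cmod (F v))\<^sup>2 \<le> M\<^sup>2 * (cmod (p v))\<^sup>2"
      unfolding F_def norm_mult power_mult_distrib
      by (intro mult_right_mono power_mono M) auto
  qed (intro circle_integrable continuous_intros F p)+
  also have "\<dots> = M\<^sup>2 * (2 * pi * (\<Sum>k<n. (cmod (x k))\<^sup>2))"
  proof -
    have "complex_of_real (integral {0..2*pi} (\<lambda>v. (cmod (p v))\<^sup>2)) = of_real (2*pi) * (\<Sum>k<n. x k * cnj (x k))"
      unfolding integral_cmod_square[OF p, symmetric] unfolding p_def by (rule trig_poly_inner)
    also have "\<dots> = of_real (2*pi * (\<Sum>k<n. (cmod (x k))\<^sup>2))"
      by (simp flip: complex_norm_square)
    finally show ?thesis unfolding of_real_eq_iff by simp
  qed
  finally have "(\<Sum>j<m. (cmod (\<Sum>k<n. fourier_coeff a (int j - int k) * x k))\<^sup>2) \<le> M\<^sup>2 * (\<Sum>k<n. (cmod (x k))\<^sup>2)"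
    by (simp add: mult.left_commute[of "M\<^sup>2"] mult.assoc)
  then have "sqrt (\<Sum>j<m. (cmod (\<Sum>k<n. fourier_coeff a (int j - int k) * x k))\<^sup>2)
     \<le> sqrt (M\<^sup>2 * (\<Sum>k<n. (cmod (x k))\<^sup>2))"
    by simp
  then show ?thesis using M0 by (simp add: L2_set_def real_sqrt_mult)
qed

text \<open>Bessel's inequality for the conjugate of \<open>a(t) t\<^sup>-\<^sup>j\<close> shows that the row \<open>k \<mapsto> a\<^sub>j\<^sub>-\<^sub>k\<close> is square-summable.\<close>

lemma toeplitz_summable:
  assumes a: "continuous_on (sphere 0 1) a" and x: "x \<in> l2"
  shows "summable (\<lambda>k. fourier_coeff a (int j - int k) * x k)"
proof -
  define F where "F v = cnj (a (cis v) * cis (- (real j * v)))" for v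
  have F: "continuous_on {0..2*pi} F"
    unfolding F_def by (intro continuous_intros circle_cont_cis a)
  have coeff: "integral {0..2*pi} (\<lambda>v. F v * cis (- (real k * v))) / of_real (2*pi) =
      cnj (fourier_coeff a (int j - int k))" for k
  proof -
    have "F v * cis (- (real k * v)) = cnj (a (cis v) * cis (- (of_int (int j - int k) * v)))" for v
      unfolding F_def by (simp add: cis_cnj cis_mult algebra_simps)
    then show ?thesis by (simp add: integral_cnj fourier_coeff_def)
  qed
  define C where "C = integral {0..2*pi} (\<lambda>v. (cmod (F v))\<^sup>2)"
  have "(\<Sum>k<n. (cmod (fourier_coeff a (int j - int k)))\<^sup>2) \<le> C / (2*pi)" for n
    using bessel_inequality[OF F, of n] unfolding coeff C_def
    by (simp add: field_simps)
  then have sa: "summable (\<lambda>k. (cmod (fourier_coeff a (int j - int k)))\<^sup>2)"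
    by (intro summableI_nonneg_bounded[where x = "C / (2*pi)"]) auto
  have sx: "summable (\<lambda>k. (cmod (x k))\<^sup>2)" using x by (simp add: l2_def)
  have "norm (fourier_coeff a (int j - int k) * x k) \<le>
      (cmod (fourier_coeff a (int j - int k)))\<^sup>2 + (cmod (x k))\<^sup>2" for k
  proof -
    have "2 * (u * v) \<le> u\<^sup>2 + v\<^sup>2 \<and> 0 \<le> u\<^sup>2 + v\<^sup>2" for u v :: real
      using sum_squares_bound[of u v] by simp
    then show ?thesis unfolding norm_mult
      by (smt (verit) power2_diff zero_le_power2)
  qed
  then show ?thesis
    by (intro summable_comparison_test'[OF summable_add[OF sa sx], of 0]) auto
qed

lemma toeplitz_bounded:
  assumes a: "continuous_on (sphere 0 1) a" and M: "\<And>t. cmod t = 1 \<Longrightarrow> cmod (a t) \<le> M"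
    and x: "x \<in> l2"
  shows "toeplitz a x \<in> l2" and "l2_norm (toeplitz a x) \<le> M * l2_norm x"
proof -
  have M0: "0 \<le> M" using M[of 1] norm_ge_zero[of "a 1"] by (simp del: norm_ge_zero)
  have "L2_set (\<lambda>j. cmod (toeplitz a x j)) {..<m} \<le> M * l2_norm x" for m
  proof (rule LIMSEQ_le_const2)
    show "(\<lambda>n. L2_set (\<lambda>j. cmod (\<Sum>k<n. fourier_coeff a (int j - int k) * x k)) {..<m})
      \<longlonglongrightarrow> L2_set (\<lambda>j. cmod (toeplitz a x j)) {..<m}"
      unfolding L2_set_def toeplitz_def
      by (intro tendsto_intros summable_LIMSEQ toeplitz_summable a x)
    have "L2_set (\<lambda>j. cmod (\<Sum>k<n. fourier_coeff a (int j - int k) * x k)) {..<m} \<le> M * l2_norm x" for n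
      using toeplitz_section_bound[OF a M, of x n m] mult_left_mono[OF l2_norm_partial[OF x, of n] M0]
      by simp
    then show "\<exists>N. \<forall>n\<ge>N. L2_set (\<lambda>j. cmod (\<Sum>k<n. fourier_coeff a (int j - int k) * x k)) {..<m} \<le> M * l2_norm x"
      by blast
  qed
  from l2I[of "toeplitz a x", OF this] show "toeplitz a x \<in> l2" "l2_norm (toeplitz a x) \<le> M * l2_norm x"
    by auto
qed

lemma toeplitz_bounded_operator:
  assumes a: "continuous_on (sphere 0 1) a"
  shows "bounded_operator_l2 (toeplitz a)"
proof -
  have "compact (a ` sphere 0 1)"
    by (intro compact_continuous_image a) auto
  then obtain M where M: "\<And>t. cmod t = 1 \<Longrightarrow> cmod (a t) \<le> M"
    using compact_imp_bounded[of "a ` sphere 0 1"] unfolding bounded_iff by (metis imageI mem_sphere_0)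
  have "toeplitz a (\<lambda>k. x k + y k) = (\<lambda>k. toeplitz a x k + toeplitz a y k)" if "x \<in> l2" "y \<in> l2" for x y
    unfolding toeplitz_def
    by (simp add: suminf_add[OF toeplitz_summable[OF a that(1)] toeplitz_summable[OF a that(2)]] distrib_left)
  moreover have "toeplitz a (\<lambda>k. c * x k) = (\<lambda>k. c * toeplitz a x k)" if "x \<in> l2" for x c
    unfolding toeplitz_def
    by (simp add: suminf_mult[OF toeplitz_summable[OF a that], symmetric] mult.left_commute)
  ultimately show ?thesis
    unfolding bounded_operator_l2_def using toeplitz_bounded[OF a M] by blast
qed

lemma toeplitz_lincomb:
  assumes a: "continuous_on (sphere 0 1) a" "continuous_on (sphere 0 1) a'" and x: "x \<in> l2"
  shows "toeplitz (\<lambda>t. p * a t + q * a' t) x j = p * toeplitz a x j + q * toeplitz a' x j"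
proof -
  note s = toeplitz_summable[OF a(1) x, of j] toeplitz_summable[OF a(2) x, of j]
  have "(\<Sum>k. p * (fourier_coeff a (int j - int k) * x k) + q * (fourier_coeff a' (int j - int k) * x k)) =
     p * (\<Sum>k. fourier_coeff a (int j - int k) * x k) + q * (\<Sum>k. fourier_coeff a' (int j - int k) * x k)"
    using s by (simp add: suminf_add[symmetric] suminf_mult summable_mult)
  then show ?thesis
    unfolding toeplitz_def fourier_coeff_lincomb[OF a] by (simp add: algebra_simps)
qed

lemma toeplitz_const: "toeplitz (\<lambda>t. \<mu>) x = (\<lambda>j. \<mu> * x j)"
proof
  fix j
  have "toeplitz (\<lambda>t. \<mu>) x j = (\<Sum>k. if k = j then \<mu> * x k else 0)"
    unfolding toeplitz_def fourier_coeff_const by (intro suminf_cong) auto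
  also have "\<dots> = \<mu> * x j"
    using suminf_finite[of "{j}" "\<lambda>k. if k = j then \<mu> * x k else 0"] by simp
  finally show "toeplitz (\<lambda>t. \<mu>) x j = \<mu> * x j" .
qed

lemma toeplitz_minus_scalar:
  assumes a: "continuous_on (sphere 0 1) a" and x: "x \<in> l2"
  shows "(\<lambda>j. toeplitz a x j - \<mu> * x j) = toeplitz (\<lambda>t. a t - \<mu>) x"
  using toeplitz_lincomb[OF a continuous_on_const x, of 1 "-1" \<mu>]
  by (simp add: toeplitz_const fun_eq_iff)

text \<open>Subtracting \<open>\<mu>\<close> from the operator is subtracting it from the symbol, so that spectra need not be
  mentioned until the end: everything is about invertibility of Toeplitz operators.\<close>

lemma not_in_toeplitz_spectrum_iff:
  assumes a: "continuous_on (sphere 0 1) a"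
  shows "\<mu> \<notin> spectrum_l2 (toeplitz a) \<longleftrightarrow> invertible_l2 (toeplitz (\<lambda>t. a t - \<mu>))"
  unfolding not_in_spectrum_iff
  by (rule invertible_l2_cong) (rule toeplitz_minus_scalar[OF a])

lemma toeplitz_invertible_perturb:
  assumes a: "continuous_on (sphere 0 1) a" and inv: "invertible_l2 (toeplitz a)"
  obtains \<eta> where "\<eta> > 0"
    "\<And>a'. continuous_on (sphere 0 1) a' \<Longrightarrow> (\<And>t. cmod t = 1 \<Longrightarrow> cmod (a t - a' t) \<le> \<eta>) \<Longrightarrow>
       invertible_l2 (toeplitz a')"
proof -
  obtain \<eta> where \<eta>: "\<eta> > 0" "\<And>A'. bounded_operator_l2 A' \<Longrightarrow>
       (\<And>x. x \<in> l2 \<Longrightarrow> l2_norm (\<lambda>k. toeplitz a x k - A' x k) \<le> \<eta> * l2_norm x) \<Longrightarrow> invertible_l2 A'"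
    using invertible_l2_perturb[OF inv toeplitz_bounded_operator[OF a]] by blast
  show ?thesis
  proof (rule that[OF \<eta>(1)])
    fix a' assume a': "continuous_on (sphere 0 1) a'" "\<And>t. cmod t = 1 \<Longrightarrow> cmod (a t - a' t) \<le> \<eta>"
    show "invertible_l2 (toeplitz a')"
    proof (rule \<eta>(2)[OF toeplitz_bounded_operator[OF a'(1)]])
      fix x assume x: "x \<in> l2"
      have "(\<lambda>k. toeplitz a x k - toeplitz a' x k) = toeplitz (\<lambda>t. a t - a' t) x"
        using toeplitz_lincomb[OF a a'(1) x, of 1 "-1"] by (simp add: fun_eq_iff)
      then show "l2_norm (\<lambda>k. toeplitz a x k - toeplitz a' x k) \<le> \<eta> * l2_norm x"
        using toeplitz_bounded(2)[of "\<lambda>t. a t - a' t" \<eta> x] a a' x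
        by (simp add: continuous_on_diff)
    qed
  qed
qed

lemma toeplitz_invertible_near_one:
  assumes a: "continuous_on (sphere 0 1) a" and q: "q < 1"
    and le: "\<And>t. cmod t = 1 \<Longrightarrow> cmod (a t - 1) \<le> q"
  shows "invertible_l2 (toeplitz a)"
proof -
  have a1: "continuous_on (sphere 0 1) (\<lambda>t. 1 - a t)" by (intro continuous_intros a)
  have "invertible_l2 (\<lambda>x k. x k - toeplitz (\<lambda>t. 1 - a t) x k)"
    by (rule neumann_invertible[OF toeplitz_bounded_operator[OF a1] q])
      (rule toeplitz_bounded(2)[OF a1], simp_all add: le norm_minus_commute[of 1])
  moreover have "(\<lambda>k. x k - toeplitz (\<lambda>t. 1 - a t) x k) = toeplitz a x" if "x \<in> l2" for x
    using toeplitz_lincomb[OF continuous_on_const a that, of 1 1 "-1"] by (simp add: toeplitz_const fun_eq_iff)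
  ultimately show ?thesis using invertible_l2_cong[of "\<lambda>x k. x k - toeplitz (\<lambda>t. 1 - a t) x k" "toeplitz a"] by simp
qed

section \<open>The index of a symbol with explicit zeros\<close>

definition shift :: "nat \<Rightarrow> (nat \<Rightarrow> complex) \<Rightarrow> nat \<Rightarrow> complex" where
  "shift n x = (\<lambda>k. if k < n then 0 else x (k - n))"

lemma shift_l2:
  assumes "x \<in> l2" shows "shift n x \<in> l2" "l2_norm (shift n x) = l2_norm x"
proof -
  have eq: "(\<lambda>k. (cmod (shift n x (k + n)))\<^sup>2) = (\<lambda>k. (cmod (x k))\<^sup>2)"
    by (simp add: shift_def)
  have s: "summable (\<lambda>k. (cmod (shift n x k))\<^sup>2)"
    using assms summable_iff_shift[of "\<lambda>k. (cmod (shift n x k))\<^sup>2" n] unfolding eq l2_def by simp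
  then show "shift n x \<in> l2" by (simp add: l2_def)
  have "(\<Sum>k<n. (cmod (shift n x k))\<^sup>2) = 0" by (simp add: shift_def)
  then show "l2_norm (shift n x) = l2_norm x"
    using suminf_split_initial_segment[OF s, of n] unfolding eq l2_norm_def by simp
qed

lemma backshift_l2:
  assumes "x \<in> l2" shows "(\<lambda>k. x (k + n)) \<in> l2" "l2_norm (\<lambda>k. x (k + n)) \<le> l2_norm x"
proof -
  have s: "summable (\<lambda>k. (cmod (x k))\<^sup>2)" using assms by (simp add: l2_def)
  then have s': "summable (\<lambda>k. (cmod (x (k + n)))\<^sup>2)" using summable_iff_shift[of "\<lambda>k. (cmod (x k))\<^sup>2" n] by simp
  then show "(\<lambda>k. x (k + n)) \<in> l2" by (simp add: l2_def)
  have "(\<Sum>k. (cmod (x (k + n)))\<^sup>2) \<le> (\<Sum>k. (cmod (x k))\<^sup>2)"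
    using suminf_split_initial_segment[OF s, of n] by (simp add: sum_nonneg)
  then show "l2_norm (\<lambda>k. x (k + n)) \<le> l2_norm x" unfolding l2_norm_def by simp
qed

lemma bounded_op_shift: "bounded_operator_l2 (shift n)"
  unfolding bounded_operator_l2_def
  using shift_l2 by (auto simp: shift_def fun_eq_iff intro!: exI[of _ 1])

lemma bounded_op_backshift: "bounded_operator_l2 (\<lambda>x k. x (k + n))"
  unfolding bounded_operator_l2_def
  using backshift_l2 by (auto intro!: exI[of _ 1])

lemma invertible_scalar_minus:
  assumes B: "bounded_operator_l2 B" "\<And>x. x \<in> l2 \<Longrightarrow> l2_norm (B x) \<le> l2_norm x" and u: "cmod u < 1"
  shows "invertible_l2 (\<lambda>x k. x k - u * B x k)" "bounded_operator_l2 (\<lambda>x k. x k - u * B x k)"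
proof -
  show "invertible_l2 (\<lambda>x k. x k - u * B x k)"
  proof (rule neumann_invertible[OF _ u])
    show "bounded_operator_l2 (\<lambda>x k. u * B x k)"
      using bounded_op_lincomb[OF B(1) B(1), of u 0] by simp
    fix x assume x: "x \<in> l2"
    show "l2_norm (\<lambda>k. u * B x k) \<le> cmod u * l2_norm x"
      using l2_norm_scale[OF bounded_opD(1)[OF B(1) x], of u] mult_left_mono[OF B(2)[OF x], of "cmod u"]
      by simp
  qed
  show "bounded_operator_l2 (\<lambda>x k. x k - u * B x k)"
    using bounded_op_lincomb[OF bounded_op_id B(1), of 1 "-u"] by simp
qed

lemma toeplitz_times_power:
  assumes a: "continuous_on (sphere 0 1) a" and x: "x \<in> l2"
  shows "toeplitz (\<lambda>t. t powi int n * a t) x = toeplitz a (shift n x)"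
proof
  fix j
  have "(\<Sum>k. fourier_coeff a (int j - int k) * shift n x k) =
     (\<Sum>k. fourier_coeff a (int j - int (k + n)) * shift n x (k + n)) + (\<Sum>k<n. fourier_coeff a (int j - int k) * shift n x k)"
    by (rule suminf_split_initial_segment[OF toeplitz_summable[OF a shift_l2(1)[OF x]]])
  also have "(\<Sum>k<n. fourier_coeff a (int j - int k) * shift n x k) = 0"
    by (simp add: shift_def)
  finally show "toeplitz (\<lambda>t. t powi int n * a t) x j = toeplitz a (shift n x) j"
    by (simp only: toeplitz_def fourier_coeff_powi) (simp add: shift_def algebra_simps)
qed

lemma toeplitz_times_neg_power:
  "toeplitz (\<lambda>t. t powi (- int n) * a t) x = (\<lambda>j. toeplitz a x (j + n))"
  by (simp only: toeplitz_def fourier_coeff_powi) (simp add: algebra_simps)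

lemma toeplitz_scale_invertible:
  assumes a: "continuous_on (sphere 0 1) a" and C: "C \<noteq> 0" and inv: "invertible_l2 (toeplitz a)"
  shows "invertible_l2 (toeplitz (\<lambda>t. C * a t))"
proof -
  have "invertible_l2 (\<lambda>x k. C * x k)"
    unfolding invertible_l2_def
    by (rule exI[of _ "\<lambda>x k. inverse C * x k"])
      (use bounded_op_lincomb[OF bounded_op_id bounded_op_id, of "inverse C" 0] C in \<open>auto simp: mult.assoc[symmetric]\<close>)
  from invertible_l2_comp[OF this inv bounded_opD(1)[OF toeplitz_bounded_operator[OF a]]]
  have "invertible_l2 (\<lambda>x k. C * toeplitz a x k)" .
  moreover have "(\<lambda>k. C * toeplitz a x k) = toeplitz (\<lambda>t. C * a t) x" if "x \<in> l2" for x
    using toeplitz_lincomb[OF a a that, of C 0] by (simp add: fun_eq_iff)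
  ultimately show ?thesis
    using invertible_l2_cong[of "\<lambda>x k. C * toeplitz a x k" "toeplitz (\<lambda>t. C * a t)"] by simp
qed

text \<open>\<open>T((t - v) a) = T(a) (S - v)\<close> with the shift \<open>S\<close>, and \<open>S - v\<close> is invertible for \<open>\<bar>v\<bar> > 1\<close>.\<close>

lemma toeplitz_cancel_outer_zero:
  assumes a: "continuous_on (sphere 0 1) a" and v: "cmod v > 1"
    and inv: "invertible_l2 (toeplitz (\<lambda>t. (t - v) * a t))"
  shows "invertible_l2 (toeplitz a)"
proof -
  have v0: "v \<noteq> 0" using v by auto
  have ta: "continuous_on (sphere 0 1) (\<lambda>t. t powi int 1 * a t)"
    by (intro continuous_intros a) auto
  define B where "B x k = x k - (1 / v) * shift 1 x k" for x k
  have B: "invertible_l2 B" "bounded_operator_l2 B"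
    using invertible_scalar_minus[OF bounded_op_shift eq_refl[OF shift_l2(2)], of "1 / v" 1] v
    unfolding B_def[abs_def] by (auto simp: norm_divide divide_less_eq)
  have eq: "toeplitz (\<lambda>t. (t - v) * a t) x = toeplitz (\<lambda>t. - v * a t) (B x)" if x: "x \<in> l2" for x
  proof
    fix j
    have "toeplitz (\<lambda>t. (t - v) * a t) x j = toeplitz (\<lambda>t. 1 * (t powi int 1 * a t) + (- v) * a t) x j"
      by (simp add: algebra_simps)
    also have "\<dots> = toeplitz a (shift 1 x) j - v * toeplitz a x j"
      by (subst toeplitz_lincomb[OF ta a x]) (simp only: toeplitz_times_power[OF a x], simp)
    also have "\<dots> = - v * (toeplitz a x j - (1 / v) * toeplitz a (shift 1 x) j)"
      using v0 by (simp add: field_simps)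
    also have "\<dots> = - v * toeplitz a (B x) j"
      unfolding B_def[abs_def]
      using bounded_op_diff[OF toeplitz_bounded_operator[OF a] x l2_scale[OF shift_l2(1)[OF x]], of "1 / v" 1]
        bounded_opD(3)[OF toeplitz_bounded_operator[OF a] shift_l2(1)[OF x], of "1 / v" 1] by simp
    also have "\<dots> = toeplitz (\<lambda>t. - v * a t) (B x) j"
      using toeplitz_lincomb[OF a a bounded_opD(1)[OF B(2) x], of "- v" 0 j] by simp
    finally show "toeplitz (\<lambda>t. (t - v) * a t) x j = toeplitz (\<lambda>t. - v * a t) (B x) j" .
  qed
  have "invertible_l2 (\<lambda>x. toeplitz (\<lambda>t. - v * a t) (B x))"
    using inv invertible_l2_cong[OF eq] by simp
  from invertible_l2_cancel_right[OF this B] have I: "invertible_l2 (toeplitz (\<lambda>t. - v * a t))" .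
  have "continuous_on (sphere 0 1) (\<lambda>t. - v * a t)" by (intro continuous_intros a)
  from toeplitz_scale_invertible[OF this _ I, of "- 1 / v"] show ?thesis using v0 by simp
qed

text \<open>\<open>T((1 - u / t) a) = (1 - u B) T(a)\<close> with the backward shift \<open>B\<close>, and \<open>1 - u B\<close> is invertible for
  \<open>\<bar>u\<bar> < 1\<close>.\<close>

lemma toeplitz_cancel_inner_zero:
  assumes a: "continuous_on (sphere 0 1) a" and u: "cmod u < 1"
    and inv: "invertible_l2 (toeplitz (\<lambda>t. (1 - u * t powi (-1)) * a t))"
  shows "invertible_l2 (toeplitz a)"
proof -
  have ta: "continuous_on (sphere 0 1) (\<lambda>t. t powi (- int 1) * a t)"
    by (intro continuous_intros a) auto
  define B where "B x k = x k - u * x (k + 1)" for x :: "nat \<Rightarrow> complex" and k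
  have B: "invertible_l2 B" "bounded_operator_l2 B"
    using invertible_scalar_minus[OF bounded_op_backshift backshift_l2(2) u, of 1]
    unfolding B_def[abs_def] by auto
  have eq: "toeplitz (\<lambda>t. (1 - u * t powi (-1)) * a t) x = B (toeplitz a x)" if x: "x \<in> l2" for x
  proof
    fix j
    have "toeplitz (\<lambda>t. (1 - u * t powi (-1)) * a t) x j = toeplitz (\<lambda>t. 1 * a t + (- u) * (t powi (- int 1) * a t)) x j"
      by (simp add: algebra_simps)
    also have "\<dots> = B (toeplitz a x) j"
      by (subst toeplitz_lincomb[OF a ta x]) (simp only: toeplitz_times_neg_power B_def, simp)
    finally show "toeplitz (\<lambda>t. (1 - u * t powi (-1)) * a t) x j = B (toeplitz a x) j" .
  qed
  have "invertible_l2 (\<lambda>x. B (toeplitz a x))"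
    using inv invertible_l2_cong[OF eq] by simp
  from invertible_l2_cancel_left[OF this B toeplitz_bounded_operator[OF a]] show ?thesis .
qed

text \<open>For \<open>k > 0\<close> the operator is \<open>T(a)\<close> after the \<open>k\<close>-fold shift, and it misses \<open>T(a) e\<^sub>0\<close>. For \<open>k < 0\<close> it is
  a power of the backward shift after \<open>T(a)\<close>, and it annihilates \<open>T(a)\<^sup>-\<^sup>1 e\<^sub>0\<close>.\<close>

lemma toeplitz_power_times_invertible:
  assumes a: "continuous_on (sphere 0 1) a" and inva: "invertible_l2 (toeplitz a)"
    and inv: "invertible_l2 (toeplitz (\<lambda>t. t powi k * a t))"
  shows "k = 0"
proof (rule ccontr)
  assume "k \<noteq> 0"
  define e :: "nat \<Rightarrow> complex" where "e = (\<lambda>i. if i = 0 then 1 else 0)"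
  have e: "e \<in> l2" by (rule l2_finite_support[of 1]) (simp add: e_def)
  note Ta = toeplitz_bounded_operator[OF a]
  have tka: "continuous_on (sphere 0 1) (\<lambda>t. t powi k * a t)"
    by (intro continuous_intros a) auto
  obtain S where S: "bounded_operator_l2 S" "\<And>x. x \<in> l2 \<Longrightarrow> S (toeplitz a x) = x"
      "\<And>x. x \<in> l2 \<Longrightarrow> toeplitz a (S x) = x"
    using invertible_l2_inverse[OF inva Ta] by metis
  obtain R where R: "bounded_operator_l2 R" "\<And>x. x \<in> l2 \<Longrightarrow> R (toeplitz (\<lambda>t. t powi k * a t) x) = x"
      "\<And>x. x \<in> l2 \<Longrightarrow> toeplitz (\<lambda>t. t powi k * a t) (R x) = x"
    using invertible_l2_inverse[OF inv toeplitz_bounded_operator[OF tka]] by metis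
  show False
  proof (cases "k > 0")
    case True
    then obtain n where n: "k = int n" "n > 0" using zero_less_imp_eq_int by blast
    define x where "x = R (toeplitz a e)"
    have x: "x \<in> l2" unfolding x_def by (intro bounded_opD(1)[OF R(1)] bounded_opD(1)[OF Ta] e)
    have "toeplitz a (shift n x) = toeplitz a e"
      using R(3)[OF bounded_opD(1)[OF Ta e]] toeplitz_times_power[OF a x, of n] by (simp add: x_def n)
    then have "shift n x = e" using S(2)[OF e] S(2)[OF shift_l2(1)[OF x]] by metis
    then have "shift n x 0 = e 0" by simp
    then show False using n by (simp add: shift_def e_def)
  next
    case False
    then obtain n where n: "k = - int n" "n > 0" using \<open>k \<noteq> 0\<close> by (metis linorder_neqE minus_minus neg_0_less_iff_less zero_less_imp_eq_int)
    have x: "S e \<in> l2" by (rule bounded_opD(1)[OF S(1) e])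
    have "toeplitz (\<lambda>t. t powi k * a t) (S e) = (\<lambda>j. 0)"
      unfolding n toeplitz_times_neg_power S(3)[OF e] using n by (auto simp: e_def)
    also have "\<dots> = toeplitz (\<lambda>t. t powi k * a t) (\<lambda>j. 0)"
      using bounded_opD(3)[OF toeplitz_bounded_operator[OF tka] l2_zero(1), of 0] by simp
    finally have "S e = (\<lambda>j. 0)" using R(2)[OF x] R(2)[OF l2_zero(1)] by metis
    then have "e = toeplitz a (\<lambda>j. 0)" using S(3)[OF e] by metis
    then have "e = (\<lambda>j. 0)" using bounded_opD(3)[OF Ta l2_zero(1), of 0] by simp
    then have "e 0 = 0" by simp
    then show False by (simp add: e_def)
  qed
qed

text \<open>A zero outside the unit circle is split off without trace. A zero \<open>u\<close> inside is split off as
  \<open>t - u = t (1 - u / t)\<close> and raises the exponent of \<open>t\<close> by one.\<close>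

theorem toeplitz_invertible_index:
  assumes J: "finite J" and u: "\<And>j. j \<in> J \<Longrightarrow> cmod (u j) \<noteq> 1"
    and a: "continuous_on (sphere 0 1) a" "invertible_l2 (toeplitz a)"
    and inv: "invertible_l2 (toeplitz (\<lambda>t. t powi k * ((\<Prod>j\<in>J. t - u j) * a t)))"
  shows "k + int (card {j\<in>J. cmod (u j) < 1}) = 0"
  using J u inv
proof (induction J arbitrary: k rule: finite_induct)
  case empty
  then show ?case using toeplitz_power_times_invertible[OF a] by simp
next
  case (insert i J)
  have cont: "continuous_on (sphere 0 1) (\<lambda>t. t powi m * ((\<Prod>j\<in>J. t - u j) * a t))" for m
    by (intro continuous_intros a(1)) auto
  show ?case
  proof (cases "cmod (u i) < 1")
    case True
    have "toeplitz (\<lambda>t. t powi k * ((\<Prod>j\<in>insert i J. t - u j) * a t)) =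
        toeplitz (\<lambda>t. (1 - u i * t powi (-1)) * (t powi (k + 1) * ((\<Prod>j\<in>J. t - u j) * a t)))"
    proof (rule toeplitz_cong)
      fix t :: complex assume "cmod t = 1"
      then have "t \<noteq> 0" by auto
      then have "t powi k * (t - u i) = (1 - u i * t powi (-1)) * t powi (k + 1)"
        by (simp add: power_int_add power_int_minus field_simps)
      then show "t powi k * ((\<Prod>j\<in>insert i J. t - u j) * a t) =
          (1 - u i * t powi (-1)) * (t powi (k + 1) * ((\<Prod>j\<in>J. t - u j) * a t))"
        unfolding prod.insert[OF insert(1,2)] by (metis mult.assoc)
    qed
    with insert.prems(2) toeplitz_cancel_inner_zero[OF cont True]
    have "invertible_l2 (toeplitz (\<lambda>t. t powi (k + 1) * ((\<Prod>j\<in>J. t - u j) * a t)))" by simp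
    with insert.IH insert.prems(1) have "k + 1 + int (card {j\<in>J. cmod (u j) < 1}) = 0" by blast
    moreover have "{j\<in>insert i J. cmod (u j) < 1} = insert i {j\<in>J. cmod (u j) < 1}"
      using True by auto
    ultimately show ?thesis using insert(1,2) by simp
  next
    case False
    then have gt: "cmod (u i) > 1" using insert.prems(1)[of i] by simp
    have "(\<lambda>t. t powi k * ((\<Prod>j\<in>insert i J. t - u j) * a t)) =
        (\<lambda>t. (t - u i) * (t powi k * ((\<Prod>j\<in>J. t - u j) * a t)))"
      using insert(1,2) by (simp add: mult.assoc mult.left_commute)
    with insert.prems(2) toeplitz_cancel_outer_zero[OF cont gt]
    have "invertible_l2 (toeplitz (\<lambda>t. t powi k * ((\<Prod>j\<in>J. t - u j) * a t)))" by simp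
    with insert.IH insert.prems(1) have "k + int (card {j\<in>J. cmod (u j) < 1}) = 0" by blast
    moreover have "{j\<in>insert i J. cmod (u j) < 1} = {j\<in>J. cmod (u j) < 1}"
      using False by auto
    ultimately show ?thesis by simp
  qed
qed

section \<open>Holomorphic parametrization of the zeros\<close>

lemma coeff_shifted_poly:
  "coeff (shifted_poly r s c \<mu>) k =
     (if k \<le> r + s then c (int k - int r) else 0) - (if k = r then \<mu> else 0)"
proof -
  have "coeff (\<Sum>n = - int r..int s. monom (c n) (nat (n + int r))) k =
      (\<Sum>n = - int r..int s. if n = int k - int r then c n else 0)"
    unfolding coeff_sum by (intro sum.cong refl) auto
  also have "\<dots> = (if k \<le> r + s then c (int k - int r) else 0)"
    by (subst sum.delta) auto
  finally show ?thesis by (simp add: shifted_poly_def)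
qed

lemma degree_shifted_poly:
  assumes "0 < s" "c (int s) \<noteq> 0"
  shows "degree (shifted_poly r s c \<mu>) = r + s" "lead_coeff (shifted_poly r s c \<mu>) = c (int s)"
proof -
  show d: "degree (shifted_poly r s c \<mu>) = r + s"
  proof (rule antisym)
    show "degree (shifted_poly r s c \<mu>) \<le> r + s"
      by (rule degree_le) (auto simp: coeff_shifted_poly)
    show "r + s \<le> degree (shifted_poly r s c \<mu>)"
      by (rule le_degree) (use assms in \<open>simp add: coeff_shifted_poly\<close>)
  qed
  show "lead_coeff (shifted_poly r s c \<mu>) = c (int s)"
    unfolding d using assms by (simp add: coeff_shifted_poly)
qed

lemma shifted_poly_root_nonzero:
  assumes "0 < r" "c (- int r) \<noteq> 0" "poly (shifted_poly r s c \<mu>) z = 0"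
  shows "z \<noteq> 0"
  using assms by (auto simp: poly_0_coeff_0 coeff_shifted_poly)

lemma poly_shifted_poly_diff:
  "poly (shifted_poly r s c \<mu>) z - poly (shifted_poly r s c \<nu>) z = (\<nu> - \<mu>) * z ^ r"
  by (simp add: shifted_poly_def poly_monom algebra_simps)

text \<open>The factor \<open>(z - \<zeta>)\<^sup>m G z\<close> is the \<open>m\<close>-th power of \<open>h z = (z - \<zeta>) (G z)\<^sup>1\<^sup>/\<^sup>m\<close>, which has non-zero
  derivative at \<open>\<zeta>\<close>; \<open>\<psi>\<close> is the local inverse of \<open>h\<close>.\<close>

lemma local_root_branch:
  assumes S: "open S" "\<zeta> \<in> S" and G: "G holomorphic_on S" "G \<zeta> \<noteq> 0" and m: "m > 0"
    and f: "\<And>z. z \<in> S \<Longrightarrow> f z = w0 + (z - \<zeta>) ^ m * G z"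
  obtains \<eta> \<psi> where "\<eta> > 0" "\<psi> holomorphic_on ball 0 \<eta>" "inj_on \<psi> (ball 0 \<eta>)"
    "\<And>\<tau>. \<tau> \<in> ball 0 \<eta> \<Longrightarrow> \<psi> \<tau> \<in> S \<and> f (\<psi> \<tau>) = w0 + \<tau> ^ m"
proof -
  define T where "T = {z\<in>S. G z / G \<zeta> \<in> {w. Re w > 0}}"
  have "continuous_on S (\<lambda>z. G z / G \<zeta>)"
    using G by (intro continuous_intros holomorphic_on_imp_continuous_on) auto
  from continuous_open_preimage[OF this S(1), of "{w. Re w > 0}"]
  have "open (S \<inter> (\<lambda>z. G z / G \<zeta>) -` {w. Re w > 0})" by (simp add: open_halfspace_Re_gt)
  moreover have "S \<inter> (\<lambda>z. G z / G \<zeta>) -` {w. Re w > 0} = T" by (auto simp: T_def)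
  ultimately have T: "open T" by simp
  have \<zeta>T: "\<zeta> \<in> T" using S G by (simp add: T_def)
  \<comment> \<open>The quotient \<open>G z / G \<zeta>\<close> stays in the right half-plane on \<open>T\<close>, which avoids the cut of \<open>Ln\<close>.\<close>
  define g where "g z = exp ((Ln (G \<zeta>) + Ln (G z / G \<zeta>)) / of_nat m)" for z
  have gm: "g z ^ m = G z" if "z \<in> T" for z
  proof -
    have "G z / G \<zeta> \<noteq> 0" using that by (auto simp: T_def)
    then have "G z \<noteq> 0" by auto
    have "g z ^ m = exp (Ln (G \<zeta>) + Ln (G z / G \<zeta>))"
      unfolding g_def using m by (simp flip: exp_of_nat_mult)
    then show ?thesis using G \<open>G z \<noteq> 0\<close> by (simp add: exp_add)
  qed
  have G': "G holomorphic_on T" by (rule holomorphic_on_subset[OF G(1)]) (auto simp: T_def)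
  have gh: "g holomorphic_on T"
    unfolding g_def using G(2) m
    by (intro holomorphic_intros G') (auto simp: T_def complex_nonpos_Reals_iff)
  define h where "h z = (z - \<zeta>) * g z" for z
  have hh: "h holomorphic_on T" unfolding h_def by (intro holomorphic_intros gh)
  have gd: "(g has_field_derivative deriv g \<zeta>) (at \<zeta>)"
    by (rule holomorphic_derivI[OF gh T \<zeta>T])
  have "(h has_field_derivative g \<zeta>) (at \<zeta>)"
    unfolding h_def by (rule derivative_eq_intros gd refl | simp)+
  then have "deriv h \<zeta> \<noteq> 0" by (simp add: DERIV_imp_deriv g_def)
  then obtain d where d: "d > 0" "ball \<zeta> d \<subseteq> T" "open (h ` ball \<zeta> d)" "inj_on h (ball \<zeta> d)"
    using has_complex_derivative_locally_invertible[OF hh \<zeta>T T] by blast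
  obtain \<psi> where \<psi>: "\<psi> holomorphic_on (h ` ball \<zeta> d)" "\<And>z. z \<in> ball \<zeta> d \<Longrightarrow> \<psi> (h z) = z"
    using holomorphic_has_inverse[OF holomorphic_on_subset[OF hh d(2)] open_ball d(4)] by metis
  have "h \<zeta> = 0" by (simp add: h_def)
  then have "0 \<in> h ` ball \<zeta> d" using d(1) by (metis centre_in_ball imageI)
  then obtain \<eta> where \<eta>: "\<eta> > 0" "ball 0 \<eta> \<subseteq> h ` ball \<zeta> d"
    using d(3) openE by blast
  have inv: "\<psi> \<tau> \<in> ball \<zeta> d \<and> h (\<psi> \<tau>) = \<tau>" if \<tau>: "\<tau> \<in> ball 0 \<eta>" for \<tau>
  proof -
    obtain z where "z \<in> ball \<zeta> d" "\<tau> = h z" using \<eta>(2) \<tau> by blast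
    then show ?thesis using \<psi>(2) by simp
  qed
  show ?thesis
  proof (rule that[OF \<eta>(1)])
    show "\<psi> holomorphic_on ball 0 \<eta>" by (rule holomorphic_on_subset[OF \<psi>(1) \<eta>(2)])
    show "inj_on \<psi> (ball 0 \<eta>)" using inv by (metis inj_onI)
    fix \<tau> :: complex assume \<tau>: "\<tau> \<in> ball 0 \<eta>"
    then have T': "\<psi> \<tau> \<in> T" using inv d(2) by blast
    then have "f (\<psi> \<tau>) = w0 + h (\<psi> \<tau>) ^ m"
      using f gm[OF T'] by (simp add: T_def h_def power_mult_distrib)
    then show "\<psi> \<tau> \<in> S \<and> f (\<psi> \<tau>) = w0 + \<tau> ^ m" using T' inv[OF \<tau>] by (simp add: T_def)
  qed
qed

lemma poly_eq_prod_roots: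
  fixes p :: "complex poly"
  assumes J: "finite J" "card J = degree p" and inj: "inj_on u J" and root: "\<And>j. j \<in> J \<Longrightarrow> poly p (u j) = 0"
  shows "p = smult (lead_coeff p) (\<Prod>j\<in>J. [:- u j, 1:])"
proof (rule poly_eqI_degree_lead_coeff)
  have d: "degree (\<Prod>j\<in>J. [:- u j, 1:]) = card J"
    by (subst degree_prod_eq_sum_degree) auto
  show "coeff p (degree p) = coeff (smult (lead_coeff p) (\<Prod>j\<in>J. [:- u j, 1:])) (degree p)"
    using lead_coeff_prod[of "\<lambda>j. [:- u j, 1:]" J] d J(2) by simp
  show "degree p \<le> card (u ` J)" using J card_image[OF inj] by simp
  show "degree (smult (lead_coeff p) (\<Prod>j\<in>J. [:- u j, 1:])) \<le> degree p"
    using d J(2) degree_smult_le[of "lead_coeff p" "\<Prod>j\<in>J. [:- u j, 1:]"] by simp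
  show "poly p z = poly (smult (lead_coeff p) (\<Prod>j\<in>J. [:- u j, 1:])) z" if "z \<in> u ` J" for z
    using that root J(1) by (auto simp: poly_prod)
qed simp

text \<open>A zero \<open>\<zeta>\<close> of multiplicity \<open>m\<close> of \<open>b - \<mu>\<close> splits into the \<open>m\<close> values \<open>\<psi>(\<sigma>)\<close> with \<open>\<sigma>\<^sup>m = \<tau>\<^sup>N\<close>, which are
  the branches indexed by \<open>(\<zeta>, k)\<close> with \<open>k < m\<close>; \<open>N\<close> is a common multiple of all multiplicities. For
  \<open>\<tau> \<noteq> 0\<close> these are \<open>r + s\<close> different zeros, hence all of them, and the factorization at \<open>\<tau> = 0\<close> follows by
  continuity. There it contains the multiplicities.\<close>

theorem puiseux_branches:
  fixes c :: "int \<Rightarrow> complex"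
  assumes "0 < r" "0 < s" and c: "c (- int r) \<noteq> 0" "c (int s) \<noteq> 0"
  obtains N :: nat and \<epsilon> :: real and J :: "(complex \<times> nat) set" and u
  where "N > 0" "\<epsilon> > 0" "finite J" "card J = r + s"
    "\<And>j. j \<in> J \<Longrightarrow> u j holomorphic_on ball 0 \<epsilon>"
    "\<And>\<tau>. \<tau> \<in> ball 0 \<epsilon> \<Longrightarrow> shifted_poly r s c (\<mu> + \<tau> ^ N) = smult (c (int s)) (\<Prod>j\<in>J. [:- u j \<tau>, 1:])"
    "\<And>\<tau>. \<tau> \<in> ball 0 \<epsilon> \<Longrightarrow> \<tau> \<noteq> 0 \<Longrightarrow> inj_on (\<lambda>j. u j \<tau>) J"
proof -
  define p where "p = shifted_poly r s c \<mu>"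
  note deg = degree_shifted_poly[where s = s and c = c and r = r, OF assms(2) c(2)]
  have p0: "p \<noteq> 0" using deg[of \<mu>] assms by (auto simp: p_def)
  define Z where "Z = {z. poly p z = 0}"
  have Z: "finite Z" unfolding Z_def by (rule poly_roots_finite[OF p0])
  have Znz: "z \<noteq> 0" if "z \<in> Z" for z
    using shifted_poly_root_nonzero[of r c s \<mu> z] assms that by (auto simp: Z_def p_def)
  define m where "m z = order z p" for z
  have m0: "m z > 0" if "z \<in> Z" for z
    using that p0 by (simp add: Z_def m_def order_gt_0_iff)
  have msum: "(\<Sum>z\<in>Z. m z) = r + s"
  proof -
    have "size (proots p) = (\<Sum>z\<in>Z. m z)"
      unfolding size_multiset_overloaded_eq using p0 by (simp add: Z_def m_def)
    then show ?thesis using size_proots_complex[of p] deg by (simp add: p_def)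
  qed
  \<comment> \<open>Disjoint balls keep the branches that start at different zeros apart.\<close>
  obtain \<delta> where \<delta>: "\<delta> > 0" "\<And>y z. y \<in> Z \<Longrightarrow> z \<in> Z \<Longrightarrow> y \<noteq> z \<Longrightarrow> ball y \<delta> \<inter> ball z \<delta> = {}"
  proof -
    define D where "D = insert 1 ((\<lambda>(y, z). dist y z) ` ((Z \<times> Z) - Id))"
    have D: "finite D" "D \<noteq> {}" "\<forall>x\<in>D. x > 0" using Z by (auto simp: D_def)
    show ?thesis
    proof (rule that[of "Min D / 2"])
      show "Min D / 2 > 0" using D by simp
      fix y z assume "y \<in> Z" "z \<in> Z" "y \<noteq> z"
      then have "Min D \<le> dist y z" using D by (intro Min_le) (auto simp: D_def)
      then show "ball y (Min D / 2) \<inter> ball z (Min D / 2) = {}"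
        by (intro disjoint_ballI) simp
    qed
  qed
  have "\<exists>\<eta> \<psi>. \<eta> > 0 \<and> \<psi> holomorphic_on ball 0 \<eta> \<and> inj_on \<psi> (ball 0 \<eta>) \<and>
    (\<forall>\<tau>\<in>ball 0 \<eta>. \<psi> \<tau> \<in> ball z \<delta> - {0} \<and> laurent r s c (\<psi> \<tau>) = \<mu> + \<tau> ^ m z)" if z: "z \<in> Z" for z
  proof -
    obtain q where q: "p = [:- z, 1:] ^ m z * q" "\<not> [:- z, 1:] dvd q"
      using order_decomp[OF p0, of z] by (auto simp: m_def)
    have qz: "poly q z \<noteq> 0" using q(2) by (simp add: poly_eq_0_iff_dvd)
    have eq: "laurent r s c w = \<mu> + (w - z) ^ m z * (poly q w / w ^ r)" if "w \<in> ball z \<delta> - {0}" for w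
    proof -
      have "w \<noteq> 0" using that by auto
      have "w ^ r * (laurent r s c w - \<mu>) = (w - z) ^ m z * poly q w"
        using poly_shifted_poly[OF \<open>w \<noteq> 0\<close>, of r s c \<mu>] q(1) by (simp add: p_def[symmetric] poly_power)
      then have "laurent r s c w - \<mu> = (w - z) ^ m z * (poly q w / w ^ r)"
        using \<open>w \<noteq> 0\<close> by (simp add: field_simps)
      then show ?thesis by (simp add: algebra_simps)
    qed
    have o: "open (ball z \<delta> - {0})" by (intro open_Diff) auto
    have zin: "z \<in> ball z \<delta> - {0}" using \<delta>(1) Znz[OF z] by auto
    have hol: "(\<lambda>w. poly q w / w ^ r) holomorphic_on (ball z \<delta> - {0})"
      by (intro holomorphic_intros) auto
    have "poly q z / z ^ r \<noteq> 0" using qz Znz[OF z] by simp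
    from local_root_branch[OF o zin hol this m0[OF z] eq] show ?thesis by metis
  qed
  then obtain \<eta> \<psi> where \<eta>\<psi>: "\<And>z. z \<in> Z \<Longrightarrow> \<eta> z > 0" "\<And>z. z \<in> Z \<Longrightarrow> \<psi> z holomorphic_on ball 0 (\<eta> z)"
    "\<And>z. z \<in> Z \<Longrightarrow> inj_on (\<psi> z) (ball 0 (\<eta> z))"
    "\<And>z \<tau>. z \<in> Z \<Longrightarrow> \<tau> \<in> ball 0 (\<eta> z) \<Longrightarrow> \<psi> z \<tau> \<in> ball z \<delta> - {0} \<and> laurent r s c (\<psi> z \<tau>) = \<mu> + \<tau> ^ m z"
    by metis
  define N where "N = (\<Prod>z\<in>Z. m z)"
  have N0: "N > 0" using Z m0 by (simp add: N_def)
  have mN: "m z dvd N" if "z \<in> Z" for z using Z that by (simp add: N_def dvd_prodI)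
  define e where "e z = N div m z" for z
  have e: "e z * m z = N" "e z > 0" if "z \<in> Z" for z
    using mN[OF that] N0 by (auto simp: e_def dvd_div_eq_0_iff intro!: Nat.gr0I)
  define \<epsilon> where "\<epsilon> = Min (insert 1 (\<eta> ` Z))"
  have \<epsilon>: "\<epsilon> > 0" "\<epsilon> \<le> 1" "\<And>z. z \<in> Z \<Longrightarrow> \<epsilon> \<le> \<eta> z"
    using Z \<eta>\<psi>(1) by (auto simp: \<epsilon>_def)
  define J where "J = Sigma Z (\<lambda>z. {..<m z})"
  define \<sigma> where "\<sigma> j \<tau> = cis (2 * pi * real (snd j) / real (m (fst j))) * \<tau> ^ e (fst j)" for j :: "complex \<times> nat" and \<tau>
  define u where "u j \<tau> = \<psi> (fst j) (\<sigma> j \<tau>)" for j :: "complex \<times> nat" and \<tau>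
  have \<sigma>: "\<sigma> j \<tau> \<in> ball 0 (\<eta> (fst j))" if "j \<in> J" "\<tau> \<in> ball 0 \<epsilon>" for j \<tau>
  proof -
    have z: "fst j \<in> Z" using that by (auto simp: J_def)
    have "cmod (\<sigma> j \<tau>) = cmod \<tau> ^ e (fst j)" by (simp add: \<sigma>_def norm_mult norm_power)
    also have "\<dots> \<le> cmod \<tau> ^ 1"
      using that \<epsilon> e(2)[OF z] by (intro power_decreasing) auto
    finally show ?thesis using that \<epsilon>(3)[OF z] by simp
  qed
  have root: "poly (shifted_poly r s c (\<mu> + \<tau> ^ N)) (u j \<tau>) = 0" if "j \<in> J" "\<tau> \<in> ball 0 \<epsilon>" for j \<tau>
  proof -
    have z: "fst j \<in> Z" using that by (auto simp: J_def)
    have "cis (2 * pi * real (snd j) / real (m (fst j))) ^ m (fst j) = cis (2 * pi * real (snd j))"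
      using m0[OF z] by (subst Complex.DeMoivre) (simp add: field_simps)
    also have "\<dots> = 1" by (simp add: cis_multiple_2pi)
    finally have "\<sigma> j \<tau> ^ m (fst j) = \<tau> ^ N"
      unfolding \<sigma>_def by (simp add: power_mult_distrib e(1)[OF z] flip: power_mult)
    then have "u j \<tau> \<noteq> 0" "laurent r s c (u j \<tau>) = \<mu> + \<tau> ^ N"
      using \<eta>\<psi>(4)[OF z \<sigma>[OF that]] by (auto simp: u_def)
    then show ?thesis by (simp add: poly_shifted_poly)
  qed
  have inj: "inj_on (\<lambda>j. u j \<tau>) J" if \<tau>: "\<tau> \<in> ball 0 \<epsilon>" "\<tau> \<noteq> 0" for \<tau>
  proof (rule inj_onI)
    fix i j assume ij: "i \<in> J" "j \<in> J" and eq: "u i \<tau> = u j \<tau>"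
    have z: "fst i \<in> Z" "fst j \<in> Z" using ij by (auto simp: J_def)
    have "u i \<tau> \<in> ball (fst i) \<delta>" "u j \<tau> \<in> ball (fst j) \<delta>"
      using \<eta>\<psi>(4)[OF z(1) \<sigma>[OF ij(1) \<tau>(1)]] \<eta>\<psi>(4)[OF z(2) \<sigma>[OF ij(2) \<tau>(1)]] by (auto simp: u_def)
    then have f: "fst i = fst j" using \<delta>(2)[OF z] eq by (metis disjoint_iff)
    have "\<sigma> i \<tau> = \<sigma> j \<tau>"
      using \<eta>\<psi>(3)[OF z(1)] \<sigma>[OF ij(1) \<tau>(1)] \<sigma>[OF ij(2) \<tau>(1)] eq f by (auto simp: u_def inj_on_def)
    then have "cis (2 * pi * real (snd i) / real (m (fst i))) = cis (2 * pi * real (snd j) / real (m (fst i)))"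
      using f \<tau>(2) by (simp add: \<sigma>_def)
    then have "snd i = snd j"
      using Complex.bij_betw_roots_unity[OF m0[OF z(1)]] ij f unfolding bij_betw_def inj_on_def J_def
      by (auto simp: mem_Times_iff)
    then show "i = j" using f by (simp add: prod_eq_iff)
  qed
  have J: "finite J" "card J = r + s" using Z msum by (auto simp: J_def)
  have fact: "shifted_poly r s c (\<mu> + \<tau> ^ N) = smult (c (int s)) (\<Prod>j\<in>J. [:- u j \<tau>, 1:])"
    if \<tau>: "\<tau> \<in> ball 0 \<epsilon>" "\<tau> \<noteq> 0" for \<tau>
    using poly_eq_prod_roots[of J "shifted_poly r s c (\<mu> + \<tau> ^ N)" "\<lambda>j. u j \<tau>"] J deg inj[OF \<tau>] root[OF _ \<tau>(1)]
    by simp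
  have hol: "u j holomorphic_on ball 0 \<epsilon>" if "j \<in> J" for j
  proof -
    have z: "fst j \<in> Z" using that by (auto simp: J_def)
    have "\<psi> (fst j) \<circ> \<sigma> j holomorphic_on ball 0 \<epsilon>"
    proof (rule holomorphic_on_compose_gen[OF _ \<eta>\<psi>(2)[OF z]])
      show "\<sigma> j holomorphic_on ball 0 \<epsilon>" unfolding \<sigma>_def[abs_def] by (intro holomorphic_intros)
      show "\<sigma> j ` ball 0 \<epsilon> \<subseteq> ball 0 (\<eta> (fst j))" using \<sigma>[OF that] by blast
    qed
    then show ?thesis by (simp add: u_def[abs_def] comp_def)
  qed
  have fact0: "shifted_poly r s c \<mu> = smult (c (int s)) (\<Prod>j\<in>J. [:- u j 0, 1:])"
  proof (rule poly_ext)
    fix z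
    have "((\<lambda>\<tau>. c (int s) * (\<Prod>j\<in>J. z - u j \<tau>)) \<longlongrightarrow> c (int s) * (\<Prod>j\<in>J. z - u j 0)) (at 0)"
    proof (intro tendsto_intros)
      fix j assume "j \<in> J"
      then have "isCont (u j) 0"
        using \<epsilon>(1) hol holomorphic_on_imp_continuous_on continuous_on_eq_continuous_at by (metis centre_in_ball open_ball)
      then show "(u j \<longlongrightarrow> u j 0) (at 0)" by (simp add: isCont_def)
    qed
    moreover have "((\<lambda>\<tau>. c (int s) * (\<Prod>j\<in>J. z - u j \<tau>)) \<longlongrightarrow> poly (shifted_poly r s c \<mu>) z) (at 0)"
    proof (rule Lim_transform_eventually)
      show "((\<lambda>\<tau>. poly (shifted_poly r s c \<mu>) z - \<tau> ^ N * z ^ r) \<longlongrightarrow> poly (shifted_poly r s c \<mu>) z) (at 0)"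
        using N0 by (auto intro!: tendsto_eq_intros simp: power_0_left)
      have "\<forall>\<^sub>F \<tau> in at 0. \<tau> \<in> ball 0 \<epsilon> - {0}"
        using \<epsilon>(1) by (intro eventually_at_in_open) auto
      then show "\<forall>\<^sub>F \<tau> in at 0. poly (shifted_poly r s c \<mu>) z - \<tau> ^ N * z ^ r = c (int s) * (\<Prod>j\<in>J. z - u j \<tau>)"
      proof eventually_elim
        case (elim \<tau>)
        then have "poly (shifted_poly r s c (\<mu> + \<tau> ^ N)) z = c (int s) * (\<Prod>j\<in>J. z - u j \<tau>)"
          using fact[of \<tau>] by (simp add: poly_prod)
        then show ?case
          using poly_shifted_poly_diff[of r s c "\<mu> + \<tau> ^ N" z \<mu>] by (simp add: algebra_simps)
      qed
    qed
    ultimately have "poly (shifted_poly r s c \<mu>) z = c (int s) * (\<Prod>j\<in>J. z - u j 0)"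
      using tendsto_unique by (metis at_neq_bot)
    then show "poly (shifted_poly r s c \<mu>) z = poly (smult (c (int s)) (\<Prod>j\<in>J. [:- u j 0, 1:])) z"
      by (simp add: poly_prod)
  qed
  have "shifted_poly r s c (\<mu> + \<tau> ^ N) = smult (c (int s)) (\<Prod>j\<in>J. [:- u j \<tau>, 1:])"
    if "\<tau> \<in> ball 0 \<epsilon>" for \<tau>
    using fact[OF that] fact0 N0 by (cases "\<tau> = 0") (simp_all add: power_0_left)
  then show ?thesis
    by (intro that[OF N0 \<epsilon>(1) J hol _ inj]) auto
qed

section \<open>Circles that separate the zeros\<close>

definition separates :: "real \<Rightarrow> ('i \<Rightarrow> complex) \<Rightarrow> 'i set \<Rightarrow> 'i set \<Rightarrow> bool" where
  "separates \<rho> x J S \<longleftrightarrow> (\<forall>j\<in>S. cmod (x j) < \<rho>) \<and> (\<forall>j\<in>J - S. \<rho> < cmod (x j))"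

lemma separates_unique:
  assumes "finite J" "S \<subseteq> J" "S' \<subseteq> J" "card S = card S'"
    and "separates \<rho> x J S" "separates \<rho>' x J S'"
  shows "S = S'"
proof (rule ccontr)
  assume "S \<noteq> S'"
  have fin: "finite S" "finite S'" using assms(1-3) finite_subset by auto
  have "\<not> S \<subseteq> S'" using card_subset_eq[OF fin(2)] assms(4) \<open>S \<noteq> S'\<close> by metis
  then obtain i where i: "i \<in> S" "i \<notin> S'" by auto
  have "\<not> S' \<subseteq> S" using card_subset_eq[OF fin(1)] assms(4) \<open>S \<noteq> S'\<close> by metis
  then obtain k where k: "k \<in> S'" "k \<notin> S" by auto
  show False
    using assms(2,3,5,6) i k unfolding separates_def by (meson DiffI less_asym less_trans subsetD)
qed

lemma separatesI:
  assumes J: "finite J" "S \<subseteq> J" and lt: "\<And>i k. i \<in> S \<Longrightarrow> k \<in> J - S \<Longrightarrow> cmod (x i) < cmod (x k)"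
  obtains \<rho> where "separates \<rho> x J S"
proof -
  have fin: "finite S" "finite (J - S)" using J finite_subset by auto
  show ?thesis
  proof (cases "S = {}")
    case True
    have "separates (-1) x J S" unfolding separates_def True
      by (auto intro: less_le_trans[OF _ norm_ge_zero])
    then show ?thesis by (rule that)
  next
    case ne: False
    define M where "M = Max ((\<lambda>i. cmod (x i)) ` S)"
    have M: "cmod (x i) \<le> M" if "i \<in> S" for i using that fin by (simp add: M_def)
    have "M \<in> (\<lambda>i. cmod (x i)) ` S" unfolding M_def using fin ne by (intro Max_in) auto
    then have M': "M < cmod (x k)" if "k \<in> J - S" for k using lt that by auto
    show ?thesis
    proof (cases "J - S = {}")
      case True
      have "separates (M + 1) x J S" unfolding separates_def True using M by fastforce
      then show ?thesis by (rule that)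
    next
      case False
      define m where "m = Min ((\<lambda>i. cmod (x i)) ` (J - S))"
      have m: "m \<le> cmod (x i)" if "i \<in> J - S" for i using that fin by (simp add: m_def)
      have "m \<in> (\<lambda>i. cmod (x i)) ` (J - S)" unfolding m_def using fin False by (intro Min_in) auto
      then have "M < m" using M' by auto
      then have "M < (M + m) / 2" "(M + m) / 2 < m" by auto
      then have "separates ((M + m) / 2) x J S" unfolding separates_def
        using M m by (meson le_less_trans less_le_trans)
      then show ?thesis by (rule that)
    qed
  qed
qed

text \<open>The radius is the \<open>r\<close>-th smallest value of \<open>f\<close>.\<close>

lemma rank_radius:
  fixes f :: "'i \<Rightarrow> real"
  assumes J: "finite J" and r: "0 < r" "r \<le> card J"
  obtains R where "card {j\<in>J. f j < R} < r" "r \<le> card {j\<in>J. f j \<le> R}"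
proof -
  define D where "D = {R\<in>f ` J. r \<le> card {j\<in>J. f j \<le> R}}"
  have D: "finite D" using J by (simp add: D_def)
  have "J \<noteq> {}" using r by auto
  have "{j\<in>J. f j \<le> Max (f ` J)} = J" using J by auto
  then have "Max (f ` J) \<in> D" using r J \<open>J \<noteq> {}\<close> by (simp add: D_def)
  then have "D \<noteq> {}" by auto
  define R where "R = Min D"
  have R: "R \<in> D" unfolding R_def using D \<open>D \<noteq> {}\<close> by (rule Min_in)
  have "card {j\<in>J. f j < R} < r"
  proof (rule ccontr)
    assume "\<not> card {j\<in>J. f j < R} < r"
    then have ge: "r \<le> card {j\<in>J. f j < R}" by simp
    then have ne: "{j\<in>J. f j < R} \<noteq> {}" using r by (metis card.empty leD)
    define R' where "R' = Max (f ` {j\<in>J. f j < R})"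
    have "R' \<in> f ` {j\<in>J. f j < R}" unfolding R'_def using J ne by (intro Max_in) auto
    then have R': "R' \<in> f ` J" "R' < R" by auto
    have "{j\<in>J. f j < R} \<subseteq> {j\<in>J. f j \<le> R'}" unfolding R'_def using J by auto
    then have "card {j\<in>J. f j < R} \<le> card {j\<in>J. f j \<le> R'}" using J by (intro card_mono) auto
    then have "R' \<in> D" using ge R' by (simp add: D_def)
    then have "R \<le> R'" unfolding R_def using D by simp
    then show False using R' by simp
  qed
  then show ?thesis using that R by (auto simp: D_def)
qed

text \<open>A multiplicative group acts freely on non-zero numbers, so that all orbits have the size of the group.\<close>

lemma card_group_dvd_card_invariant:
  fixes G X :: "complex set"
  assumes G: "finite G" "1 \<in> G" "0 \<notin> G" "\<And>g h. g \<in> G \<Longrightarrow> h \<in> G \<Longrightarrow> g * h \<in> G"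
      "\<And>g. g \<in> G \<Longrightarrow> inverse g \<in> G"
    and X: "finite X" "0 \<notin> X" "\<And>g x. g \<in> G \<Longrightarrow> x \<in> X \<Longrightarrow> g * x \<in> X"
  shows "card G dvd card X"
proof (rule equiv_imp_dvd_card[OF X(1)])
  let ?R = "{(x, y). x \<in> X \<and> y \<in> X \<and> (\<exists>g\<in>G. y = g * x)}"
  show "equiv X ?R"
  proof (rule equivI)
    show "sym ?R"
    proof (rule symI)
      fix x y assume "(x, y) \<in> ?R"
      then obtain g where g: "g \<in> G" "y = g * x" "x \<in> X" "y \<in> X" by auto
      then have "x = inverse g * y" using G(3) by (auto simp: field_simps)
      then show "(y, x) \<in> ?R" using g G(5) by blast
    qed
    show "trans ?R"
    proof (rule transI)
      fix x y z assume "(x, y) \<in> ?R" "(y, z) \<in> ?R"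
      then obtain g h where g: "g \<in> G" "y = g * x" "h \<in> G" "z = h * y" "x \<in> X" "z \<in> X" by auto
      then have "z = (h * g) * x" by simp
      then show "(x, z) \<in> ?R" using g G(4) by blast
    qed
    show "refl_on X ?R"
      using G(2) by (auto simp: refl_on_def intro!: bexI[of _ 1])
  qed auto
  fix Y assume "Y \<in> X // {(x, y). x \<in> X \<and> y \<in> X \<and> (\<exists>g\<in>G. y = g * x)}"
  then obtain x where x: "x \<in> X" "Y = ?R `` {x}" by (rule quotientE)
  then have "Y = (\<lambda>g. g * x) ` G" using X(3) by auto
  moreover have "inj_on (\<lambda>g. g * x) G" using x(1) X(2) by (auto simp: inj_on_def)
  ultimately show "card G dvd card Y" by (simp add: card_image)
qed

text \<open>By the open mapping theorem a non-constant holomorphic function has modulus \<open>1\<close> only on a nowhere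
  dense set, and finitely many such sets do not cover an open set.\<close>

lemma generic_modulus_not_1:
  assumes P: "finite P" and U: "open U" "connected U"
    and f: "\<And>q. q \<in> P \<Longrightarrow> f q holomorphic_on U" "\<And>q. q \<in> P \<Longrightarrow> \<not> f q constant_on U"
    and W: "open W" "W \<noteq> {}" "W \<subseteq> U"
  shows "\<exists>V. open V \<and> V \<noteq> {} \<and> V \<subseteq> W \<and> (\<forall>q\<in>P. \<forall>\<tau>\<in>V. cmod (f q \<tau>) \<noteq> 1)"
  using P f
proof (induction P rule: finite_induct)
  case empty then show ?case using W by auto
next
  case (insert q P)
  then obtain V where V: "open V" "V \<noteq> {}" "V \<subseteq> W" "\<forall>q\<in>P. \<forall>\<tau>\<in>V. cmod (f q \<tau>) \<noteq> 1" by auto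
  have hol: "f q holomorphic_on U" and nc: "\<not> f q constant_on U" using insert.prems by auto
  have VU: "V \<subseteq> U" using V(3) W(3) by blast
  have op: "open (f q ` V)" by (rule open_mapping_thm[OF hol U V(1) VU nc])
  have "\<not> f q ` V \<subseteq> sphere 0 1"
  proof
    assume "f q ` V \<subseteq> sphere 0 1"
    obtain \<tau> where "\<tau> \<in> V" using V(2) by blast
    define w where "w = f q \<tau>"
    have w: "w \<in> f q ` V" using \<open>\<tau> \<in> V\<close> by (simp add: w_def)
    then obtain e where e: "e > 0" "ball w e \<subseteq> f q ` V" using op openE by blast
    have w1: "cmod w = 1" using w \<open>f q ` V \<subseteq> sphere 0 1\<close> by auto
    have "w + of_real (e / 2) * w \<in> ball w e" using e(1) w1 by (simp add: dist_norm norm_mult)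
    then have "cmod (w + of_real (e / 2) * w) = 1"
      using e(2) \<open>f q ` V \<subseteq> sphere 0 1\<close> by (meson mem_sphere_0 subsetD)
    moreover have "w + of_real (e / 2) * w = of_real (1 + e / 2) * w" by (simp add: algebra_simps)
    ultimately have "\<bar>1 + e / 2\<bar> = 1" using w1 by (metis mult.right_neutral norm_mult norm_of_real)
    then show False using e(1) by simp
  qed
  then obtain \<tau> where \<tau>: "\<tau> \<in> V" "cmod (f q \<tau>) \<noteq> 1"
    by (metis image_subsetI mem_sphere_0)
  define V' where "V' = V \<inter> f q -` (- sphere 0 1)"
  have "continuous_on V (f q)" using hol VU holomorphic_on_imp_continuous_on holomorphic_on_subset by blast
  then have "open V'" unfolding V'_def
    by (intro continuous_open_preimage V(1)) (auto simp: open_Compl)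
  then show ?case using \<tau> V by (intro exI[of _ V']) (auto simp: V'_def)
qed

section \<open>The selection of the inner zeros\<close>

text \<open>The situation that \<open>puiseux_branches\<close> provides. The zeros are indexed by \<open>J\<close> without any order by
  modulus, since such an order would not be compatible with holomorphic branches.\<close>

locale laurent_branches =
  fixes r s :: nat and c :: "int \<Rightarrow> complex" and \<mu> :: complex and N :: nat and \<epsilon> :: real
    and J :: "'i set" and u :: "'i \<Rightarrow> complex \<Rightarrow> complex"
  assumes r: "0 < r" and s: "0 < s" and cr: "c (- int r) \<noteq> 0" and cs: "c (int s) \<noteq> 0"
    and N: "0 < N" and \<epsilon>: "0 < \<epsilon>" and J: "finite J" "card J = r + s"
    and hol: "\<And>j. j \<in> J \<Longrightarrow> u j holomorphic_on ball 0 \<epsilon>"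
    and factor: "\<And>\<tau>. \<tau> \<in> ball 0 \<epsilon> \<Longrightarrow>
        shifted_poly r s c (\<mu> + \<tau> ^ N) = smult (c (int s)) (\<Prod>j\<in>J. [:- u j \<tau>, 1:])"
    and inj: "\<And>\<tau>. \<tau> \<in> ball 0 \<epsilon> \<Longrightarrow> \<tau> \<noteq> 0 \<Longrightarrow> inj_on (\<lambda>j. u j \<tau>) J"
begin

lemma poly_factor:
  assumes "\<tau> \<in> ball 0 \<epsilon>"
  shows "poly (shifted_poly r s c (\<mu> + \<tau> ^ N)) z = c (int s) * (\<Prod>j\<in>J. z - u j \<tau>)"
  unfolding factor[OF assms] by (simp add: poly_prod)

lemma branch_nonzero:
  assumes "\<tau> \<in> ball 0 \<epsilon>" "j \<in> J" shows "u j \<tau> \<noteq> 0"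
proof (rule shifted_poly_root_nonzero[of r c s "\<mu> + \<tau> ^ N", OF r cr])
  show "poly (shifted_poly r s c (\<mu> + \<tau> ^ N)) (u j \<tau>) = 0"
    unfolding poly_factor[OF assms(1)] using assms(2) J(1) by auto
qed

lemma laurent_factor:
  assumes "\<tau> \<in> ball 0 \<epsilon>" "z \<noteq> 0"
  shows "laurent r s c z - (\<mu> + \<tau> ^ N) = c (int s) / z ^ r * (\<Prod>j\<in>J. z - u j \<tau>)"
  using poly_factor[OF assms(1), of z] poly_shifted_poly[OF assms(2), of r s c "\<mu> + \<tau> ^ N"] assms(2)
  by (simp add: field_simps)

lemma laurent_branch:
  assumes "\<tau> \<in> ball 0 \<epsilon>" "j \<in> J" shows "laurent r s c (u j \<tau>) = \<mu> + \<tau> ^ N"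
proof -
  have "(\<Prod>i\<in>J. u j \<tau> - u i \<tau>) = 0" using assms(2) J(1) by auto
  then show ?thesis using laurent_factor[OF assms(1) branch_nonzero[OF assms]] by simp
qed

lemma continuous_branch: "j \<in> J \<Longrightarrow> continuous_on (ball 0 \<epsilon>) (u j)"
  using hol holomorphic_on_imp_continuous_on by blast

lemma branch_image_infinite:
  assumes j: "j \<in> J" shows "infinite (u j ` ball 0 \<epsilon>)"
proof
  assume fin: "finite (u j ` ball 0 \<epsilon>)"
  have "ball 0 \<epsilon> \<subseteq> (\<Union>z\<in>u j ` ball 0 \<epsilon>. {\<tau>. \<tau> ^ N = laurent r s c z - \<mu>})"
    using laurent_branch[OF _ j] by auto
  moreover have "finite (\<Union>z\<in>u j ` ball 0 \<epsilon>. {\<tau>. \<tau> ^ N = laurent r s c z - \<mu>})"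
    using fin N by (intro finite_UN_I finite_nth_roots) auto
  ultimately have "finite (ball (0::complex) \<epsilon>)" using finite_subset by blast
  then show False using \<epsilon> finite_imp_not_open[of "ball (0::complex) \<epsilon>"] by simp
qed

text \<open>The rotations \<open>\<omega>\<close> with \<open>b(\<omega> z) = b(z)\<close>, in terms of the coefficients.\<close>

definition symmetries :: "complex set" where
  "symmetries = {\<omega>. \<omega> \<noteq> 0 \<and> (\<forall>n\<in>{- int r..int s}. c n * \<omega> powi n = c n)}"

lemma symmetries_power: "\<omega> \<in> symmetries \<Longrightarrow> \<omega> ^ r = 1"
proof -
  assume "\<omega> \<in> symmetries"
  then have "c (- int r) * \<omega> powi (- int r) = c (- int r)" by (auto simp: symmetries_def)
  then show ?thesis using cr by (simp add: power_int_minus)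
qed

lemma symmetries_group:
  "finite symmetries" "1 \<in> symmetries" "0 \<notin> symmetries"
  "\<And>g h. g \<in> symmetries \<Longrightarrow> h \<in> symmetries \<Longrightarrow> g * h \<in> symmetries"
  "\<And>g. g \<in> symmetries \<Longrightarrow> inverse g \<in> symmetries"
proof -
  have "symmetries \<subseteq> {z. z ^ r = 1}" using symmetries_power by auto
  then show "finite symmetries" using r finite_roots_unity[of r] finite_subset by auto
  show "1 \<in> symmetries" "0 \<notin> symmetries" by (auto simp: symmetries_def)
  show "g * h \<in> symmetries" if "g \<in> symmetries" "h \<in> symmetries" for g h
    using that unfolding symmetries_def
    by (simp add: power_int_mult_distrib) (metis mult_1)
  show "inverse g \<in> symmetries" if "g \<in> symmetries" for g
    using that by (auto simp: symmetries_def power_int_inverse field_simps)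
qed

lemma laurent_symmetry: "\<omega> \<in> symmetries \<Longrightarrow> laurent r s c (\<omega> * z) = laurent r s c z"
  unfolding laurent_def symmetries_def
  by (intro sum.cong refl) (auto simp: power_int_mult_distrib mult.assoc[symmetric])

text \<open>The symmetries act on the \<open>r\<close>-th roots of unity by multiplication.\<close>

lemma card_symmetries_dvd: "card symmetries dvd r"
proof -
  have "card symmetries dvd card {z::complex. z ^ r = 1}"
    by (rule card_group_dvd_card_invariant[OF symmetries_group])
      (use r symmetries_power in \<open>auto simp: finite_roots_unity power_mult_distrib power_0_left\<close>)
  then show ?thesis using card_roots_unity_eq[of r] r by simp
qed

text \<open>The polynomials \<open>z\<^sup>r b(\<omega> z)\<close> and \<open>z\<^sup>r b(z)\<close> agree on the infinite set of values of a branch, hence in all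
  coefficients.\<close>

lemma branch_ratio_symmetry:
  assumes i: "i \<in> J" and k: "k \<in> J" and eq: "\<And>\<tau>. \<tau> \<in> ball 0 \<epsilon> \<Longrightarrow> u i \<tau> = \<omega> * u k \<tau>"
  shows "\<omega> \<in> symmetries"
proof -
  have \<omega>: "\<omega> \<noteq> 0" using eq[of 0] branch_nonzero[OF _ i, of 0] \<epsilon> by auto
  define c' where "c' n = c n * \<omega> powi n" for n
  have l: "laurent r s c' z = laurent r s c (\<omega> * z)" for z
    by (simp add: laurent_def c'_def power_int_mult_distrib mult.assoc)
  have p: "poly (shifted_poly r s c' 0) z = poly (shifted_poly r s c 0) z" if z: "z \<in> u k ` ball 0 \<epsilon>" for z
  proof -
    obtain \<tau> where \<tau>: "\<tau> \<in> ball 0 \<epsilon>" "z = u k \<tau>" using z by blast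
    have "z \<noteq> 0" using branch_nonzero[OF \<tau>(1) k] \<tau>(2) by simp
    moreover have "laurent r s c (\<omega> * z) = laurent r s c z"
      using laurent_branch[OF \<tau>(1) i] laurent_branch[OF \<tau>(1) k] eq[OF \<tau>(1)] \<tau>(2) by simp
    ultimately show ?thesis by (simp add: poly_shifted_poly l)
  qed
  have "shifted_poly r s c' 0 = shifted_poly r s c 0"
  proof (rule ccontr)
    assume "shifted_poly r s c' 0 \<noteq> shifted_poly r s c 0"
    then have "finite {z. poly (shifted_poly r s c' 0 - shifted_poly r s c 0) z = 0}"
      by (intro poly_roots_finite) simp
    moreover have "u k ` ball 0 \<epsilon> \<subseteq> {z. poly (shifted_poly r s c' 0 - shifted_poly r s c 0) z = 0}"
      using p by auto
    ultimately show False using branch_image_infinite[OF k] finite_subset by blast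
  qed
  then have co: "coeff (shifted_poly r s c' 0) m = coeff (shifted_poly r s c 0) m" for m by simp
  have "c' n = c n" if "n \<in> {- int r..int s}" for n
    using co[of "nat (n + int r)"] that by (auto simp: coeff_shifted_poly split: if_splits)
  then show ?thesis using \<omega> by (auto simp: symmetries_def c'_def)
qed

text \<open>At a generic parameter two zeros have equal modulus only if the quotient of their branches is a
  constant, which is then a symmetry of \<open>b\<close>. The zeros on any circle therefore form a single orbit (or
  none), and the number of zeros inside a circle is a multiple of the order of the group, as is \<open>r\<close>.
  Passing from the open to the closed disc of the \<open>r\<close>-th smallest radius adds one orbit, so that a count
  below \<open>r\<close> jumps to exactly \<open>r\<close>.\<close>

lemma separated_dense:
  assumes W: "open W" "W \<noteq> {}" "W \<subseteq> ball 0 \<epsilon>"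
  obtains \<tau> S \<rho> where "\<tau> \<in> W" "\<tau> \<noteq> 0" "S \<subseteq> J" "card S = r" "separates \<rho> (\<lambda>j. u j \<tau>) J S"
proof -
  define P where "P = {(i, k). i \<in> J \<and> k \<in> J \<and> \<not> (\<lambda>\<tau>. u i \<tau> / u k \<tau>) constant_on ball 0 \<epsilon>}"
  have finP: "finite P" by (rule finite_subset[of _ "J \<times> J"]) (use J in \<open>auto simp: P_def\<close>)
  have W0: "open (W - {0})" "W - {0} \<noteq> {}" "W - {0} \<subseteq> ball 0 \<epsilon>"
  proof -
    show "W - {0} \<noteq> {}"
    proof
      assume "W - {0} = {}"
      then have "W = {0}" using W(2) by auto
      then show False using W(1) not_open_singleton by blast
    qed
  qed (use W in \<open>auto intro: open_Diff\<close>)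
  have "\<exists>V. open V \<and> V \<noteq> {} \<and> V \<subseteq> W - {0} \<and>
     (\<forall>q\<in>P. \<forall>\<tau>\<in>V. cmod ((\<lambda>(i, k) \<tau>. u i \<tau> / u k \<tau>) q \<tau>) \<noteq> 1)"
    by (rule generic_modulus_not_1[OF finP open_ball connected_ball _ _ W0])
      (use branch_nonzero in \<open>auto simp: P_def intro!: holomorphic_intros hol\<close>)
  then obtain \<tau> where \<tau>: "\<tau> \<in> W - {0}" "\<And>i k. (i, k) \<in> P \<Longrightarrow> cmod (u i \<tau> / u k \<tau>) \<noteq> 1"
    by fastforce
  have \<tau>b: "\<tau> \<in> ball 0 \<epsilon>" "\<tau> \<noteq> 0" using \<tau>(1) W by auto
  define x where "x j = u j \<tau>" for j
  have injx: "inj_on x J" using inj[OF \<tau>b] by (simp add: x_def[abs_def])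
  have x0: "x j \<noteq> 0" if "j \<in> J" for j using branch_nonzero[OF \<tau>b(1) that] by (simp add: x_def)
  have sym: "\<exists>\<omega>\<in>symmetries. x i = \<omega> * x k" if ik: "i \<in> J" "k \<in> J" "cmod (x i) = cmod (x k)" for i k
  proof -
    have "cmod (u i \<tau> / u k \<tau>) = 1" using ik x0 by (simp add: x_def norm_divide)
    then have "(i, k) \<notin> P" using \<tau>(2) by blast
    then obtain \<omega> where \<omega>: "\<And>\<sigma>. \<sigma> \<in> ball 0 \<epsilon> \<Longrightarrow> u i \<sigma> / u k \<sigma> = \<omega>"
      using ik unfolding P_def constant_on_def by auto
    have eq: "u i \<sigma> = \<omega> * u k \<sigma>" if "\<sigma> \<in> ball 0 \<epsilon>" for \<sigma>
      using \<omega>[OF that] branch_nonzero[OF that \<open>k \<in> J\<close>] by (simp add: field_simps)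
    show ?thesis using branch_ratio_symmetry[OF ik(1,2) eq] eq[OF \<tau>b(1)] by (auto simp: x_def)
  qed
  have inv: "\<omega> * z \<in> x ` J" if \<omega>z: "\<omega> \<in> symmetries" "z \<in> x ` J" for \<omega> z
  proof -
    obtain j where j: "j \<in> J" "z = u j \<tau>" using \<omega>z(2) by (auto simp: x_def)
    have nz: "\<omega> * z \<noteq> 0" using j \<omega>z(1) branch_nonzero[OF \<tau>b(1)] by (auto simp: symmetries_def)
    have "laurent r s c (\<omega> * z) = \<mu> + \<tau> ^ N"
      using laurent_symmetry[OF \<omega>z(1)] laurent_branch[OF \<tau>b(1) j(1)] j(2) by simp
    then have "(\<Prod>j\<in>J. \<omega> * z - u j \<tau>) = 0" using laurent_factor[OF \<tau>b(1) nz] nz cs by simp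
    then show ?thesis using J(1) by (auto simp: x_def)
  qed
  have norm1: "cmod \<omega> = 1" if "\<omega> \<in> symmetries" for \<omega>
    using symmetries_power[OF that] r by (metis norm_one norm_power norm_ge_zero power_eq_1_iff not_gr0)
  obtain R where R: "card {j\<in>J. cmod (x j) < R} < r" "r \<le> card {j\<in>J. cmod (x j) \<le> R}"
    using rank_radius[of J r "\<lambda>j. cmod (x j)"] J r by auto
  define A where "A = {z\<in>x ` J. cmod z < R}"
  define B where "B = {z\<in>x ` J. cmod z \<le> R}"
  have "A = x ` {j\<in>J. cmod (x j) < R}" "B = x ` {j\<in>J. cmod (x j) \<le> R}" by (auto simp: A_def B_def)
  then have cardAB: "card A = card {j\<in>J. cmod (x j) < R}" "card B = card {j\<in>J. cmod (x j) \<le> R}"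
    using card_image[OF inj_on_subset[OF injx]] by auto
  have fin: "finite A" "finite B" using J by (auto simp: A_def B_def)
  have dA: "card symmetries dvd card A"
    by (rule card_group_dvd_card_invariant[OF symmetries_group fin(1)])
      (use inv norm1 x0 in \<open>auto simp: A_def norm_mult\<close>)
  have dB: "card symmetries dvd card B"
    by (rule card_group_dvd_card_invariant[OF symmetries_group fin(2)])
      (use inv norm1 x0 in \<open>auto simp: B_def norm_mult\<close>)
  have "A \<subseteq> B" by (auto simp: A_def B_def)
  have "B - A \<noteq> {}"
  proof
    assume "B - A = {}"
    then have "B = A" using \<open>A \<subseteq> B\<close> by auto
    then show False using R cardAB by simp
  qed
  then obtain i where i: "i \<in> J" "cmod (x i) = R" by (force simp: A_def B_def)
  have "B \<subseteq> A \<union> (\<lambda>\<omega>. \<omega> * x i) ` symmetries"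
    using sym i by (fastforce simp: A_def B_def)
  then have "card B \<le> card (A \<union> (\<lambda>\<omega>. \<omega> * x i) ` symmetries)"
    using fin symmetries_group(1) by (intro card_mono) auto
  also have "\<dots> \<le> card A + card ((\<lambda>\<omega>. \<omega> * x i) ` symmetries)" by (rule card_Un_le)
  also have "\<dots> \<le> card A + card symmetries" using symmetries_group(1) by (simp add: card_image_le)
  finally have le: "card B \<le> card A + card symmetries" .
  have "card B = r"
  proof -
    have g: "card symmetries > 0" using symmetries_group(1,2) by (metis card_gt_0_iff empty_iff)
    obtain a b q where ab: "card A = card symmetries * a" "card B = card symmetries * b" "r = card symmetries * q"
      using dA dB card_symmetries_dvd unfolding dvd_def by blast
    have "card symmetries * a < card symmetries * q" using R(1) cardAB(1) ab by simp
    then have "a < q" by simp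
    moreover have "card symmetries * q \<le> card symmetries * b" using R(2) cardAB(2) ab by simp
    then have "q \<le> b" using g by simp
    moreover have "card symmetries * b \<le> card symmetries * Suc a" using le ab(1,2) by simp
    then have "b \<le> Suc a" using g by (simp del: mult_Suc_right)
    ultimately have "q = b" by simp
    then show ?thesis using ab by simp
  qed
  then have card: "card {j\<in>J. cmod (x j) \<le> R} = r" using cardAB by simp
  obtain \<rho> where "separates \<rho> x J {j\<in>J. cmod (x j) \<le> R}"
    by (rule separatesI[of J "{j\<in>J. cmod (x j) \<le> R}" x]) (use J in auto)
  then show ?thesis using that[of \<tau> "{j\<in>J. cmod (x j) \<le> R}" \<rho>] card \<tau>(1) by (auto simp: x_def[abs_def])
qed

text \<open>Any circle that avoids the zeros has both or none of the \<open>r\<close>-th and the \<open>(r+1)\<close>-th zero inside, as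
  these have the same modulus.\<close>

lemma limit_set_not_separated:
  assumes \<mu>: "\<mu> \<in> limit_set r s c" and S: "S \<subseteq> J" "card S = r"
  shows "\<not> separates \<rho> (\<lambda>j. u j 0) J S"
proof
  assume sep: "separates \<rho> (\<lambda>j. u j 0) J S"
  obtain zs where zs: "mset zs = proots (shifted_poly r s c \<mu>)" "sorted (map cmod zs)"
    "cmod (zs ! (r - 1)) = cmod (zs ! r)"
    using \<mu> unfolding limit_set_def by auto
  have "shifted_poly r s c \<mu> = smult (c (int s)) (\<Prod>j\<in>J. [:- u j 0, 1:])"
    using factor[of 0] \<epsilon> N by (simp add: power_0_left)
  then have "proots (shifted_poly r s c \<mu>) = (\<Sum>j\<in>J. {#u j 0#})"
    using cs by (simp add: proots_prod)
  also have "\<dots> = image_mset (\<lambda>j. u j 0) (mset_set J)"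
  proof -
    have "(\<Sum>j\<in>K. {#u j 0#}) = image_mset (\<lambda>j. u j 0) (mset_set K)" if "finite K" for K
      using that by (induction K rule: finite_induct) auto
    then show ?thesis using J(1) by blast
  qed
  finally have m: "mset zs = image_mset (\<lambda>j. u j 0) (mset_set J)" using zs by simp
  have len: "length zs = r + s" using arg_cong[OF m, of size] J by simp
  have "length (filter (\<lambda>z. cmod z < \<rho>) zs) = size (filter_mset (\<lambda>z. cmod z < \<rho>) (mset zs))"
    by (metis mset_filter size_mset)
  also have "\<dots> = card {j\<in>J. cmod (u j 0) < \<rho>}"
    unfolding m by (simp add: filter_mset_image_mset J(1))
  also have "{j\<in>J. cmod (u j 0) < \<rho>} = S"
    using sep S(1) unfolding separates_def by (auto intro: ccontr) (metis DiffI less_asym)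
  finally have cnt: "card {i. i < length zs \<and> cmod (zs ! i) < \<rho>} = r"
    using S by (simp add: length_filter_conv_card)
  have mono: "cmod (zs ! i) \<le> cmod (zs ! k)" if "i \<le> k" "k < r + s" for i k
    using sorted_nth_mono[OF zs(2), of i k] that len by simp
  show False
  proof (cases "cmod (zs ! r) < \<rho>")
    case True
    have "{..r} \<subseteq> {i. i < length zs \<and> cmod (zs ! i) < \<rho>}"
      using mono[of _ r] True s len by fastforce
    then have "card {..r} \<le> r" using cnt by (metis (no_types, lifting) card_mono finite_nat_set_iff_bounded mem_Collect_eq)
    then show False by simp
  next
    case False
    have "{i. i < length zs \<and> cmod (zs ! i) < \<rho>} \<subseteq> {..<r - 1}"
    proof (rule subsetI)
      fix i assume "i \<in> {i. i < length zs \<and> cmod (zs ! i) < \<rho>}"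
      then show "i \<in> {..<r - 1}" using mono[of "r - 1" i] zs(3) False len by (cases "i < r - 1") auto
    qed
    then have "r \<le> card {..<r - 1}" using cnt by (metis card_mono finite_lessThan)
    then show False using r by simp
  qed
qed

text \<open>The maximum principle for the quotient of the two branches.\<close>

lemma branch_ratio_bound:
  assumes i: "i \<in> J" and k: "k \<in> J"
    and le: "\<And>\<tau>. \<tau> \<in> ball 0 \<epsilon> \<Longrightarrow> cmod (u i \<tau>) \<le> cmod (u k \<tau>)" and eq: "cmod (u i 0) \<ge> cmod (u k 0)"
    and \<tau>: "\<tau> \<in> ball 0 \<epsilon>"
  shows "cmod (u i \<tau>) = cmod (u k \<tau>)"
proof -
  define q where "q \<tau> = u i \<tau> / u k \<tau>" for \<tau>
  have qh: "q holomorphic_on ball 0 \<epsilon>"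
    unfolding q_def using branch_nonzero[OF _ k] by (intro holomorphic_intros hol i k) auto
  have 0: "0 \<in> ball (0::complex) \<epsilon>" using \<epsilon> by simp
  have q0: "cmod (q 0) = 1" using le[OF 0] eq branch_nonzero[OF 0 k] by (simp add: q_def norm_divide)
  have q1: "cmod (q \<sigma>) \<le> cmod (q 0)" if "\<sigma> \<in> ball 0 \<epsilon>" for \<sigma>
    unfolding q0 using le[OF that] branch_nonzero[OF that k] by (simp add: q_def norm_divide)
  have "q constant_on ball 0 \<epsilon>"
    by (rule maximum_modulus_principle[OF qh open_ball connected_ball open_ball order_refl 0 q1])
  then have "q \<tau> = q 0" using \<tau> 0 unfolding constant_on_def by metis
  then have "cmod (q \<tau>) = 1" using q0 by simp
  then show ?thesis using branch_nonzero[OF \<tau> k] by (simp add: q_def norm_divide)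
qed

theorem two_selections:
  assumes \<mu>: "\<mu> \<in> limit_set r s c"
  obtains \<tau> \<tau>' S S' \<rho> \<rho>' where "\<tau> \<in> ball 0 \<epsilon> - {0}" "\<tau>' \<in> ball 0 \<epsilon> - {0}" "S \<subseteq> J" "S' \<subseteq> J" "S \<noteq> S'"
    "card S = r" "card S' = r"
    "separates \<rho> (\<lambda>j. u j \<tau>) J S" "separates \<rho>' (\<lambda>j. u j \<tau>') J S'"
proof -
  have 0: "0 \<in> ball (0::complex) \<epsilon>" using \<epsilon> by simp
  obtain \<tau> S \<rho> where S: "\<tau> \<in> ball 0 \<epsilon>" "\<tau> \<noteq> 0" "S \<subseteq> J" "card S = r" "separates \<rho> (\<lambda>j. u j \<tau>) J S"
    using separated_dense[of "ball 0 \<epsilon>"] \<epsilon> by auto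
  have "\<exists>\<tau>' S' \<rho>'. \<tau>' \<in> ball 0 \<epsilon> - {0} \<and> S' \<subseteq> J \<and> S \<noteq> S' \<and> card S' = r \<and> separates \<rho>' (\<lambda>j. u j \<tau>') J S'"
  proof (rule ccontr)
    assume no: "\<not> ?thesis"
    have le: "cmod (u i \<sigma>) \<le> cmod (u k \<sigma>)" if ik: "i \<in> S" "k \<in> J - S" and \<sigma>: "\<sigma> \<in> ball 0 \<epsilon>" for i k \<sigma>
    proof (rule ccontr)
      assume "\<not> cmod (u i \<sigma>) \<le> cmod (u k \<sigma>)"
      have iJ: "i \<in> J" "k \<in> J" using ik S(3) by auto
      define W where "W = ball 0 \<epsilon> \<inter> (\<lambda>\<tau>. cmod (u i \<tau>) - cmod (u k \<tau>)) -` {0<..}"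
      have "open W" unfolding W_def
        by (intro continuous_open_preimage continuous_intros continuous_branch iJ) auto
      moreover have "W \<noteq> {}" using \<open>\<not> cmod (u i \<sigma>) \<le> cmod (u k \<sigma>)\<close> \<sigma> by (auto simp: W_def)
      ultimately obtain \<tau>' S' \<rho>' where S': "\<tau>' \<in> W" "\<tau>' \<noteq> 0" "S' \<subseteq> J" "card S' = r" "separates \<rho>' (\<lambda>j. u j \<tau>') J S'"
        using separated_dense[of W] by (auto simp: W_def)
      then have "S' = S" using no by (auto simp: W_def)
      then have "cmod (u i \<tau>') < cmod (u k \<tau>')" using S'(5) ik unfolding separates_def by (meson less_trans)
      then show False using S'(1) by (auto simp: W_def)
    qed
    have "\<exists>i\<in>S. \<exists>k\<in>J - S. cmod (u i 0) \<ge> cmod (u k 0)"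
    proof (rule ccontr)
      assume "\<not> ?thesis"
      then have "\<And>i k. i \<in> S \<Longrightarrow> k \<in> J - S \<Longrightarrow> cmod (u i 0) < cmod (u k 0)" by (meson not_le)
      then obtain \<rho>0 where "separates \<rho>0 (\<lambda>j. u j 0) J S" using separatesI[of J S "\<lambda>j. u j 0"] J(1) S(3) by blast
      then show False using limit_set_not_separated[OF \<mu> S(3,4)] by blast
    qed
    then obtain i k where ik: "i \<in> S" "k \<in> J - S" "cmod (u i 0) \<ge> cmod (u k 0)" by blast
    have "cmod (u i \<tau>) = cmod (u k \<tau>)"
      by (rule branch_ratio_bound) (use ik S le in auto)
    then show False using S(5) ik(1,2) unfolding separates_def by (metis less_asym)
  qed
  then show ?thesis using that S by blast
qed

end

section \<open>Bounded Lipschitz functions\<close>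

text \<open>One constant bounds both the values and the difference quotients, so that these functions form an
  algebra and a small constant means closeness in a sense in which simple zeros are stable.\<close>

definition bounded_lipschitz :: "'a::metric_space set \<Rightarrow> real \<Rightarrow> ('a \<Rightarrow> complex) \<Rightarrow> bool" where
  "bounded_lipschitz X M f \<longleftrightarrow> 0 \<le> M \<and> (\<forall>z\<in>X. cmod (f z) \<le> M) \<and>
     (\<forall>z\<in>X. \<forall>w\<in>X. cmod (f z - f w) \<le> M * dist z w)"

lemma bounded_lipschitzD:
  assumes "bounded_lipschitz X M f"
  shows "0 \<le> M" "z \<in> X \<Longrightarrow> cmod (f z) \<le> M"
    "z \<in> X \<Longrightarrow> w \<in> X \<Longrightarrow> cmod (f z - f w) \<le> M * dist z w"
  using assms by (auto simp: bounded_lipschitz_def)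

lemma bounded_lipschitz_mono:
  assumes "bounded_lipschitz X M f" "M \<le> M'" shows "bounded_lipschitz X M' f"
  using assms unfolding bounded_lipschitz_def
  by (meson mult_right_mono order_trans zero_le_dist)

lemma bounded_lipschitz_const: "bounded_lipschitz X (cmod a) (\<lambda>z. a)"
  by (simp add: bounded_lipschitz_def)

lemma bounded_lipschitz_add:
  assumes f: "bounded_lipschitz X A f" and g: "bounded_lipschitz X B g"
  shows "bounded_lipschitz X (A + B) (\<lambda>z. f z + g z)"
  unfolding bounded_lipschitz_def
proof (intro conjI ballI)
  show "0 \<le> A + B" using bounded_lipschitzD(1)[OF f] bounded_lipschitzD(1)[OF g] by simp
  fix z assume z: "z \<in> X"
  show "cmod (f z + g z) \<le> A + B"
    by (intro norm_triangle_le add_mono bounded_lipschitzD(2)[OF f z] bounded_lipschitzD(2)[OF g z])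
  fix w assume w: "w \<in> X"
  have "cmod (f z + g z - (f w + g w)) = cmod ((f z - f w) + (g z - g w))" by (simp add: algebra_simps)
  also have "\<dots> \<le> A * dist z w + B * dist z w"
    by (intro norm_triangle_le add_mono bounded_lipschitzD(3)[OF f z w] bounded_lipschitzD(3)[OF g z w])
  finally show "cmod (f z + g z - (f w + g w)) \<le> (A + B) * dist z w" by (simp add: algebra_simps)
qed

lemma bounded_lipschitz_mult:
  assumes f: "bounded_lipschitz X A f" and g: "bounded_lipschitz X B g"
  shows "bounded_lipschitz X (2 * A * B) (\<lambda>z. f z * g z)"
  unfolding bounded_lipschitz_def
proof (intro conjI ballI)
  have A: "0 \<le> A" and B: "0 \<le> B" using bounded_lipschitzD(1)[OF f] bounded_lipschitzD(1)[OF g] .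
  then show AB: "0 \<le> 2 * A * B" by simp
  fix z assume z: "z \<in> X"
  have "cmod (f z * g z) \<le> A * B"
    unfolding norm_mult by (intro mult_mono bounded_lipschitzD(2)[OF f z] bounded_lipschitzD(2)[OF g z] A) simp
  then show "cmod (f z * g z) \<le> 2 * A * B" using AB by simp
  fix w assume w: "w \<in> X"
  have "cmod (f z * g z - f w * g w) = cmod (f z * (g z - g w) + (f z - f w) * g w)"
    by (simp add: algebra_simps)
  also have "\<dots> \<le> cmod (f z) * cmod (g z - g w) + cmod (f z - f w) * cmod (g w)"
    unfolding norm_mult[symmetric] by (rule norm_triangle_ineq)
  also have "\<dots> \<le> A * (B * dist z w) + (A * dist z w) * B"
    by (intro add_mono mult_mono bounded_lipschitzD(2)[OF f z] bounded_lipschitzD(2)[OF g w]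
        bounded_lipschitzD(3)[OF f z w] bounded_lipschitzD(3)[OF g z w] A) (auto simp: A)
  finally show "cmod (f z * g z - f w * g w) \<le> 2 * A * B * dist z w" by (simp add: algebra_simps)
qed

lemma bounded_lipschitz_power:
  assumes "bounded_lipschitz X A f"
  obtains B where "bounded_lipschitz X B (\<lambda>z. f z ^ n)"
proof -
  have "\<exists>B. bounded_lipschitz X B (\<lambda>z. f z ^ n)"
  proof (induction n)
    case 0 show ?case using bounded_lipschitz_const[of X 1] by auto
  next
    case (Suc n) then show ?case using bounded_lipschitz_mult[OF assms] by fastforce
  qed
  then show ?thesis using that by blast
qed

lemma bounded_lipschitz_sum:
  assumes "\<And>i. i \<in> I \<Longrightarrow> bounded_lipschitz X (A i) (f i)"
  shows "bounded_lipschitz X (\<Sum>i\<in>I. A i) (\<lambda>z. \<Sum>i\<in>I. f i z)"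
  using assms
proof (induction I rule: infinite_finite_induct)
  case (insert i I) then show ?case by (simp add: bounded_lipschitz_add)
qed (auto simp: bounded_lipschitz_def)

lemma bounded_lipschitz_compose:
  assumes f: "bounded_lipschitz Y A f" and h: "h ` X \<subseteq> Y" "1 \<le> L"
    "\<And>z w. z \<in> X \<Longrightarrow> w \<in> X \<Longrightarrow> dist (h z) (h w) \<le> L * dist z w"
  shows "bounded_lipschitz X (A * L) (\<lambda>z. f (h z))"
  unfolding bounded_lipschitz_def
proof (intro conjI ballI)
  have A: "0 \<le> A" using bounded_lipschitzD(1)[OF f] .
  then show "0 \<le> A * L" using h(2) by simp
  have AL: "A \<le> A * L" using A h(2) by (simp add: mult_le_cancel_left1)
  fix z assume z: "z \<in> X"
  then show "cmod (f (h z)) \<le> A * L" using bounded_lipschitzD(2)[OF f, of "h z"] h(1) AL by force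
  fix w assume w: "w \<in> X"
  have "cmod (f (h z) - f (h w)) \<le> A * dist (h z) (h w)"
    by (rule bounded_lipschitzD(3)[OF f]) (use z w h(1) in auto)
  also have "\<dots> \<le> A * (L * dist z w)" by (intro mult_left_mono h(3) z w A)
  finally show "cmod (f (h z) - f (h w)) \<le> A * L * dist z w" by simp
qed

lemma bounded_lipschitz_continuous:
  "bounded_lipschitz X M f \<Longrightarrow> continuous_on X f"
  by (rule lipschitz_on_continuous_on[of M])
    (auto simp: lipschitz_on_def bounded_lipschitz_def dist_norm)

abbreviation annulus :: "real \<Rightarrow> real \<Rightarrow> complex set" where
  "annulus \<rho>1 \<rho>2 \<equiv> {z. \<rho>1 \<le> cmod z \<and> cmod z \<le> \<rho>2}"

lemma bounded_lipschitz_inverse: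
  assumes f: "bounded_lipschitz X A f" and m: "0 < m" "\<And>z. z \<in> X \<Longrightarrow> m \<le> cmod (f z)"
  shows "bounded_lipschitz X (max (1 / m) (A / m\<^sup>2)) (\<lambda>z. inverse (f z))"
  unfolding bounded_lipschitz_def
proof (intro conjI ballI)
  have A: "0 \<le> A" by (rule bounded_lipschitzD(1)[OF f])
  show "0 \<le> max (1 / m) (A / m\<^sup>2)" using m by (simp add: le_max_iff_disj)
  fix z assume z: "z \<in> X"
  have "inverse (cmod (f z)) \<le> inverse m" using m z by (intro le_imp_inverse_le) auto
  then show "cmod (inverse (f z)) \<le> max (1 / m) (A / m\<^sup>2)"
    by (simp add: norm_inverse norm_divide inverse_eq_divide le_max_iff_disj)
  fix w assume w: "w \<in> X"
  have 0: "f z \<noteq> 0" "f w \<noteq> 0" using m z w by force+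
  have "inverse (f z) - inverse (f w) = (f w - f z) / (f z * f w)" using 0 by (simp add: field_simps)
  then have "cmod (inverse (f z) - inverse (f w)) = cmod (f z - f w) / (cmod (f z) * cmod (f w))"
    by (simp add: norm_divide norm_mult norm_minus_commute)
  also have "\<dots> \<le> (A * dist z w) / (m * m)"
    by (intro frac_le mult_mono bounded_lipschitzD(3)[OF f z w]) (use m z w A in auto)
  also have "\<dots> = (A / m\<^sup>2) * dist z w" by (simp add: power2_eq_square)
  also have "\<dots> \<le> max (1 / m) (A / m\<^sup>2) * dist z w" by (intro mult_right_mono) auto
  finally show "cmod (inverse (f z) - inverse (f w)) \<le> max (1 / m) (A / m\<^sup>2) * dist z w" .
qed

lemma bounded_lipschitz_powi:
  assumes f: "bounded_lipschitz X A f" and m: "0 < m" "\<And>z. z \<in> X \<Longrightarrow> m \<le> cmod (f z)"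
  obtains B where "bounded_lipschitz X B (\<lambda>z. f z powi n)"
proof (cases "n \<ge> 0")
  case True
  obtain B where "bounded_lipschitz X B (\<lambda>z. f z ^ nat n)"
    using bounded_lipschitz_power[OF f] by blast
  then show ?thesis using True that by (auto simp: power_int_def)
next
  case False
  obtain B where "bounded_lipschitz X B (\<lambda>z. inverse (f z) ^ nat (- n))"
    using bounded_lipschitz_power[OF bounded_lipschitz_inverse[OF f m]] by blast
  then show ?thesis using False that by (auto simp: power_int_def)
qed

lemma bounded_lipschitz_id:
  assumes "\<And>z. z \<in> X \<Longrightarrow> cmod z \<le> R"
  shows "bounded_lipschitz X (max 1 R) (\<lambda>z. z)"
  unfolding bounded_lipschitz_def
proof (intro conjI ballI)
  fix z w
  have "cmod (z - w) = 1 * dist z w" by (simp add: dist_norm)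
  also have "\<dots> \<le> max 1 R * dist z w" by (intro mult_right_mono) auto
  finally show "cmod (z - w) \<le> max 1 R * dist z w" .
qed (use assms in \<open>auto simp: le_max_iff_disj\<close>)

lemma bounded_lipschitz_laurent:
  assumes \<rho>: "0 < \<rho>1"
  obtains B where "bounded_lipschitz (annulus \<rho>1 \<rho>2) B (laurent r s c)"
proof -
  let ?X = "annulus \<rho>1 \<rho>2"
  have id: "bounded_lipschitz ?X (max 1 \<rho>2) (\<lambda>z. z)" by (rule bounded_lipschitz_id) auto
  have "\<exists>B. bounded_lipschitz ?X B (\<lambda>z. z powi n)" for n
    using bounded_lipschitz_powi[OF id \<rho>] by auto
  then obtain B where B: "\<And>n. bounded_lipschitz ?X (B n) (\<lambda>z. z powi n)" by metis
  have "bounded_lipschitz ?X (\<Sum>n = - int r..int s. 2 * cmod (c n) * B n) (laurent r s c)"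
    unfolding laurent_def[abs_def]
    by (intro bounded_lipschitz_sum bounded_lipschitz_mult bounded_lipschitz_const B)
  then show ?thesis by (rule that)
qed

lemma holomorphic_bounded_lipschitz:
  assumes H: "open H" "f holomorphic_on H" and K: "compact K" "convex K" "K \<subseteq> H"
  obtains B where "bounded_lipschitz K B f"
proof -
  have "compact (f ` K)"
    by (intro compact_continuous_image K continuous_on_subset[OF holomorphic_on_imp_continuous_on[OF H(2)]])
  then obtain B1 where B1: "\<And>z. z \<in> K \<Longrightarrow> cmod (f z) \<le> B1"
    using compact_imp_bounded[of "f ` K"] unfolding bounded_iff by (metis imageI)
  have "compact (deriv f ` K)"
    by (intro compact_continuous_image K continuous_on_subset[OF holomorphic_on_imp_continuous_on[OF holomorphic_deriv[OF H(2,1)]]])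
  then obtain B2 where B2: "\<And>z. z \<in> K \<Longrightarrow> cmod (deriv f z) \<le> B2"
    using compact_imp_bounded[of "deriv f ` K"] unfolding bounded_iff by (metis imageI)
  define B where "B = \<bar>B1\<bar> + \<bar>B2\<bar>"
  have "bounded_lipschitz K B f"
    unfolding bounded_lipschitz_def
  proof (intro conjI ballI)
    show "0 \<le> B" by (simp add: B_def)
    fix z assume z: "z \<in> K"
    show "cmod (f z) \<le> B" using B1[OF z] by (simp add: B_def)
    fix w assume w: "w \<in> K"
    have "cmod (f z - f w) \<le> B * cmod (z - w)"
    proof (rule field_differentiable_bound[OF K(2) _ _ z w])
      fix x assume x: "x \<in> K"
      show "(f has_field_derivative deriv f x) (at x within K)"
        using holomorphic_derivI[OF H(2,1)] x K(3) has_field_derivative_at_within by blast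
      show "cmod (deriv f x) \<le> B" using B2[OF x] by (simp add: B_def)
    qed
    then show "cmod (f z - f w) \<le> B * dist z w" by (simp add: dist_norm)
  qed
  then show ?thesis by (rule that)
qed

lemma circle_dilate_continuous:
  assumes f: "bounded_lipschitz (annulus \<rho>1 \<rho>2) M f" and \<rho>: "\<rho> \<in> {\<rho>1..\<rho>2}" "0 \<le> \<rho>"
  shows "continuous_on (sphere 0 1) (\<lambda>t. f (of_real \<rho> * t))"
  by (rule continuous_on_compose2[OF bounded_lipschitz_continuous[OF f]])
    (use \<rho> in \<open>auto intro!: continuous_intros simp: norm_mult\<close>)

section \<open>The error of the polygon discretization\<close>

text \<open>The derivative of the error is the slope of the chord minus \<open>\<phi>'\<close>; both are within \<open>K (b - a)\<close> of \<open>\<phi>' a\<close>.\<close>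

lemma linear_interpolation_error_lipschitz:
  fixes \<phi> :: "real \<Rightarrow> complex"
  assumes d: "\<And>x. (\<phi> has_vector_derivative \<phi>' x) (at x)"
    and K: "\<And>x y. cmod (\<phi>' x - \<phi>' y) \<le> K * \<bar>x - y\<bar>"
    and ab: "a < b" and v: "v \<in> {a..b}" and w: "w \<in> {a..b}"
  defines "D \<equiv> \<lambda>x. of_real ((x - a) / (b - a)) * (\<phi> b - \<phi> a) + \<phi> a - \<phi> x"
  shows "cmod (D v - D w) \<le> 2 * K * (b - a) * \<bar>v - w\<bar>"
proof -
  have K0: "0 \<le> K" using order_trans[OF norm_ge_zero K[of 1 0]] by simp
  have lin: "cmod (\<phi> y - \<phi> x - (y - x) *\<^sub>R \<phi>' a) \<le> \<bar>y - x\<bar> * (K * (b - a))"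
    if "x \<in> {a..b}" "y \<in> {a..b}" for x y
  proof -
    have "cmod (\<phi> y - \<phi> x - (y - x) *\<^sub>R \<phi>' a) \<le> norm (y - x) * (K * (b - a))"
    proof (rule vector_differentiable_bound_linearization[where S = "{a..b}"])
      show "(\<phi> has_vector_derivative \<phi>' t) (at t within {a..b})" for t
        by (rule has_vector_derivative_at_within[OF d])
      show "closed_segment x y \<subseteq> {a..b}" using that by (auto simp: closed_segment_eq_real_ivl)
      fix t assume t: "t \<in> {a..b}"
      have "cmod (\<phi>' t - \<phi>' a) \<le> K * \<bar>t - a\<bar>" by (rule K)
      also have "\<dots> \<le> K * (b - a)" using t K0 by (intro mult_left_mono) auto
      finally show "cmod (\<phi>' t - \<phi>' a) \<le> K * (b - a)" .
    qed (use ab in auto)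
    then show ?thesis by simp
  qed
  define m where "m = (\<phi> b - \<phi> a) /\<^sub>R (b - a)"
  have "m - \<phi>' a = (\<phi> b - \<phi> a - (b - a) *\<^sub>R \<phi>' a) /\<^sub>R (b - a)"
    using ab by (simp add: m_def scaleR_right_diff_distrib)
  then have "cmod (m - \<phi>' a) = cmod (\<phi> b - \<phi> a - (b - a) *\<^sub>R \<phi>' a) / (b - a)"
    using ab by (simp add: divide_inverse mult.commute)
  also have "\<dots> \<le> K * (b - a)"
    using lin[of a b] ab by (simp add: divide_le_eq mult.commute)
  finally have m: "cmod (m - \<phi>' a) \<le> K * (b - a)" .
  have "D v - D w = (v - w) *\<^sub>R m - (\<phi> v - \<phi> w)"
  proof -
    have scale: "of_real ((x - a) / (b - a)) * (\<phi> b - \<phi> a) = (x - a) *\<^sub>R m" for x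
      by (simp add: m_def scaleR_conv_of_real divide_inverse mult.assoc)
    show ?thesis unfolding D_def scale by (simp add: algebra_simps)
  qed
  also have "\<dots> = (v - w) *\<^sub>R (m - \<phi>' a) - (\<phi> v - \<phi> w - (v - w) *\<^sub>R \<phi>' a)"
    by (simp add: algebra_simps)
  finally have "cmod (D v - D w) \<le> cmod ((v - w) *\<^sub>R (m - \<phi>' a)) + cmod (\<phi> v - \<phi> w - (v - w) *\<^sub>R \<phi>' a)"
    by (simp only: norm_triangle_ineq4)
  also have "\<dots> \<le> \<bar>v - w\<bar> * (K * (b - a)) + \<bar>v - w\<bar> * (K * (b - a))"
    using lin[OF w v] m by (intro add_mono) (auto intro!: mult_left_mono)
  finally show ?thesis by (simp add: algebra_simps)
qed

lemma partition_mono: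
  assumes "xs \<in> partitions \<alpha> \<beta> \<Delta>" "i \<le> k" "k < length xs"
  shows "xs ! i \<le> xs ! k"
proof (cases "i = k")
  case False
  then show ?thesis using assms by (auto simp: partitions_def sorted_wrt_iff_nth_less intro: less_imp_le)
qed simp

lemma partition_ends:
  assumes "xs \<in> partitions \<alpha> \<beta> \<Delta>"
  shows "xs \<noteq> []" "xs ! 0 = \<alpha>" "xs ! (length xs - 1) = \<beta>"
  using assms by (auto simp: partitions_def hd_conv_nth last_conv_nth)

lemma partition_step:
  assumes "xs \<in> partitions \<alpha> \<beta> \<Delta>" "Suc j < length xs"
  shows "xs ! j < xs ! Suc j" "xs ! Suc j - xs ! j \<le> \<Delta>"
proof -
  show "xs ! j < xs ! Suc j" using assms by (auto simp: partitions_def sorted_wrt_iff_nth_less)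
  have "finite {xs ! Suc j - xs ! j |j. Suc j < length xs}"
    by (rule finite_subset[of _ "(\<lambda>j. xs ! Suc j - xs ! j) ` {..<length xs}"]) auto
  then have "xs ! Suc j - xs ! j \<le> granularity xs"
    unfolding granularity_def using assms(2) by (intro Max_ge) auto
  then show "xs ! Suc j - xs ! j \<le> \<Delta>" using assms(1) by (simp add: partitions_def)
qed

lemma partition_mesh_nonneg:
  assumes "xs \<in> partitions \<alpha> \<beta> \<Delta>" shows "0 \<le> \<Delta>"
proof -
  have "finite {xs ! Suc j - xs ! j |j. Suc j < length xs}"
    by (rule finite_subset[of _ "(\<lambda>j. xs ! Suc j - xs ! j) ` {..<length xs}"]) auto
  then have "0 \<le> granularity xs" unfolding granularity_def by (intro Max_ge) auto
  then show ?thesis using assms by (simp add: partitions_def)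
qed

lemma partition_locate:
  assumes xs: "xs \<in> partitions \<alpha> \<beta> \<Delta>" and v: "\<alpha> \<le> v" "v < \<beta>"
  obtains j where "Suc j < length xs" "xs ! j \<le> v" "v < xs ! Suc j"
proof -
  note e = partition_ends[OF xs]
  define j where "j = (LEAST k. v < xs ! k)"
  have P: "v < xs ! j" unfolding j_def by (rule LeastI[of _ "length xs - 1"]) (use e v in simp)
  have le: "j \<le> length xs - 1" unfolding j_def by (rule Least_le) (use e v in simp)
  have "j \<noteq> 0" using P e v by (metis not_less)
  then obtain i where i: "j = Suc i" using not0_implies_Suc by blast
  have "\<not> v < xs ! i" using not_less_Least[of i "\<lambda>k. v < xs ! k"] i by (simp add: j_def)
  then show ?thesis using that[of i] P i le e(1) by (metis Suc_le_lessD le_SucI not_less length_greater_0_conv le_imp_less_Suc Suc_diff_1)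
qed

lemma partition_approximates:
  assumes xs: "xs \<in> partitions \<alpha> \<beta> \<Delta>" and v: "\<alpha> \<le> v" "v \<le> \<beta>" and "0 \<le> \<Delta>"
  obtains x where "x \<in> set xs" "\<bar>x - v\<bar> \<le> \<Delta>"
proof (cases "v = \<beta>")
  case True
  then show ?thesis using that[of \<beta>] partition_ends[OF xs] assms(4)
    by (metis abs_zero cancel_comm_monoid_add_class.diff_cancel diff_less length_greater_0_conv less_one nth_mem)
next
  case False
  then obtain j where j: "Suc j < length xs" "xs ! j \<le> v" "v < xs ! Suc j"
    using partition_locate[OF xs v(1)] v(2) by force
  then show ?thesis using that[of "xs ! j"] partition_step(2)[OF xs j(1)] by fastforce
qed

lemma partition_subset:
  assumes xs: "xs \<in> partitions \<alpha> \<beta> \<Delta>" and "x \<in> set xs" shows "\<alpha> \<le> x" "x \<le> \<beta>"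
proof -
  obtain i where i: "i < length xs" "x = xs ! i" using assms(2) by (auto simp: in_set_conv_nth)
  show "\<alpha> \<le> x" using partition_mono[OF xs, of 0 i] partition_ends[OF xs] i by simp
  show "x \<le> \<beta>" using partition_mono[OF xs, of i "length xs - 1"] partition_ends[OF xs] i by simp
qed

text \<open>The chord is \<open>2 sin (\<theta> / 2)\<close>, so that by symmetry the claim is \<open>x / 2 \<le> sin x\<close> for half the angle,
  up to \<open>\<pi> / 2\<close>.\<close>

lemma chord_bound:
  assumes "0 \<le> \<theta>" "\<theta> \<le> 2 * pi"
  shows "min \<theta> (2 * pi - \<theta>) \<le> 2 * cmod (cis \<theta> - 1)"
proof -
  have half: "x / 2 \<le> sin x" if "0 \<le> x" "x \<le> pi / 2" for x :: real
  proof (cases "x \<le> pi / 3")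
    case True
    have "sin 0 - 0 / 2 \<le> sin x - x / 2"
    proof (rule DERIV_nonneg_imp_nondecreasing[OF that(1)])
      fix y assume y: "0 \<le> y" "y \<le> x"
      have "cos (pi / 3) \<le> cos y" using y True by (intro cos_monotone_0_pi_le) auto
      then show "\<exists>d. ((\<lambda>x. sin x - x / 2) has_real_derivative d) (at y) \<and> 0 \<le> d"
        by (intro exI[of _ "cos y - 1 / 2"]) (auto intro!: derivative_eq_intros simp: cos_60)
    qed
    then show ?thesis by simp
  next
    case False
    \<comment> \<open>Here \<open>x / 2 \<le> pi / 4 < 0.8\<close>, while \<open>sin (pi / 3)\<close> exceeds \<open>0.85\<close>.\<close>
    have "sin (pi / 3) \<le> sin x" using that False by (intro sin_monotone_2pi_le) auto
    moreover have "1.7 \<le> sqrt 3" by (rule real_le_rsqrt) (simp add: power2_eq_square)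
    moreover have "x \<le> 1.6" using that pi_approx by simp
    ultimately show ?thesis by (simp add: sin_60)
  qed
  have chord: "cmod (cis \<theta> - 1) = 2 * sin (\<theta> / 2)"
  proof -
    have "(cmod (cis \<theta> - 1))\<^sup>2 = (cos \<theta> - 1)\<^sup>2 + (sin \<theta>)\<^sup>2" by (simp add: cmod_power2)
    also have "\<dots> = 2 - 2 * cos \<theta>" using sin_cos_squared_add[of \<theta>] by (simp add: power2_eq_square algebra_simps)
    also have "\<dots> = (2 * sin (\<theta> / 2))\<^sup>2" using cos_double_sin[of "\<theta> / 2"] by (simp add: power_mult_distrib)
    finally show ?thesis
      by (rule power2_eq_imp_eq) (use assms in \<open>auto intro!: sin_ge_zero\<close>)
  qed
  show ?thesis
  proof (cases "\<theta> \<le> pi")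
    case True
    then show ?thesis using half[of "\<theta> / 2"] assms chord by simp
  next
    case False
    have "sin (\<theta> / 2) = sin ((2 * pi - \<theta>) / 2)"
      using sin_pi_minus[of "\<theta> / 2"] by (simp add: diff_divide_distrib)
    then show ?thesis using half[of "(2 * pi - \<theta>) / 2"] assms chord False by simp
  qed
qed

text \<open>The error vanishes at the nodes. Two points in different pieces are therefore compared through the
  nodes next to them, and no constants add up over the pieces. The node at angle \<open>0\<close>, which is also
  the one at \<open>2 \<pi>\<close>, serves for pairs whose shorter arc passes through the point \<open>1\<close>.\<close>

lemma polygon_power_error:
  assumes vs: "vs \<in> partitions 0 (2 * pi) \<Delta>"
  shows "bounded_lipschitz (sphere 0 1) (16 * (of_int n)\<^sup>2 * \<Delta>)
    (\<lambda>t. polygon (\<lambda>z. z powi n) vs t - t powi n)"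
proof -
  define E where "E t = polygon (\<lambda>z. z powi n) vs t - t powi n" for t
  define \<phi> where "\<phi> v = cis (of_int n * v)" for v
  define \<phi>' where "\<phi>' v = \<i> * of_int n * \<phi> v" for v
  define K :: real where "K = (of_int n)\<^sup>2"
  have K0: "0 \<le> K" by (simp add: K_def)
  note e = partition_ends[OF vs]
  have d: "(\<phi> has_vector_derivative \<phi>' x) (at x)" for x
  proof -
    have "((\<lambda>z. exp (\<i> * of_int n * z)) has_field_derivative exp (\<i> * of_int n * of_real x) * (\<i> * of_int n)) (at (of_real x))"
      by (auto intro!: derivative_eq_intros)
    from has_vector_derivative_real_field[OF this, of UNIV]
    show ?thesis by (simp add: \<phi>_def[abs_def] \<phi>'_def cis_conv_exp mult.assoc mult.commute mult.left_commute)
  qed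
  have K: "cmod (\<phi>' x - \<phi>' y) \<le> K * \<bar>x - y\<bar>" for x y
  proof -
    have "cmod (\<phi> x - \<phi> y - (x - y) *\<^sub>R 0) \<le> norm (x - y) * of_int \<bar>n\<bar>"
    proof -
      have "norm (\<phi> x - \<phi> y) \<le> of_int \<bar>n\<bar> * norm (x - y)"
      proof (rule differentiable_bound[where S = UNIV and f' = "\<lambda>x h. h *\<^sub>R \<phi>' x"])
        show "(\<phi> has_derivative (\<lambda>h. h *\<^sub>R \<phi>' z)) (at z within UNIV)" for z
          using d by (simp add: has_vector_derivative_def)
        show "onorm (\<lambda>h. h *\<^sub>R \<phi>' z) \<le> of_int \<bar>n\<bar>" for z
          by (rule onorm_le) (simp add: \<phi>'_def \<phi>_def norm_mult)
      qed auto
      then show ?thesis by (simp add: mult.commute)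
    qed
    then have "cmod (\<phi> x - \<phi> y) \<le> of_int \<bar>n\<bar> * \<bar>x - y\<bar>" by (simp add: mult.commute)
    moreover have "\<phi>' x - \<phi>' y = \<i> * of_int n * (\<phi> x - \<phi> y)" by (simp add: \<phi>'_def algebra_simps)
    ultimately have "cmod (\<phi>' x - \<phi>' y) \<le> of_int \<bar>n\<bar> * (of_int \<bar>n\<bar> * \<bar>x - y\<bar>)"
      by (simp add: norm_mult mult_left_mono)
    then show ?thesis by (simp add: K_def power2_eq_square)
  qed
  define D where "D j x = of_real ((x - vs ! j) / (vs ! Suc j - vs ! j)) * (\<phi> (vs ! Suc j) - \<phi> (vs ! j)) + \<phi> (vs ! j) - \<phi> x" for j x
  define L where "L = 2 * K * \<Delta>"
  have \<Delta>: "0 \<le> \<Delta>"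
    by (rule partition_mesh_nonneg[OF vs])
  have L: "0 \<le> L" using K0 \<Delta> by (simp add: L_def)
  have lip: "cmod (D j v - D j w) \<le> L * \<bar>v - w\<bar>"
    if j: "Suc j < length vs" and vw: "v \<in> {vs ! j..vs ! Suc j}" "w \<in> {vs ! j..vs ! Suc j}" for j v w
  proof -
    have "cmod (D j v - D j w) \<le> 2 * K * (vs ! Suc j - vs ! j) * \<bar>v - w\<bar>"
      unfolding D_def by (rule linear_interpolation_error_lipschitz[OF d K partition_step(1)[OF vs j] vw])
    also have "\<dots> \<le> 2 * K * \<Delta> * \<bar>v - w\<bar>"
      using partition_step(2)[OF vs j] K0 by (intro mult_right_mono mult_left_mono) auto
    finally show ?thesis by (simp add: L_def)
  qed
  have nodes: "D j (vs ! j) = 0" "D j (vs ! Suc j) = 0" if "Suc j < length vs" for j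
    using partition_step(1)[OF vs that] by (auto simp: D_def)
  have ED: "E (cis v) = D j v" if "Suc j < length vs" "vs ! j \<le> v" "v < vs ! Suc j" for j v
    unfolding E_def polygon_cis[OF vs that] by (simp add: D_def \<phi>_def cis_power_int)
  have arc: "cmod (E (cis v) - E (cis w)) \<le> L * (w - v)" if vw: "0 \<le> v" "v \<le> w" "w < 2 * pi" for v w
  proof -
    obtain j where j: "Suc j < length vs" "vs ! j \<le> v" "v < vs ! Suc j"
      using partition_locate[OF vs, of v] vw by auto
    obtain k where k: "Suc k < length vs" "vs ! k \<le> w" "w < vs ! Suc k"
      using partition_locate[OF vs, of w] vw by auto
    show ?thesis
    proof (cases "j = k")
      case True
      then show ?thesis using lip[OF j(1), of v w] j k vw by (simp add: ED[OF j] ED[OF k])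
    next
      case False
      have "\<not> Suc k \<le> j" using partition_mono[OF vs, of "Suc k" j] j k vw by force
      then have "Suc j \<le> k" using False by simp
      then have le: "vs ! Suc j \<le> vs ! k" using partition_mono[OF vs] k by simp
      have "cmod (D j v) \<le> L * (vs ! Suc j - v)"
        using lip[OF j(1), of v "vs ! Suc j"] nodes[OF j(1)] j by simp
      moreover have "cmod (D k w) \<le> L * (w - vs ! k)"
        using lip[OF k(1), of w "vs ! k"] nodes[OF k(1)] k by simp
      ultimately have "cmod (D j v - D k w) \<le> L * (vs ! Suc j - v) + L * (w - vs ! k)"
        using norm_triangle_ineq4[of "D j v" "D k w"] by simp
      also have "\<dots> = L * (w - v) - L * (vs ! k - vs ! Suc j)" by (simp add: algebra_simps)
      also have "\<dots> \<le> L * (w - v)" using L le by simp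
      finally show ?thesis by (simp add: ED[OF j] ED[OF k])
    qed
  qed
  have E0: "E (cis 0) = 0"
  proof -
    obtain j where j: "Suc j < length vs" "vs ! j \<le> 0" "0 < vs ! Suc j"
      using partition_locate[OF vs, of 0] by auto
    have "vs ! j = 0" using partition_mono[OF vs, of 0 j] e j by simp
    then show ?thesis using ED[OF j] nodes[OF j(1)] by simp
  qed
  have left: "cmod (E (cis v)) \<le> L * v" if "0 \<le> v" "v < 2 * pi" for v
    using arc[of 0 v] that E0 by simp
  have right: "cmod (E (cis v)) \<le> L * (2 * pi - v)" if v: "0 \<le> v" "v < 2 * pi" for v
  proof -
    obtain j where j: "Suc j < length vs" "vs ! j \<le> v" "v < vs ! Suc j"
      using partition_locate[OF vs, of v] v by auto
    have "cmod (D j v) \<le> L * (vs ! Suc j - v)"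
      using lip[OF j(1), of v "vs ! Suc j"] nodes[OF j(1)] j by simp
    also have "\<dots> \<le> L * (2 * pi - v)"
      using L partition_mono[OF vs, of "Suc j" "length vs - 1"] j(1) e by (intro mult_left_mono) auto
    finally show ?thesis by (simp add: ED[OF j])
  qed
  have chord: "cmod (E (cis v) - E (cis w)) \<le> 2 * L * cmod (cis v - cis w)"
    if vw: "0 \<le> v" "v \<le> w" "w < 2 * pi" for v w
  proof -
    have "cmod (E (cis v) - E (cis w)) \<le> cmod (E (cis v)) + cmod (E (cis w))" by (rule norm_triangle_ineq4)
    also have "\<dots> \<le> L * v + L * (2 * pi - w)" using left right vw by (intro add_mono) auto
    finally have "cmod (E (cis v) - E (cis w)) \<le> L * (2 * pi - (w - v))" by (simp add: algebra_simps)
    then have "cmod (E (cis v) - E (cis w)) \<le> L * min (w - v) (2 * pi - (w - v))"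
      using arc[OF vw] by (simp add: min_def)
    also have "\<dots> \<le> L * (2 * cmod (cis (w - v) - 1))"
      using vw L by (intro mult_left_mono chord_bound) auto
    also have "cmod (cis (w - v) - 1) = cmod (cis v * (cis (w - v) - 1))" by (simp add: norm_mult)
    also have "cis v * (cis (w - v) - 1) = cis w - cis v" by (simp add: algebra_simps cis_mult)
    finally show ?thesis by (simp add: norm_minus_commute)
  qed
  have rep: "\<exists>v. 0 \<le> v \<and> v < 2 * pi \<and> t = cis v" if "t \<in> sphere 0 1" for t
    using that Arg2pi[of t] by (intro exI[of _ "Arg2pi t"]) (auto simp: cis_conv_exp is_Arg_def)
  have "bounded_lipschitz (sphere 0 1) (8 * L) E"
    unfolding bounded_lipschitz_def
  proof (intro conjI ballI)
    show "0 \<le> 8 * L" using L by simp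
    fix t :: complex assume t: "t \<in> sphere 0 1"
    then obtain v where v: "0 \<le> v" "v < 2 * pi" "t = cis v" using rep by blast
    have "cmod (E t) \<le> L * v" using left v by simp
    also have "\<dots> \<le> L * 8" using v L pi_approx by (intro mult_left_mono) auto
    finally show "cmod (E t) \<le> 8 * L" by simp
    fix t' :: complex assume t': "t' \<in> sphere 0 1"
    then obtain w where w: "0 \<le> w" "w < 2 * pi" "t' = cis w" using rep by blast
    have "cmod (E t - E t') \<le> 2 * L * cmod (t - t')"
      using chord[of v w] chord[of w v] v w by (cases "v \<le> w") (auto simp: norm_minus_commute)
    also have "\<dots> \<le> 8 * L * dist t t'" unfolding dist_norm using L by (intro mult_right_mono) auto
    finally show "cmod (E t - E t') \<le> 8 * L * dist t t'" .
  qed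
  then show ?thesis by (simp add: E_def[abs_def] L_def K_def mult.assoc)
qed

lemma polygon_dilate_laurent:
  "polygon (dilate (laurent r s c) \<rho>) vs t =
     (\<Sum>n = - int r..int s. c n * of_real \<rho> powi n * polygon (\<lambda>z. z powi n) vs t)"
proof -
  have linear: "w * ((\<Sum>n\<in>I. f n * g n) - (\<Sum>n\<in>I. f n * h n)) + (\<Sum>n\<in>I. f n * h n) =
      (\<Sum>n\<in>I. f n * (w * (g n - h n) + h n))" for w :: complex and I :: "int set" and f g h
  proof -
    have "(\<Sum>n\<in>I. f n * (w * (g n - h n) + h n)) = (\<Sum>n\<in>I. w * (f n * g n) - w * (f n * h n) + f n * h n)"
      by (intro sum.cong refl) (simp add: algebra_simps)
    then show ?thesis by (simp add: sum.distrib sum_subtractf sum_distrib_left right_diff_distrib)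
  qed
  show ?thesis
    unfolding polygon_def Let_def dilate_def laurent_def power_int_mult_distrib mult.assoc[symmetric]
    by (rule linear)
qed

text \<open>The discretized symbols for all radii \<open>\<rho>\<close>, put together into one function on an annulus:
  at the point \<open>\<rho> t\<close> with \<open>\<bar>t\<bar> = 1\<close> the error is that of the polygon of radius \<open>\<rho>\<close> at \<open>t\<close>.\<close>

definition polygon_error :: "(complex \<Rightarrow> complex) \<Rightarrow> real list \<Rightarrow> complex \<Rightarrow> complex" where
  "polygon_error f vs z = polygon (dilate f (cmod z)) vs (z / of_real (cmod z)) - f z"

lemma polygon_dilate_eq:
  assumes "0 < \<rho>" "cmod t = 1"
  shows "polygon (dilate f \<rho>) vs t = f (of_real \<rho> * t) + polygon_error f vs (of_real \<rho> * t)"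
  using assms by (simp add: polygon_error_def norm_mult)

text \<open>By linearity the error is \<open>\<Sum> c\<^sub>n \<bar>z\<bar>\<^sup>n e\<^sub>n (z / \<bar>z\<bar>)\<close>, where \<open>e\<^sub>n\<close> is the error of \<open>t\<^sup>n\<close>; all
  factors are bounded Lipschitz functions on the annulus and \<open>e\<^sub>n\<close> is small in that sense.\<close>

theorem polygon_error_lipschitz:
  assumes \<rho>: "0 < \<rho>1"
  obtains C where "0 < C"
    "\<And>\<Delta> vs. vs \<in> partitions 0 (2 * pi) \<Delta> \<Longrightarrow>
       bounded_lipschitz (annulus \<rho>1 \<rho>2) (C * \<Delta>) (polygon_error (laurent r s c) vs)"
proof -
  let ?X = "annulus \<rho>1 \<rho>2"
  have X0: "cmod z > 0" if "z \<in> ?X" for z using that \<rho> by auto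
  have norm: "bounded_lipschitz ?X (max 1 \<rho>2) (\<lambda>z. of_real (cmod z))"
    unfolding bounded_lipschitz_def
  proof (intro conjI ballI)
    fix z w
    have "\<bar>cmod z - cmod w\<bar> \<le> 1 * dist z w" by (simp add: dist_norm norm_triangle_ineq3)
    also have "\<dots> \<le> max 1 \<rho>2 * dist z w" by (intro mult_right_mono) auto
    finally show "cmod (of_real (cmod z) - of_real (cmod w)) \<le> max 1 \<rho>2 * dist z w"
      by (metis norm_of_real of_real_diff)
  qed auto
  have "\<exists>B. bounded_lipschitz ?X B (\<lambda>z. of_real (cmod z) powi n)" for n
    using bounded_lipschitz_powi[OF norm \<rho>] by auto
  then obtain B where B: "\<And>n. bounded_lipschitz ?X (B n) (\<lambda>z. of_real (cmod z) powi n)" by metis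
  define L where "L = max 1 (2 / \<rho>1)"
  have dir: "dist (z / of_real (cmod z)) (w / of_real (cmod w)) \<le> L * dist z w" if zw: "z \<in> ?X" "w \<in> ?X" for z w
  proof -
    have n0: "cmod z \<noteq> 0" "cmod w \<noteq> 0" using X0[OF zw(1)] X0[OF zw(2)] by simp_all
    have "z / of_real (cmod z) - w / of_real (cmod w) =
       ((z - w) + of_real (cmod w - cmod z) * (w / of_real (cmod w))) / of_real (cmod z)"
      using n0 by (simp add: field_simps)
    then have "dist (z / of_real (cmod z)) (w / of_real (cmod w)) =
        cmod ((z - w) + of_real (cmod w - cmod z) * (w / of_real (cmod w))) / cmod z"
      by (simp add: dist_norm norm_divide)
    also have "\<dots> \<le> (dist z w + dist z w) / \<rho>1"
    proof (intro frac_le norm_triangle_le add_mono)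
      have "cmod (of_real (cmod w - cmod z) * (w / of_real (cmod w))) = \<bar>cmod w - cmod z\<bar>"
        using n0 by (simp add: norm_mult norm_divide del: of_real_diff)
      then show "cmod (of_real (cmod w - cmod z) * (w / of_real (cmod w))) \<le> dist z w"
        by (metis dist_commute dist_norm norm_triangle_ineq3)
    qed (use zw \<rho> in \<open>auto simp: dist_norm\<close>)
    also have "\<dots> = (2 / \<rho>1) * dist z w" by simp
    also have "\<dots> \<le> L * dist z w" unfolding L_def by (intro mult_right_mono) auto
    finally show ?thesis .
  qed
  define C where "C = 1 + (\<Sum>n = - int r..int s. 2 * (2 * cmod (c n) * B n) * (16 * (of_int n)\<^sup>2 * L))"
  have B0: "0 \<le> B n" for n using bounded_lipschitzD(1)[OF B] .
  have L1: "1 \<le> L" by (simp add: L_def)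
  have "0 \<le> (\<Sum>n = - int r..int s. 2 * (2 * cmod (c n) * B n) * (16 * (of_int n)\<^sup>2 * L))"
    using B0 L1 by (intro sum_nonneg) auto
  then have C: "0 < C" by (simp add: C_def)
  show ?thesis
  proof (rule that[OF C])
    fix \<Delta> vs assume vs: "vs \<in> partitions 0 (2 * pi) \<Delta>"
    have \<Delta>: "0 \<le> \<Delta>" by (rule partition_mesh_nonneg[OF vs])
    define e where "e n t = polygon (\<lambda>z. z powi n) vs t - t powi n" for n :: int and t
    define E where "E z = (\<Sum>n = - int r..int s. (c n * of_real (cmod z) powi n) * e n (z / of_real (cmod z)))" for z
    have en: "bounded_lipschitz ?X ((16 * (of_int n)\<^sup>2 * \<Delta>) * L) (\<lambda>z. e n (z / of_real (cmod z)))" for n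
      unfolding e_def
      by (rule bounded_lipschitz_compose[OF polygon_power_error[OF vs] _ L1 dir])
        (use X0 in \<open>auto simp: norm_divide\<close>)
    have "bounded_lipschitz ?X (\<Sum>n = - int r..int s. 2 * (2 * cmod (c n) * B n) * ((16 * (of_int n)\<^sup>2 * \<Delta>) * L)) E"
      unfolding E_def
      by (intro bounded_lipschitz_sum bounded_lipschitz_mult bounded_lipschitz_const B en)
    moreover have "(\<Sum>n = - int r..int s. 2 * (2 * cmod (c n) * B n) * ((16 * (of_int n)\<^sup>2 * \<Delta>) * L)) = (C - 1) * \<Delta>"
      unfolding C_def add_diff_cancel_left' sum_distrib_right
      by (intro sum.cong refl) (simp add: mult.assoc mult.commute mult.left_commute)
    ultimately have "bounded_lipschitz ?X ((C - 1) * \<Delta>) E" by (simp only:)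
    moreover have "(C - 1) * \<Delta> \<le> C * \<Delta>" using \<Delta> by (simp add: algebra_simps)
    ultimately have bl: "bounded_lipschitz ?X (C * \<Delta>) E" by (rule bounded_lipschitz_mono)
    have "polygon_error (laurent r s c) vs z = E z" if z: "z \<in> ?X" for z
    proof -
      have "laurent r s c z = laurent r s c (of_real (cmod z) * (z / of_real (cmod z)))"
        using X0[OF z] by simp
      also have "\<dots> = (\<Sum>n = - int r..int s. c n * of_real (cmod z) powi n * (z / of_real (cmod z)) powi n)"
        by (simp add: laurent_def power_int_mult_distrib[symmetric] mult.assoc)
      finally show ?thesis
        unfolding polygon_error_def polygon_dilate_laurent E_def e_def
        by (simp add: sum_subtractf right_diff_distrib)
    qed
    then show "bounded_lipschitz ?X (C * \<Delta>) (polygon_error (laurent r s c) vs)"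
      using bl unfolding bounded_lipschitz_def by simp
  qed
qed

section \<open>Zeros of a perturbed Laurent polynomial\<close>

lemma uniform_positive_lower_bound:
  fixes f :: "'p \<Rightarrow> 'x::topological_space \<Rightarrow> real"
  assumes "finite P" "compact K" "\<And>p. p \<in> P \<Longrightarrow> continuous_on K (f p)"
    "\<And>p x. p \<in> P \<Longrightarrow> x \<in> K \<Longrightarrow> f p x > 0"
  obtains m where "m > 0" "\<And>p x. p \<in> P \<Longrightarrow> x \<in> K \<Longrightarrow> m \<le> f p x"
proof -
  have "\<exists>m>0. \<forall>p\<in>P. \<forall>x\<in>K. m \<le> f p x"
    using assms(1,3,4)
  proof (induction P rule: finite_induct)
    case empty show ?case by (auto intro: exI[of _ 1])
  next
    case (insert p P)
    then obtain m where m: "m > 0" "\<forall>p\<in>P. \<forall>x\<in>K. m \<le> f p x" by auto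
    have "\<exists>m'>0. \<forall>x\<in>K. m' \<le> f p x"
    proof (cases "K = {}")
      case False
      have "continuous_on K (f p)" using insert.prems(1) by simp
      then obtain x where "x \<in> K" "\<forall>y\<in>K. f p x \<le> f p y"
        using continuous_attains_inf[OF assms(2) False] by blast
      then show ?thesis using insert.prems(2)[of p x] by auto
    qed (auto intro: exI[of _ 1])
    then obtain m' where "m' > 0" "\<forall>x\<in>K. m' \<le> f p x" by blast
    then show ?case using m by (intro exI[of _ "min m m'"]) (auto simp: min_le_iff_disj)
  qed
  then show ?thesis using that by blast
qed

text \<open>\<open>Z \<xi>\<close> is the fixed point of the contraction \<open>z \<mapsto> \<xi> - p z\<close>; it depends on \<open>\<xi>\<close> with Lipschitz constant \<open>2\<close>.\<close>

lemma perturbed_identity_inverse: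
  fixes p :: "complex \<Rightarrow> complex"
  assumes K: "\<And>\<xi>. \<xi> \<in> \<Gamma> \<Longrightarrow> cball \<xi> \<eta> \<subseteq> K" and \<eta>: "0 \<le> \<eta>"
    and p: "\<And>z. z \<in> K \<Longrightarrow> cmod (p z) \<le> \<eta>"
      "\<And>z w. z \<in> K \<Longrightarrow> w \<in> K \<Longrightarrow> cmod (p z - p w) \<le> 1 / 2 * dist z w"
  obtains Z where "continuous_on \<Gamma> Z" "\<And>\<xi>. \<xi> \<in> \<Gamma> \<Longrightarrow> Z \<xi> \<in> K" "\<And>\<xi>. \<xi> \<in> \<Gamma> \<Longrightarrow> Z \<xi> + p (Z \<xi>) = \<xi>"
proof -
  have "\<exists>z. z \<in> K \<and> z + p z = \<xi>" if \<xi>: "\<xi> \<in> \<Gamma>" for \<xi>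
  proof -
    have "\<exists>!z. z \<in> cball \<xi> \<eta> \<and> \<xi> - p z = z"
    proof (rule Banach_fix)
      show "complete (cball \<xi> \<eta>)" by (simp add: complete_eq_closed)
      show "cball \<xi> \<eta> \<noteq> {}" using \<eta> by simp
      show "(\<lambda>z. \<xi> - p z) ` cball \<xi> \<eta> \<subseteq> cball \<xi> \<eta>"
        using K[OF \<xi>] p(1) by (auto simp: dist_norm)
      show "dist (\<xi> - p z) (\<xi> - p w) \<le> 1 / 2 * dist z w" if zw: "z \<in> cball \<xi> \<eta>" "w \<in> cball \<xi> \<eta>" for z w
      proof -
        have "z \<in> K" "w \<in> K" using K[OF \<xi>] zw by blast+
        from p(2)[OF this] show ?thesis by (simp add: dist_norm norm_minus_commute)
      qed
    qed auto
    then obtain z where "z \<in> cball \<xi> \<eta>" "\<xi> - p z = z" by blast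
    then show ?thesis using K[OF \<xi>] by (metis diff_add_cancel subsetD)
  qed
  then obtain Z where Z: "\<And>\<xi>. \<xi> \<in> \<Gamma> \<Longrightarrow> Z \<xi> \<in> K" "\<And>\<xi>. \<xi> \<in> \<Gamma> \<Longrightarrow> Z \<xi> + p (Z \<xi>) = \<xi>" by metis
  have "dist (Z \<xi>) (Z \<zeta>) \<le> 2 * dist \<xi> \<zeta>" if "\<xi> \<in> \<Gamma>" "\<zeta> \<in> \<Gamma>" for \<xi> \<zeta>
  proof -
    have "Z \<xi> - Z \<zeta> = (\<xi> - \<zeta>) - (p (Z \<xi>) - p (Z \<zeta>))"
      using Z(2)[OF that(1)] Z(2)[OF that(2)] by (metis add_diff_cancel_right' diff_diff_eq2 diff_add_eq)
    then have "dist (Z \<xi>) (Z \<zeta>) \<le> dist \<xi> \<zeta> + cmod (p (Z \<xi>) - p (Z \<zeta>))"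
      by (simp only: dist_norm norm_triangle_ineq4)
    also have "\<dots> \<le> dist \<xi> \<zeta> + 1 / 2 * dist (Z \<xi>) (Z \<zeta>)"
      using p(2)[OF Z(1)[OF that(1)] Z(1)[OF that(2)]] by simp
    finally show ?thesis by simp
  qed
  then have "2-lipschitz_on \<Gamma> Z" by (simp add: lipschitz_on_def)
  then show ?thesis using that[of Z] Z lipschitz_on_continuous_on by blast
qed

lemma Ln_near_one:
  assumes "cmod w \<le> 1 / 2" "cmod w' \<le> 1 / 2"
  shows "cmod (Ln (1 + w) - Ln (1 + w')) \<le> 2 * cmod (w - w')"
proof -
  have Re: "1 / 2 \<le> Re z" if "z \<in> cball (1::complex) (1/2)" for z
    using that abs_Re_le_cmod[of "1 - z"] by (simp add: dist_norm)
  have "cmod (Ln (1 + w) - Ln (1 + w')) \<le> 2 * cmod ((1 + w) - (1 + w'))"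
  proof (rule field_differentiable_bound[of "cball 1 (1/2)" Ln "\<lambda>z. inverse z"])
    fix z :: complex assume z: "z \<in> cball 1 (1/2)"
    have "z \<notin> \<real>\<^sub>\<le>\<^sub>0" using Re[OF z] by (auto simp: complex_nonpos_Reals_iff)
    then show "(Ln has_field_derivative inverse z) (at z within cball 1 (1/2))"
      by (rule has_field_derivative_at_within[OF has_field_derivative_Ln])
    have "1 / 2 \<le> cmod z" using Re[OF z] complex_Re_le_cmod[of z] by linarith
    then have "inverse (cmod z) \<le> inverse (1 / 2)" by (rule le_imp_inverse_le) simp
    then show "cmod (inverse z) \<le> 2" by (simp add: norm_inverse)
  next
    show "convex (cball (1::complex) (1/2))" by (rule convex_cball)
    show "1 + w \<in> cball 1 (1/2)" "1 + w' \<in> cball 1 (1/2)" using assms by (simp_all add: dist_norm)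
  qed
  then show ?thesis by simp
qed

text \<open>For the \<open>w\<^sub>j\<close> closest to \<open>z\<close>, all other factors of the product are at least \<open>d\<close>.\<close>

lemma root_product_lower_bound:
  assumes J: "finite J" "J \<noteq> {}" and d: "0 < d"
    and sep: "\<And>i k. i \<in> J \<Longrightarrow> k \<in> J \<Longrightarrow> i \<noteq> k \<Longrightarrow> 2 * d \<le> cmod (w i - w k)"
  obtains j where "j \<in> J" "cmod (z - w j) * d ^ (card J - 1) \<le> cmod (\<Prod>k\<in>J. z - w k)"
proof -
  define j where "j = arg_min_on (\<lambda>k. cmod (z - w k)) J"
  have j: "j \<in> J" unfolding j_def by (rule arg_min_if_finite(1)[OF J])
  have jmin: "cmod (z - w j) \<le> cmod (z - w k)" if "k \<in> J" for k
    unfolding j_def using arg_min_least[OF J that, of "\<lambda>k. cmod (z - w k)"] by simp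
  have "d \<le> cmod (z - w k)" if k: "k \<in> J - {j}" for k
  proof -
    have "2 * d \<le> cmod (w j - w k)" using sep[of j k] j k by auto
    also have "w j - w k = (z - w k) - (z - w j)" by simp
    also have "cmod \<dots> \<le> cmod (z - w k) + cmod (z - w j)" by (rule norm_triangle_ineq4)
    also have "\<dots> \<le> cmod (z - w k) + cmod (z - w k)" using jmin[of k] k by simp
    finally show ?thesis by simp
  qed
  then have "(\<Prod>k\<in>J - {j}. d) \<le> (\<Prod>k\<in>J - {j}. cmod (z - w k))"
    using d by (intro prod_mono) auto
  then have "cmod (z - w j) * d ^ (card J - 1) \<le> cmod (z - w j) * (\<Prod>k\<in>J - {j}. cmod (z - w k))"
    using j J(1) by (intro mult_left_mono) auto
  also have "\<dots> = cmod (\<Prod>k\<in>J. z - w k)"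
    using J(1) j by (simp add: prod_norm[symmetric] norm_mult prod.remove)
  finally show ?thesis using that j by blast
qed

lemma bounded_lipschitz_root_product_diff:
  assumes J: "finite J" and R: "0 \<le> R" "\<And>z. z \<in> X \<Longrightarrow> cmod z \<le> R"
  shows "\<exists>C\<ge>0. \<forall>y w \<kappa>. 0 \<le> \<kappa> \<longrightarrow> (\<forall>j\<in>J. cmod (y j) \<le> R \<and> cmod (w j) \<le> R \<and> cmod (y j - w j) \<le> \<kappa>) \<longrightarrow>
       bounded_lipschitz X (C * \<kappa>) (\<lambda>z. (\<Prod>j\<in>J. z - y j) - (\<Prod>j\<in>J. z - w j))"
proof -
  have lin: "bounded_lipschitz X (2 * R + 1) (\<lambda>z. z - a)" if "cmod a \<le> R" for a
    unfolding bounded_lipschitz_def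
  proof (intro conjI ballI)
    fix z assume z: "z \<in> X"
    show "cmod (z - a) \<le> 2 * R + 1" using norm_triangle_ineq4[of z a] R(2)[OF z] that by simp
    fix w
    have "cmod (z - a - (w - a)) = 1 * dist z w" by (simp add: dist_norm)
    also have "\<dots> \<le> (2 * R + 1) * dist z w" using R by (intro mult_right_mono) auto
    finally show "cmod (z - a - (w - a)) \<le> (2 * R + 1) * dist z w" .
  qed (use R in auto)
  have prod: "\<exists>B. \<forall>w. (\<forall>j\<in>J. cmod (w j) \<le> R) \<longrightarrow> bounded_lipschitz X B (\<lambda>z. \<Prod>j\<in>J. z - w j)"
    if "finite J" for J :: "'a set"
    using that
  proof (induction J rule: finite_induct)
    case empty show ?case using bounded_lipschitz_const[of X 1] by auto
  next
    case (insert i J)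
    then obtain B where B: "\<And>w. (\<forall>j\<in>J. cmod (w j) \<le> R) \<Longrightarrow> bounded_lipschitz X B (\<lambda>z. \<Prod>j\<in>J. z - w j)" by blast
    have "bounded_lipschitz X (2 * (2 * R + 1) * B) (\<lambda>z. \<Prod>j\<in>insert i J. z - w j)"
      if "\<forall>j\<in>insert i J. cmod (w j) \<le> R" for w
      using bounded_lipschitz_mult[OF lin B, of "w i" w] that insert(1,2) by simp
    then show ?case by blast
  qed
  show "\<exists>C\<ge>0. \<forall>y w \<kappa>. 0 \<le> \<kappa> \<longrightarrow> (\<forall>j\<in>J. cmod (y j) \<le> R \<and> cmod (w j) \<le> R \<and> cmod (y j - w j) \<le> \<kappa>) \<longrightarrow>
       bounded_lipschitz X (C * \<kappa>) (\<lambda>z. (\<Prod>j\<in>J. z - y j) - (\<Prod>j\<in>J. z - w j))"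
    using J
  proof (induction J rule: finite_induct)
    case empty show ?case by (auto intro!: exI[of _ 0] simp: bounded_lipschitz_def)
  next
    case (insert i J)
    obtain B where B: "\<And>w. (\<forall>j\<in>J. cmod (w j) \<le> R) \<Longrightarrow> bounded_lipschitz X B (\<lambda>z. \<Prod>j\<in>J. z - w j)"
      using prod[OF insert(1)] by blast
    obtain C where C: "C \<ge> 0" "\<And>y w \<kappa>. 0 \<le> \<kappa> \<Longrightarrow> (\<forall>j\<in>J. cmod (y j) \<le> R \<and> cmod (w j) \<le> R \<and> cmod (y j - w j) \<le> \<kappa>) \<Longrightarrow>
       bounded_lipschitz X (C * \<kappa>) (\<lambda>z. (\<Prod>j\<in>J. z - y j) - (\<Prod>j\<in>J. z - w j))"
      using insert.IH by blast
    have "bounded_lipschitz X ((2 * (2 * R + 1) * C + 2 * \<bar>B\<bar>) * \<kappa>)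
        (\<lambda>z. (\<Prod>j\<in>insert i J. z - y j) - (\<Prod>j\<in>insert i J. z - w j))"
      if \<kappa>: "0 \<le> \<kappa>" and yw: "\<forall>j\<in>insert i J. cmod (y j) \<le> R \<and> cmod (w j) \<le> R \<and> cmod (y j - w j) \<le> \<kappa>" for y w \<kappa>
    proof -
      have B': "bounded_lipschitz X \<bar>B\<bar> (\<lambda>z. \<Prod>j\<in>J. z - w j)"
        by (rule bounded_lipschitz_mono[OF B]) (use yw in auto)
      have k: "bounded_lipschitz X \<kappa> (\<lambda>z. w i - y i)"
        by (rule bounded_lipschitz_mono[OF bounded_lipschitz_const]) (use yw in \<open>auto simp: norm_minus_commute\<close>)
      have 1: "bounded_lipschitz X (2 * (2 * R + 1) * (C * \<kappa>)) (\<lambda>z. (z - y i) * ((\<Prod>j\<in>J. z - y j) - (\<Prod>j\<in>J. z - w j)))"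
        by (intro bounded_lipschitz_mult lin C(2) \<kappa>) (use yw in auto)
      have 2: "bounded_lipschitz X (2 * \<kappa> * \<bar>B\<bar>) (\<lambda>z. (w i - y i) * (\<Prod>j\<in>J. z - w j))"
        by (rule bounded_lipschitz_mult[OF k B'])
      have eq: "(\<lambda>z. (z - y i) * ((\<Prod>j\<in>J. z - y j) - (\<Prod>j\<in>J. z - w j)) + (w i - y i) * (\<Prod>j\<in>J. z - w j)) =
         (\<lambda>z. (\<Prod>j\<in>insert i J. z - y j) - (\<Prod>j\<in>insert i J. z - w j))"
        using insert(1,2) by (simp add: algebra_simps)
      have const: "2 * (2 * R + 1) * (C * \<kappa>) + 2 * \<kappa> * \<bar>B\<bar> = (2 * (2 * R + 1) * C + 2 * \<bar>B\<bar>) * \<kappa>"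
        by (simp add: algebra_simps)
      show ?thesis using bounded_lipschitz_add[OF 1 2] unfolding eq const .
    qed
    moreover have "0 \<le> 2 * (2 * R + 1) * C + 2 * \<bar>B\<bar>" using R C(1) by simp
    ultimately show ?case by blast
  qed
qed

lemma separates_stable:
  assumes J: "finite J" "S \<subseteq> J" and sep: "separates \<rho> x J S"
  obtains g where "g > 0" "\<And>y. (\<And>j. j \<in> J \<Longrightarrow> cmod (y j - x j) < g) \<Longrightarrow> separates \<rho> y J S"
proof -
  have ne: "cmod (x j) \<noteq> \<rho>" if "j \<in> J" for j using sep that unfolding separates_def by (cases "j \<in> S") auto
  obtain g where g: "g > 0" "\<And>j y. j \<in> J \<Longrightarrow> y \<in> {0::real} \<Longrightarrow> g \<le> \<bar>cmod (x j) - \<rho>\<bar>"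
    by (rule uniform_positive_lower_bound[OF J(1), of "{0::real}" "\<lambda>j _. \<bar>cmod (x j) - \<rho>\<bar>"])
      (use ne in auto)
  show ?thesis
  proof (rule that[OF g(1)])
    fix y assume y: "\<And>j. j \<in> J \<Longrightarrow> cmod (y j - x j) < g"
    have "\<bar>cmod (y j) - cmod (x j)\<bar> < \<bar>cmod (x j) - \<rho>\<bar>" if "j \<in> J" for j
      using y[OF that] g(2)[OF that singletonI] norm_triangle_ineq3[of "y j" "x j"] by linarith
    moreover have "cmod (x j) < \<rho>" if "j \<in> S" for j using sep that by (auto simp: separates_def)
    moreover have "\<rho> < cmod (x j)" if "j \<in> J - S" for j using sep that by (auto simp: separates_def)
    ultimately show "separates \<rho> y J S"
      unfolding separates_def using J(2) by (smt (verit) DiffD1 subsetD)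
  qed
qed

text \<open>The index set that a circle separates is locally constant, and it does not depend on the circle.\<close>

lemma selection_constant:
  assumes J: "finite J" and \<Gamma>: "connected \<Gamma>" and w: "\<And>j. j \<in> J \<Longrightarrow> continuous_on \<Gamma> (w j)"
    and ex: "\<And>\<xi>. \<xi> \<in> \<Gamma> \<Longrightarrow> \<exists>\<rho> S. S \<subseteq> J \<and> card S = r \<and> separates \<rho> (\<lambda>j. w j \<xi>) J S"
    and a: "a \<in> \<Gamma>" "S \<subseteq> J" "card S = r" "separates \<rho> (\<lambda>j. w j a) J S"
    and b: "b \<in> \<Gamma>" "S' \<subseteq> J" "card S' = r" "separates \<rho>' (\<lambda>j. w j b) J S'"
  shows "S = S'"
proof -
  obtain sel rad where sel: "\<And>\<xi>. \<xi> \<in> \<Gamma> \<Longrightarrow> sel \<xi> \<subseteq> J \<and> card (sel \<xi>) = r \<and> separates (rad \<xi>) (\<lambda>j. w j \<xi>) J (sel \<xi>)"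
    using ex by metis
  have "sel a = sel b"
  proof (rule connected_local_const[OF \<Gamma> a(1) b(1)], rule ballI)
    fix \<xi> assume \<xi>: "\<xi> \<in> \<Gamma>"
    obtain g where g: "g > 0" "\<And>y. (\<And>j. j \<in> J \<Longrightarrow> cmod (y j - w j \<xi>) < g) \<Longrightarrow> separates (rad \<xi>) y J (sel \<xi>)"
      using separates_stable[of J "sel \<xi>" "rad \<xi>" "\<lambda>j. w j \<xi>"] J sel[OF \<xi>] by blast
    have "\<forall>\<^sub>F \<zeta> in at \<xi> within \<Gamma>. \<forall>j\<in>J. cmod (w j \<zeta> - w j \<xi>) < g"
      unfolding eventually_ball_finite_distrib[OF J]
    proof
      fix j assume "j \<in> J"
      then have "(w j \<longlongrightarrow> w j \<xi>) (at \<xi> within \<Gamma>)" using w \<xi> by (simp add: continuous_on_def)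
      from tendstoD[OF this g(1)] show "\<forall>\<^sub>F \<zeta> in at \<xi> within \<Gamma>. cmod (w j \<zeta> - w j \<xi>) < g"
        by (simp add: dist_norm)
    qed
    moreover have "\<forall>\<^sub>F \<zeta> in at \<xi> within \<Gamma>. \<zeta> \<in> \<Gamma>" by (simp add: eventually_at_filter)
    ultimately show "\<forall>\<^sub>F \<zeta> in at \<xi> within \<Gamma>. sel \<xi> = sel \<zeta>"
    proof eventually_elim
      case (elim \<zeta>)
      then have "separates (rad \<xi>) (\<lambda>j. w j \<zeta>) J (sel \<xi>)" using g(2)[of "\<lambda>j. w j \<zeta>"] by blast
      then show ?case using separates_unique[OF J] sel[OF \<xi>] sel[OF elim(2)] by metis
    qed
  qed
  moreover have "S = sel a" using separates_unique[OF J a(2)] sel[OF a(1)] a by metis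
  moreover have "S' = sel b" using separates_unique[OF J b(2)] sel[OF b(1)] b by metis
  ultimately show ?thesis by simp
qed

context laurent_branches
begin

text \<open>In the coordinate \<open>\<tau> = exp \<xi>\<close>, which unrolls the punctured disc into a half-plane, the branches are
  \<open>v\<^sub>j \<xi> = u\<^sub>j (exp \<xi>)\<close> with \<open>b (v\<^sub>j \<xi>) = \<mu> + exp (N \<xi>)\<close>. A zero of \<open>b + E - (\<mu> + exp (N \<xi>))\<close> is sought in the
  form \<open>v\<^sub>j \<zeta>\<close>, which leads to \<open>exp (N \<zeta>) + E (v\<^sub>j \<zeta>) = exp (N \<xi>)\<close>, that is, to \<open>\<zeta> + p \<zeta> = \<xi>\<close> with
  \<open>p \<zeta> = Ln (1 + E (v\<^sub>j \<zeta>) exp (- N \<zeta>)) / N\<close>. If \<open>E\<close> is small in the Lipschitz sense, so is \<open>p\<close>.\<close>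

lemma perturbed_branches:
  assumes K: "compact K" "convex K" "\<And>\<xi>. \<xi> \<in> K \<Longrightarrow> exp \<xi> \<in> ball 0 \<epsilon>"
    and \<Gamma>: "\<And>\<xi>. \<xi> \<in> \<Gamma> \<Longrightarrow> cball \<xi> \<eta> \<subseteq> K" and \<eta>: "0 < \<eta>"
    and X: "\<And>j \<xi>. j \<in> J \<Longrightarrow> \<xi> \<in> K \<Longrightarrow> u j (exp \<xi>) \<in> X"
  obtains L where "0 < L"
    "\<And>\<kappa> E. L * \<kappa> \<le> 1 \<Longrightarrow> bounded_lipschitz X \<kappa> E \<Longrightarrow>
       \<exists>w. \<forall>j\<in>J. continuous_on \<Gamma> (w j) \<and> (\<forall>\<xi>\<in>\<Gamma>. w j \<xi> \<in> X \<and>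
          laurent r s c (w j \<xi>) + E (w j \<xi>) = \<mu> + exp \<xi> ^ N \<and> cmod (w j \<xi> - u j (exp \<xi>)) \<le> L * \<kappa>)"
proof -
  define H where "H = (exp :: complex \<Rightarrow> complex) -` ball 0 \<epsilon>"
  have "open H" unfolding H_def by (intro open_vimage open_ball continuous_intros)
  define v where "v j \<xi> = u j (exp \<xi>)" for j \<xi>
  have v: "v j holomorphic_on H" if "j \<in> J" for j
  proof -
    have "u j \<circ> exp holomorphic_on H"
      by (rule holomorphic_on_compose_gen[OF _ hol[OF that]]) (auto simp: H_def intro: holomorphic_intros)
    then show ?thesis by (simp add: v_def[abs_def] comp_def)
  qed
  have KH: "K \<subseteq> H" using K(3) by (auto simp: H_def)
  have "\<exists>B. bounded_lipschitz K B (v j)" if "j \<in> J" for j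
    using holomorphic_bounded_lipschitz[OF \<open>open H\<close> v[OF that] K(1,2) KH] by blast
  then obtain B where B: "\<And>j. j \<in> J \<Longrightarrow> bounded_lipschitz K (B j) (v j)" by metis
  define M where "M = 1 + (\<Sum>j\<in>J. \<bar>B j\<bar>)"
  have M1: "1 \<le> M" by (simp add: M_def sum_nonneg)
  have vM: "bounded_lipschitz K M (v j)" if "j \<in> J" for j
  proof (rule bounded_lipschitz_mono[OF B[OF that]])
    have "\<bar>B j\<bar> \<le> (\<Sum>j\<in>J. \<bar>B j\<bar>)" using that J(1) by (intro member_le_sum) auto
    then show "B j \<le> M" by (simp add: M_def)
  qed
  obtain B2 where B2: "bounded_lipschitz K B2 (\<lambda>\<xi>. exp (- (of_nat N * \<xi>)))"
    by (rule holomorphic_bounded_lipschitz[of UNIV "\<lambda>\<xi>. exp (- (of_nat N * \<xi>))" K])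
      (use K in \<open>auto intro!: holomorphic_intros\<close>)
  define B3 where "B3 = \<bar>B2\<bar> + 1"
  have B3: "1 \<le> B3" "bounded_lipschitz K B3 (\<lambda>\<xi>. exp (- (of_nat N * \<xi>)))"
    using bounded_lipschitz_mono[OF B2, of B3] by (auto simp: B3_def)
  define Q where "Q = 2 * M * B3"
  have Q: "Q > 0" using M1 B3(1) by (simp add: Q_def)
  define L where "L = 8 * Q * M * (1 + 1 / \<eta>)"
  have LQ: "4 * Q \<le> L" "2 * Q \<le> L * \<eta>" "2 * Q * M \<le> L"
  proof -
    define Y where "Y = Q * M"
    have Y: "Q \<le> Y" using mult_left_mono[OF M1, of Q] Q by (simp add: Y_def)
    have L: "L = 8 * Y + 8 * (Y / \<eta>)" by (simp add: L_def Y_def algebra_simps)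
    have "0 \<le> Y / \<eta>" using Y Q \<eta> by simp
    then have "4 * Q \<le> L" "2 * Y \<le> L" using L Y Q by linarith+
    then show "4 * Q \<le> L" "2 * Q * M \<le> L" by (simp_all add: Y_def)
    have "L * \<eta> = 8 * (Y * \<eta>) + 8 * Y" using \<eta> by (simp add: L field_simps)
    moreover have "0 \<le> Y * \<eta>" using Y Q \<eta> by simp
    ultimately show "2 * Q \<le> L * \<eta>" using Y Q by linarith
  qed
  have "0 < L" using LQ(1) Q by simp
  show ?thesis
  proof (rule that[OF \<open>0 < L\<close>])
    fix \<kappa> E assume \<kappa>: "L * \<kappa> \<le> 1" and E: "bounded_lipschitz X \<kappa> E"
    have \<kappa>0: "0 \<le> \<kappa>" using bounded_lipschitzD(1)[OF E] .
    \<comment> \<open>\<open>Q \<kappa>\<close> bounds \<open>e\<close> and its Lipschitz constant, \<open>2 Q \<kappa>\<close> does so for \<open>p\<close>.\<close>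
    have q: "4 * Q * \<kappa> \<le> 1" using mult_right_mono[OF LQ(1) \<kappa>0] \<kappa> by simp
    have q\<eta>: "2 * Q * \<kappa> \<le> \<eta>"
    proof -
      have "2 * Q * \<kappa> \<le> L * \<eta> * \<kappa>" using LQ(2) \<kappa>0 by (rule mult_right_mono)
      also have "\<dots> = \<eta> * (L * \<kappa>)" by simp
      also have "\<dots> \<le> \<eta> * 1" using \<kappa> \<eta> by (intro mult_left_mono) auto
      finally show ?thesis by simp
    qed
    have "\<exists>w. continuous_on \<Gamma> w \<and> (\<forall>\<xi>\<in>\<Gamma>. w \<xi> \<in> X \<and>
          laurent r s c (w \<xi>) + E (w \<xi>) = \<mu> + exp \<xi> ^ N \<and> cmod (w \<xi> - u j (exp \<xi>)) \<le> L * \<kappa>)" if j: "j \<in> J" for j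
    proof -
      define e where "e \<zeta> = E (v j \<zeta>) * exp (- (of_nat N * \<zeta>))" for \<zeta>
      have "bounded_lipschitz K (\<kappa> * M) (\<lambda>\<zeta>. E (v j \<zeta>))"
        by (rule bounded_lipschitz_compose[OF E _ M1])
          (use X[OF j] bounded_lipschitzD(3)[OF vM[OF j]] in \<open>auto simp: v_def dist_norm\<close>)
      from bounded_lipschitz_mult[OF this B3(2)]
      have e: "bounded_lipschitz K (Q * \<kappa>) e" by (simp add: e_def[abs_def] Q_def algebra_simps)
      have ehalf: "cmod (e \<zeta>) \<le> 1 / 2" if "\<zeta> \<in> K" for \<zeta>
        using bounded_lipschitzD(2)[OF e that] q Q \<kappa>0 by simp
      define p where "p \<zeta> = Ln (1 + e \<zeta>) / of_nat N" for \<zeta>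
      have N1: "1 \<le> real N" using N by simp
      have divN: "x / real N \<le> x" if "0 \<le> x" for x using that N1 by (simp add: divide_le_eq mult_le_cancel_left1)
      have plip: "cmod (p z - p w) \<le> 2 * cmod (e z - e w)" if "z \<in> K" "w \<in> K" for z w
      proof -
        have "cmod (p z - p w) = cmod (Ln (1 + e z) - Ln (1 + e w)) / real N"
          by (simp add: p_def norm_divide flip: diff_divide_distrib)
        also have "\<dots> \<le> cmod (Ln (1 + e z) - Ln (1 + e w))" by (rule divN) simp
        also have "\<dots> \<le> 2 * cmod (e z - e w)" by (rule Ln_near_one) (use ehalf that in auto)
        finally show ?thesis .
      qed
      have psmall: "cmod (p z) \<le> 2 * Q * \<kappa>" if "z \<in> K" for z
      proof -
        have "cmod (p z) = cmod (Ln (1 + e z) - Ln (1 + 0)) / real N" by (simp add: p_def norm_divide)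
        also have "\<dots> \<le> cmod (Ln (1 + e z) - Ln (1 + 0))" by (rule divN) simp
        also have "\<dots> \<le> 2 * cmod (e z - 0)" by (rule Ln_near_one) (use ehalf that in auto)
        also have "\<dots> \<le> 2 * (Q * \<kappa>)" using bounded_lipschitzD(2)[OF e that] by simp
        finally show ?thesis by simp
      qed
      have plip': "cmod (p z - p w) \<le> 1 / 2 * dist z w" if "z \<in> K" "w \<in> K" for z w
      proof -
        have "cmod (p z - p w) \<le> 2 * (Q * \<kappa> * dist z w)"
          using plip[OF that] bounded_lipschitzD(3)[OF e that] by simp
        also have "\<dots> = (2 * Q * \<kappa>) * dist z w" by simp
        also have "\<dots> \<le> 1 / 2 * dist z w" using q by (intro mult_right_mono) auto
        finally show ?thesis .
      qed
      obtain Z where Z: "continuous_on \<Gamma> Z" "\<And>\<xi>. \<xi> \<in> \<Gamma> \<Longrightarrow> Z \<xi> \<in> K" "\<And>\<xi>. \<xi> \<in> \<Gamma> \<Longrightarrow> Z \<xi> + p (Z \<xi>) = \<xi>"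
        using perturbed_identity_inverse[OF \<Gamma> less_imp_le[OF \<eta>] order_trans[OF psmall q\<eta>] plip'] by blast
      show ?thesis
      proof (intro exI[of _ "\<lambda>\<xi>. v j (Z \<xi>)"] conjI ballI)
        show "continuous_on \<Gamma> (\<lambda>\<xi>. v j (Z \<xi>))"
          by (rule continuous_on_compose2[OF bounded_lipschitz_continuous[OF vM[OF j]] Z(1)]) (use Z(2) in auto)
        fix \<xi> assume \<xi>: "\<xi> \<in> \<Gamma>"
        note ZK = Z(2)[OF \<xi>]
        show "v j (Z \<xi>) \<in> X" using X[OF j ZK] by (simp add: v_def)
        have "1 + e (Z \<xi>) \<noteq> 0" using ehalf[OF ZK] by (auto simp: add_eq_0_iff dest!: sym[of "- _"])
        then have "exp (of_nat N * p (Z \<xi>)) = 1 + e (Z \<xi>)" using N by (simp add: p_def)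
        moreover have "exp \<xi> ^ N = exp (of_nat N * Z \<xi>) * exp (of_nat N * p (Z \<xi>))"
          by (subst Z(3)[OF \<xi>, symmetric]) (simp add: exp_of_nat_mult[symmetric] exp_add[symmetric] distrib_left)
        ultimately have "exp \<xi> ^ N = exp (of_nat N * Z \<xi>) + E (v j (Z \<xi>)) * (exp (of_nat N * Z \<xi>) * exp (- (of_nat N * Z \<xi>)))"
          by (simp add: e_def algebra_simps)
        also have "exp (of_nat N * Z \<xi>) * exp (- (of_nat N * Z \<xi>)) = 1" by (simp flip: exp_add)
        finally have "exp \<xi> ^ N = exp (Z \<xi>) ^ N + E (v j (Z \<xi>))" by (simp add: exp_of_nat_mult)
        moreover have "laurent r s c (v j (Z \<xi>)) = \<mu> + exp (Z \<xi>) ^ N"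
          unfolding v_def by (rule laurent_branch[OF K(3)[OF ZK] j])
        ultimately show "laurent r s c (v j (Z \<xi>)) + E (v j (Z \<xi>)) = \<mu> + exp \<xi> ^ N" by simp
        have \<xi>K: "\<xi> \<in> K" using \<Gamma>[OF \<xi>] \<eta> by auto
        have "cmod (v j (Z \<xi>) - v j \<xi>) \<le> M * dist (Z \<xi>) \<xi>" by (rule bounded_lipschitzD(3)[OF vM[OF j] ZK \<xi>K])
        also have "dist (Z \<xi>) \<xi> = cmod (p (Z \<xi>))"
          using Z(3)[OF \<xi>] by (metis add_diff_cancel_left' dist_commute dist_norm)
        also have "M * cmod (p (Z \<xi>)) \<le> M * (2 * Q * \<kappa>)" using psmall[OF ZK] M1 by (intro mult_left_mono) auto
        also have "\<dots> = 2 * Q * M * \<kappa>" by simp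
        also have "\<dots> \<le> L * \<kappa>" using LQ(3) \<kappa>0 by (rule mult_right_mono)
        finally show "cmod (v j (Z \<xi>) - u j (exp \<xi>)) \<le> L * \<kappa>" by (simp add: v_def)
      qed
    qed
    then show "\<exists>w. \<forall>j\<in>J. continuous_on \<Gamma> (w j) \<and> (\<forall>\<xi>\<in>\<Gamma>. w j \<xi> \<in> X \<and>
          laurent r s c (w j \<xi>) + E (w j \<xi>) = \<mu> + exp \<xi> ^ N \<and> cmod (w j \<xi> - u j (exp \<xi>)) \<le> L * \<kappa>)"
      by (intro bchoice) blast
  qed
qed

end

context laurent_branches
begin

text \<open>Both \<open>b + E - (\<mu> + \<tau>\<^sup>N)\<close> and \<open>G z = c\<^sub>s z\<^sup>-\<^sup>r \<Prod> (z - w\<^sub>j)\<close> vanish at every \<open>w\<^sub>j\<close>, and their difference \<open>F\<close> has a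
  small Lipschitz constant. Hence \<open>\<bar>F z\<bar>\<close> is a small multiple of the distance from \<open>z\<close> to the closest
  \<open>w\<^sub>j\<close>, whereas \<open>\<bar>G z\<bar>\<close> is at least a fixed multiple of it, since the \<open>w\<^sub>j\<close> stay apart from each other.\<close>

lemma perturbed_factor:
  fixes \<rho>1 \<rho>2 d :: real
  assumes \<rho>: "0 < \<rho>1" and d: "0 < d"
  defines "X \<equiv> annulus \<rho>1 \<rho>2"
  obtains \<delta> where "0 < \<delta>"
    "\<And>\<tau> \<kappa> E w z. \<tau> \<in> ball 0 \<epsilon> \<Longrightarrow> (\<And>i k. i \<in> J \<Longrightarrow> k \<in> J \<Longrightarrow> i \<noteq> k \<Longrightarrow> 4 * d \<le> cmod (u i \<tau> - u k \<tau>)) \<Longrightarrow>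
       (\<And>j. j \<in> J \<Longrightarrow> u j \<tau> \<in> X) \<Longrightarrow> \<kappa> \<le> \<delta> \<Longrightarrow> bounded_lipschitz X \<kappa> E \<Longrightarrow>
       (\<And>j. j \<in> J \<Longrightarrow> w j \<in> X \<and> laurent r s c (w j) + E (w j) = \<mu> + \<tau> ^ N \<and> cmod (w j - u j \<tau>) \<le> \<kappa>) \<Longrightarrow>
       z \<in> X \<Longrightarrow>
       cmod (laurent r s c z + E z - (\<mu> + \<tau> ^ N) - c (int s) / z ^ r * (\<Prod>j\<in>J. z - w j))
         \<le> 1 / 2 * cmod (c (int s) / z ^ r * (\<Prod>j\<in>J. z - w j))"
proof (cases "\<rho>1 \<le> \<rho>2")
  case False
  then have "X = {}" by (auto simp: X_def)
  then show ?thesis using that[of 1] by auto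
next
  case True
  then have \<rho>2: "0 < \<rho>2" using \<rho> by simp
  have Jne: "J \<noteq> {}" using J(2) r by auto
  have id: "bounded_lipschitz X (max 1 \<rho>2) (\<lambda>z. z)" by (rule bounded_lipschitz_id) (auto simp: X_def)
  have inv: "bounded_lipschitz X (max (1 / \<rho>1) (max 1 \<rho>2 / \<rho>1\<^sup>2)) (\<lambda>z. inverse z)"
    by (rule bounded_lipschitz_inverse[OF id \<rho>]) (auto simp: X_def)
  obtain B0 where "bounded_lipschitz X B0 (\<lambda>z. inverse z ^ r)" using bounded_lipschitz_power[OF inv] by blast
  from bounded_lipschitz_mult[OF bounded_lipschitz_const[of X "c (int s)"] this]
  obtain B where B: "bounded_lipschitz X B (\<lambda>z. c (int s) / z ^ r)"
    by (simp add: divide_inverse power_inverse)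
  have B0: "0 \<le> B" by (rule bounded_lipschitzD(1)[OF B])
  obtain C where C: "C \<ge> 0" "\<And>y w \<kappa>. 0 \<le> \<kappa> \<Longrightarrow> (\<forall>j\<in>J. cmod (y j) \<le> \<rho>2 \<and> cmod (w j) \<le> \<rho>2 \<and> cmod (y j - w j) \<le> \<kappa>) \<Longrightarrow>
       bounded_lipschitz X (C * \<kappa>) (\<lambda>z. (\<Prod>j\<in>J. z - y j) - (\<Prod>j\<in>J. z - w j))"
    using bounded_lipschitz_root_product_diff[OF J(1), of \<rho>2 X] \<rho>2 by (auto simp: X_def)
  define m where "m = cmod (c (int s)) / \<rho>2 ^ r * d ^ (card J - 1)"
  have m: "0 < m" using cs \<rho>2 d by (simp add: m_def)
  define A where "A = 1 + 2 * B * C"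
  have A: "1 \<le> A" using B0 C(1) by (simp add: A_def)
  define \<delta> where "\<delta> = min d (m / (2 * A))"
  have \<delta>: "0 < \<delta>" "\<delta> \<le> d" "A * \<delta> \<le> m / 2"
  proof -
    show "0 < \<delta>" "\<delta> \<le> d" using d m A by (auto simp: \<delta>_def)
    have "A * \<delta> \<le> A * (m / (2 * A))" using A by (intro mult_left_mono) (auto simp: \<delta>_def)
    then show "A * \<delta> \<le> m / 2" using A by simp
  qed
  show ?thesis
  proof (rule that[OF \<delta>(1)])
    fix \<tau> \<kappa> E w z
    assume \<tau>: "\<tau> \<in> ball 0 \<epsilon>" and sep: "\<And>i k. i \<in> J \<Longrightarrow> k \<in> J \<Longrightarrow> i \<noteq> k \<Longrightarrow> 4 * d \<le> cmod (u i \<tau> - u k \<tau>)"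
      and uX: "\<And>j. j \<in> J \<Longrightarrow> u j \<tau> \<in> X" and \<kappa>: "\<kappa> \<le> \<delta>" and E: "bounded_lipschitz X \<kappa> E"
      and w: "\<And>j. j \<in> J \<Longrightarrow> w j \<in> X \<and> laurent r s c (w j) + E (w j) = \<mu> + \<tau> ^ N \<and> cmod (w j - u j \<tau>) \<le> \<kappa>"
      and z: "z \<in> X"
    have \<kappa>0: "0 \<le> \<kappa>" by (rule bounded_lipschitzD(1)[OF E])
    define G where "G z = c (int s) / z ^ r * (\<Prod>j\<in>J. z - w j)" for z
    define F where "F z = laurent r s c z + E z - (\<mu> + \<tau> ^ N) - G z" for z
    have nz: "z \<noteq> 0" if "z \<in> X" for z using that \<rho> by (auto simp: X_def)
    have Feq: "F z = E z + c (int s) / z ^ r * ((\<Prod>j\<in>J. z - u j \<tau>) - (\<Prod>j\<in>J. z - w j))" if "z \<in> X" for z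
    proof -
      have "F z = (laurent r s c z - (\<mu> + \<tau> ^ N)) + E z - G z" by (simp add: F_def)
      then show ?thesis unfolding laurent_factor[OF \<tau> nz[OF that]] by (simp add: G_def right_diff_distrib)
    qed
    have "bounded_lipschitz X (\<kappa> + 2 * B * (C * \<kappa>))
        (\<lambda>z. E z + c (int s) / z ^ r * ((\<Prod>j\<in>J. z - u j \<tau>) - (\<Prod>j\<in>J. z - w j)))"
      by (intro bounded_lipschitz_add E bounded_lipschitz_mult B C(2) \<kappa>0)
        (use uX w in \<open>auto simp: X_def norm_minus_commute\<close>)
    moreover have "\<kappa> + 2 * B * (C * \<kappa>) = A * \<kappa>" by (simp add: A_def algebra_simps)
    ultimately have F: "bounded_lipschitz X (A * \<kappa>) F"
      unfolding bounded_lipschitz_def using Feq by auto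
    have wsep: "2 * d \<le> cmod (w i - w k)" if "i \<in> J" "k \<in> J" "i \<noteq> k" for i k
    proof -
      have "u i \<tau> - u k \<tau> = (w i - w k) + ((u i \<tau> - w i) - (u k \<tau> - w k))" by simp
      then have "cmod (u i \<tau> - u k \<tau>) \<le> cmod (w i - w k) + (cmod (u i \<tau> - w i) + cmod (u k \<tau> - w k))"
        by (metis norm_triangle_le norm_triangle_ineq4 add_left_mono)
      then show ?thesis using sep[OF that] w[OF that(1)] w[OF that(2)] \<kappa> \<delta>(2) by (simp add: norm_minus_commute)
    qed
    obtain j where j: "j \<in> J" "cmod (z - w j) * d ^ (card J - 1) \<le> cmod (\<Prod>k\<in>J. z - w k)"
      by (rule root_product_lower_bound[OF J(1) Jne d, of w z]) (rule wsep)
    have "F (w j) = 0" using w[OF j(1)] j(1) J(1) by (auto simp: F_def G_def)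
    then have "cmod (F z) \<le> A * \<kappa> * cmod (z - w j)"
      using bounded_lipschitzD(3)[OF F z, of "w j"] w[OF j(1)] by (simp add: dist_norm)
    also have "\<dots> \<le> (A * \<delta>) * cmod (z - w j)" using \<kappa> A by (intro mult_right_mono mult_left_mono) auto
    also have "\<dots> \<le> m / 2 * cmod (z - w j)" by (intro mult_right_mono \<delta>(3)) simp
    also have "\<dots> = 1 / 2 * (cmod (c (int s)) / \<rho>2 ^ r * (cmod (z - w j) * d ^ (card J - 1)))" by (simp add: m_def mult_ac)
    also have "\<dots> \<le> 1 / 2 * (cmod (c (int s)) / cmod z ^ r * cmod (\<Prod>k\<in>J. z - w k))"
      using z nz[OF z] \<rho>2 d j(2)
      by (intro mult_left_mono mult_mono frac_le power_mono) (auto simp: X_def)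
    also have "\<dots> = 1 / 2 * cmod (G z)" by (simp add: G_def norm_mult norm_divide norm_power)
    finally show "cmod (laurent r s c z + E z - (\<mu> + \<tau> ^ N) - c (int s) / z ^ r * (\<Prod>j\<in>J. z - w j))
         \<le> 1 / 2 * cmod (c (int s) / z ^ r * (\<Prod>j\<in>J. z - w j))"
      by (simp add: F_def G_def)
  qed
qed

text \<open>On a circle that avoids all \<open>w\<^sub>j\<close> the symbol is \<open>t\<^sup>-\<^sup>r \<Prod> (t - w\<^sub>j / \<rho>')\<close> times an invertible factor, so that
  the circle would have exactly \<open>r\<close> of the \<open>w\<^sub>j\<close> inside if the operator were invertible. An exceptional radius is
  a limit of such radii, and invertibility is an open condition.\<close>

lemma unseparated_not_invertible:
  fixes \<rho>1 \<rho>2 :: real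
  assumes \<rho>1: "0 < \<rho>1"
  defines "X \<equiv> annulus \<rho>1 \<rho>2"
  assumes E: "bounded_lipschitz X \<kappa> E"
    and close: "\<And>z. z \<in> X \<Longrightarrow> cmod (laurent r s c z + E z - \<nu> - c (int s) / z ^ r * (\<Prod>j\<in>J. z - w j))
         \<le> 1 / 2 * cmod (c (int s) / z ^ r * (\<Prod>j\<in>J. z - w j))"
    and unsep: "\<not> (\<exists>\<rho> S. S \<subseteq> J \<and> card S = r \<and> separates \<rho> w J S)"
    and \<rho>: "\<rho>1 < \<rho>" "\<rho> < \<rho>2"
  shows "\<not> invertible_l2 (toeplitz (\<lambda>t. laurent r s c (of_real \<rho> * t) + E (of_real \<rho> * t) - \<nu>))"
proof
  define f where "f z = laurent r s c z + E z - \<nu>" for z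
  assume "invertible_l2 (toeplitz (\<lambda>t. laurent r s c (of_real \<rho> * t) + E (of_real \<rho> * t) - \<nu>))"
  then have inv: "invertible_l2 (toeplitz (\<lambda>t. f (of_real \<rho> * t)))" by (simp add: f_def)
  obtain B where B: "bounded_lipschitz X B (laurent r s c)"
    using bounded_lipschitz_laurent[OF \<rho>1] unfolding X_def by blast
  from bounded_lipschitz_add[OF bounded_lipschitz_add[OF B E] bounded_lipschitz_const[of X "- \<nu>"]]
  obtain M where M: "bounded_lipschitz X M f" by (auto simp: f_def[abs_def])
  have M0: "0 \<le> M" by (rule bounded_lipschitzD(1)[OF M])
  have cont: "continuous_on (sphere 0 1) (\<lambda>t. f (of_real \<rho>' * t))" if "\<rho>' \<in> {\<rho>1..\<rho>2}" for \<rho>'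
    by (rule circle_dilate_continuous[OF M[unfolded X_def] that]) (use that \<rho>1 in auto)
  obtain \<eta> where \<eta>: "\<eta> > 0" "\<And>a'. continuous_on (sphere 0 1) a' \<Longrightarrow>
      (\<And>t. cmod t = 1 \<Longrightarrow> cmod (f (of_real \<rho> * t) - a' t) \<le> \<eta>) \<Longrightarrow> invertible_l2 (toeplitz a')"
    using toeplitz_invertible_perturb[OF cont inv] \<rho> by auto
  \<comment> \<open>A radius close to \<open>\<rho>\<close> that is not the modulus of any \<open>w\<^sub>j\<close>.\<close>
  define U where "U = {max \<rho>1 (\<rho> - \<eta> / (M + 1))<..<\<rho>} - (\<lambda>j. cmod (w j)) ` J"
  have "infinite U"
    unfolding U_def using \<rho> \<eta>(1) M0 J(1) by (intro Diff_infinite_finite) auto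
  then obtain \<rho>' where "\<rho>' \<in> U" by (meson finite.emptyI finite_subset subsetI)
  then have \<rho>': "\<rho>1 < \<rho>'" "\<rho>' < \<rho>" "\<rho> - \<rho>' \<le> \<eta> / (M + 1)" "\<And>j. j \<in> J \<Longrightarrow> cmod (w j) \<noteq> \<rho>'"
    by (auto simp: U_def)
  have \<rho>'0: "0 < \<rho>'" using \<rho>' \<rho>1 by simp
  have inX: "of_real \<rho>' * t \<in> X" "of_real \<rho> * t \<in> X" if "cmod t = 1" for t :: complex
    using that \<rho>' \<rho> \<rho>'0 by (auto simp: X_def norm_mult)
  have inv': "invertible_l2 (toeplitz (\<lambda>t. f (of_real \<rho>' * t)))"
  proof (rule \<eta>(2)[OF cont])
    show "\<rho>' \<in> {\<rho>1..\<rho>2}" using \<rho>' \<rho> by auto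
    fix t :: complex assume t: "cmod t = 1"
    have "cmod (f (of_real \<rho> * t) - f (of_real \<rho>' * t)) \<le> M * dist (of_real \<rho> * t) (of_real \<rho>' * t)"
      by (rule bounded_lipschitzD(3)[OF M inX(2)[OF t] inX(1)[OF t]])
    also have "dist (of_real \<rho> * t) (of_real \<rho>' * t) = cmod (of_real (\<rho> - \<rho>') * t)"
      by (simp add: dist_norm left_diff_distrib)
    also have "\<dots> = \<rho> - \<rho>'" unfolding norm_mult norm_of_real using t \<rho>'(2) by simp
    also have "M * (\<rho> - \<rho>') \<le> (M + 1) * (\<eta> / (M + 1))"
      using \<rho>' M0 by (intro mult_mono) auto
    also have "\<dots> = \<eta>" using M0 by simp
    finally show "cmod (f (of_real \<rho> * t) - f (of_real \<rho>' * t)) \<le> \<eta>" .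
  qed
  define G where "G z = c (int s) / z ^ r * (\<Prod>j\<in>J. z - w j)" for z
  have G0: "G (of_real \<rho>' * t) \<noteq> 0" if t: "cmod t = 1" for t :: complex
  proof -
    have n: "cmod (of_real \<rho>' * t) = \<rho>'" using t \<rho>'0 by (simp add: norm_mult)
    then have "of_real \<rho>' * t \<noteq> w j" if "j \<in> J" for j using \<rho>'(4)[OF that] by metis
    moreover have "of_real \<rho>' * t \<noteq> 0" using n \<rho>'0 by auto
    ultimately show ?thesis using cs J(1) by (simp add: G_def)
  qed
  define a where "a t = f (of_real \<rho>' * t) / G (of_real \<rho>' * t)" for t
  have a: "continuous_on (sphere 0 1) a"
    unfolding a_def
  proof (intro continuous_intros cont)
    show "\<rho>' \<in> {\<rho>1..\<rho>2}" using \<rho>' \<rho> by auto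
    show "continuous_on (sphere 0 1) (\<lambda>t. G (of_real \<rho>' * t))"
      unfolding G_def by (intro continuous_intros) (use \<rho>'0 in auto)
  qed (use G0 in auto)
  have "cmod (a t - 1) \<le> 1 / 2" if t: "cmod t = 1" for t
  proof -
    have "a t - 1 = (f (of_real \<rho>' * t) - G (of_real \<rho>' * t)) / G (of_real \<rho>' * t)"
      using G0[OF t] by (simp add: a_def field_simps)
    moreover have "cmod (f (of_real \<rho>' * t) - G (of_real \<rho>' * t)) \<le> 1 / 2 * cmod (G (of_real \<rho>' * t))"
      using close[OF inX(1)[OF t]] by (simp only: f_def G_def)
    moreover have "0 < cmod (G (of_real \<rho>' * t))" using G0[OF t] by simp
    ultimately show ?thesis by (simp only: norm_divide pos_divide_le_eq)
  qed
  then have inva: "invertible_l2 (toeplitz a)" by (intro toeplitz_invertible_near_one[OF a, of "1 / 2"]) auto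
  define C where "C = c (int s) * of_real \<rho>' ^ card J / of_real \<rho>' ^ r"
  have C: "C \<noteq> 0" using cs \<rho>'0 by (simp add: C_def)
  have "toeplitz (\<lambda>t. f (of_real \<rho>' * t)) = toeplitz (\<lambda>t. t powi (- int r) * ((\<Prod>j\<in>J. t - w j / of_real \<rho>') * (C * a t)))"
  proof (rule toeplitz_cong)
    fix t :: complex assume t: "cmod t = 1"
    have t0: "t \<noteq> 0" using t by auto
    have "(\<Prod>j\<in>J. of_real \<rho>' * t - w j) = (\<Prod>j\<in>J. of_real \<rho>' * (t - w j / of_real \<rho>'))"
      using \<rho>'0 by (intro prod.cong refl) (simp add: field_simps)
    also have "\<dots> = of_real \<rho>' ^ card J * (\<Prod>j\<in>J. t - w j / of_real \<rho>')"
      by (simp add: prod.distrib)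
    finally have "G (of_real \<rho>' * t) = t powi (- int r) * ((\<Prod>j\<in>J. t - w j / of_real \<rho>') * C)"
      using t0 \<rho>'0 by (simp add: G_def C_def power_int_minus power_mult_distrib field_simps)
    moreover have "f (of_real \<rho>' * t) = G (of_real \<rho>' * t) * a t" using G0[OF t] by (simp add: a_def)
    ultimately show "f (of_real \<rho>' * t) = t powi (- int r) * ((\<Prod>j\<in>J. t - w j / of_real \<rho>') * (C * a t))" by simp
  qed
  with inv' have "invertible_l2 (toeplitz (\<lambda>t. t powi (- int r) * ((\<Prod>j\<in>J. t - w j / of_real \<rho>') * (C * a t))))" by simp
  moreover have "cmod (w j / of_real \<rho>') \<noteq> 1" if "j \<in> J" for j
    using \<rho>'(4)[OF that] \<rho>'0 by (simp add: norm_divide)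
  ultimately have "- int r + int (card {j\<in>J. cmod (w j / of_real \<rho>') < 1}) = 0"
    by (intro toeplitz_invertible_index[where a = "\<lambda>t. C * a t", OF J(1)] toeplitz_scale_invertible inva a C continuous_intros) auto
  moreover have "{j\<in>J. cmod (w j / of_real \<rho>') < 1} = {j\<in>J. cmod (w j) < \<rho>'}"
    using \<rho>'0 by (auto simp: norm_divide)
  ultimately have "card {j\<in>J. cmod (w j) < \<rho>'} = r" by simp
  moreover have "separates \<rho>' w J {j\<in>J. cmod (w j) < \<rho>'}"
    using \<rho>'(4) by (force simp: separates_def)
  ultimately show False using unsep by (metis (no_types, lifting) mem_Collect_eq subsetI)
qed

section \<open>Stability of the points of the limit set\<close>

text \<open>The path is a segment in the coordinate \<open>\<xi> = Ln \<tau>\<close>, which cannot run into \<open>\<tau> = 0\<close>, where the branches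
  may meet. All bounds are uniform on it by compactness.\<close>

theorem limit_point_survives:
  assumes \<mu>: "\<mu> \<in> limit_set r s c" and \<rho>: "0 < \<rho>l" "\<rho>l \<le> \<rho>h"
  obtains \<kappa> \<rho>1 \<rho>2 where "0 < \<kappa>" "0 < \<rho>1" "\<rho>1 < \<rho>l" "\<rho>h < \<rho>2"
    "\<And>E. bounded_lipschitz (annulus \<rho>1 \<rho>2) \<kappa> E \<Longrightarrow>
       \<exists>\<tau>\<in>ball 0 \<epsilon>. \<forall>\<rho>\<in>{\<rho>l..\<rho>h}. \<not> invertible_l2 (toeplitz (\<lambda>t. laurent r s c (of_real \<rho> * t) + E (of_real \<rho> * t) - (\<mu> + \<tau> ^ N)))"
proof -
  obtain \<tau>a \<tau>b Sa Sb \<rho>a \<rho>b where ab: "\<tau>a \<in> ball 0 \<epsilon> - {0}" "\<tau>b \<in> ball 0 \<epsilon> - {0}" "Sa \<subseteq> J" "Sb \<subseteq> J" "Sa \<noteq> Sb"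
    "card Sa = r" "card Sb = r" "separates \<rho>a (\<lambda>j. u j \<tau>a) J Sa" "separates \<rho>b (\<lambda>j. u j \<tau>b) J Sb"
    using two_selections[OF \<mu>] by blast
  define \<xi>a where "\<xi>a = Ln \<tau>a"
  define \<xi>b where "\<xi>b = Ln \<tau>b"
  have ex: "exp \<xi>a = \<tau>a" "exp \<xi>b = \<tau>b" using ab by (auto simp: \<xi>a_def \<xi>b_def)
  define \<Gamma> where "\<Gamma> = closed_segment \<xi>a \<xi>b"
  have \<Gamma>: "compact \<Gamma>" "convex \<Gamma>" "connected \<Gamma>" "\<xi>a \<in> \<Gamma>" "\<xi>b \<in> \<Gamma>"
    by (auto simp: \<Gamma>_def convex_connected)
  define R where "R = max (Re \<xi>a) (Re \<xi>b)"
  have ReR: "Re \<xi> \<le> R" if "\<xi> \<in> \<Gamma>" for \<xi>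
  proof -
    have "\<Gamma> \<subseteq> {z. Re z \<le> R}"
      unfolding \<Gamma>_def by (intro closed_segment_subset convex_halfspace_Re_le) (auto simp: R_def)
    then show ?thesis using that by auto
  qed
  have R\<epsilon>: "exp R < \<epsilon>"
  proof -
    have "exp (Re \<xi>a) = cmod \<tau>a" "exp (Re \<xi>b) = cmod \<tau>b" using ex by (metis norm_exp_eq_Re)+
    then show ?thesis using ab(1,2) by (auto simp: R_def max_def)
  qed
  define \<eta> where "\<eta> = (ln \<epsilon> - R) / 2"
  have "exp R < exp (ln \<epsilon>)" using R\<epsilon> \<epsilon> by simp
  then have "R < ln \<epsilon>" by (simp only: exp_less_cancel_iff)
  then have \<eta>: "0 < \<eta>" by (simp add: \<eta>_def)
  \<comment> \<open>A convex compact neighbourhood of the segment that is still mapped into the disc of radius \<open>\<epsilon>\<close> by \<open>exp\<close>.\<close>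
  define K where "K = {x + y |x y. x \<in> \<Gamma> \<and> y \<in> cball (0::complex) \<eta>}"
  have K: "compact K" "convex K"
  proof -
    show "compact K" unfolding K_def by (rule compact_sums[OF \<Gamma>(1) compact_cball])
    have "K = (\<Union>x\<in>\<Gamma>. \<Union>y\<in>cball 0 \<eta>. {x + y})" unfolding K_def by blast
    then show "convex K" using convex_sums[OF \<Gamma>(2) convex_cball, of 0 \<eta>] by simp
  qed
  have K\<epsilon>: "exp \<xi> \<in> ball 0 \<epsilon>" if \<xi>: "\<xi> \<in> K" for \<xi>
  proof -
    obtain x y where xy: "\<xi> = x + y" "x \<in> \<Gamma>" "cmod y \<le> \<eta>" using \<xi> by (auto simp: K_def)
    have "Re \<xi> \<le> R + \<eta>" using ReR[OF xy(2)] complex_Re_le_cmod[of y] xy by simp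
    moreover have "2 * \<eta> = ln \<epsilon> - R" by (simp add: \<eta>_def)
    ultimately have "Re \<xi> < ln \<epsilon>" using \<eta> by linarith
    then have "exp (Re \<xi>) < \<epsilon>" using \<epsilon> by (metis exp_less_cancel_iff exp_ln)
    then show ?thesis by (simp add: norm_exp_eq_Re)
  qed
  have \<Gamma>K: "cball \<xi> \<eta> \<subseteq> K" if "\<xi> \<in> \<Gamma>" for \<xi>
  proof
    fix z assume "z \<in> cball \<xi> \<eta>"
    then have "z = \<xi> + (z - \<xi>)" "z - \<xi> \<in> cball 0 \<eta>" by (auto simp: dist_norm norm_minus_commute)
    then show "z \<in> K" using that unfolding K_def by blast
  qed
  have \<Gamma>subK: "\<Gamma> \<subseteq> K" using \<Gamma>K \<eta> by fastforce
  have contK: "continuous_on K (\<lambda>\<xi>. u j (exp \<xi>))" if "j \<in> J" for j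
    by (rule continuous_on_compose2[OF continuous_branch[OF that]]) (use K\<epsilon> in \<open>auto intro!: continuous_intros\<close>)
  \<comment> \<open>The annulus contains all branches over \<open>K\<close>, and all radii in question in its interior.\<close>
  obtain m where m: "m > 0" "\<And>j \<xi>. j \<in> J \<Longrightarrow> \<xi> \<in> K \<Longrightarrow> m \<le> cmod (u j (exp \<xi>))"
    by (rule uniform_positive_lower_bound[OF J(1) K(1), of "\<lambda>j \<xi>. cmod (u j (exp \<xi>))"])
      (use contK branch_nonzero K\<epsilon> in \<open>auto intro!: continuous_intros\<close>)
  obtain m' where m': "m' > 0" "\<And>j \<xi>. j \<in> J \<Longrightarrow> \<xi> \<in> K \<Longrightarrow> m' \<le> inverse (cmod (u j (exp \<xi>)))"
    by (rule uniform_positive_lower_bound[OF J(1) K(1), of "\<lambda>j \<xi>. inverse (cmod (u j (exp \<xi>)))"])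
      (use contK branch_nonzero K\<epsilon> in \<open>auto intro!: continuous_intros\<close>)
  define \<rho>1 where "\<rho>1 = min m (\<rho>l / 2)"
  define \<rho>2 where "\<rho>2 = max (inverse m') (\<rho>h + 1)"
  have \<rho>12: "0 < \<rho>1" "\<rho>1 < \<rho>l" "\<rho>h < \<rho>2" using m(1) \<rho> by (auto simp: \<rho>1_def \<rho>2_def)
  define X where "X = annulus \<rho>1 \<rho>2"
  have uX: "u j (exp \<xi>) \<in> X" if "j \<in> J" "\<xi> \<in> K" for j \<xi>
  proof -
    have "cmod (u j (exp \<xi>)) \<le> inverse m'"
      using le_imp_inverse_le[OF m'(2)[OF that] m'(1)] by simp
    then show ?thesis using m(2)[OF that] by (auto simp: X_def \<rho>1_def \<rho>2_def)
  qed
  define P where "P = {(i, k). i \<in> J \<and> k \<in> J \<and> i \<noteq> k}"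
  have P: "finite P" by (rule finite_subset[of _ "J \<times> J"]) (use J in \<open>auto simp: P_def\<close>)
  obtain D where D: "D > 0" "\<And>p \<xi>. p \<in> P \<Longrightarrow> \<xi> \<in> \<Gamma> \<Longrightarrow> D \<le> (\<lambda>(i, k) \<xi>. cmod (u i (exp \<xi>) - u k (exp \<xi>))) p \<xi>"
  proof (rule uniform_positive_lower_bound[OF P \<Gamma>(1), of "\<lambda>(i, k) \<xi>. cmod (u i (exp \<xi>) - u k (exp \<xi>))"])
    fix p assume "p \<in> P"
    then obtain i k where p: "p = (i, k)" "i \<in> J" "k \<in> J" "i \<noteq> k" by (auto simp: P_def)
    have "continuous_on \<Gamma> (\<lambda>\<xi>. cmod (u i (exp \<xi>) - u k (exp \<xi>)))"
      using continuous_on_subset[OF contK[OF p(2)] \<Gamma>subK] continuous_on_subset[OF contK[OF p(3)] \<Gamma>subK]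
      by (intro continuous_intros)
    then show "continuous_on \<Gamma> ((\<lambda>(i, k) \<xi>. cmod (u i (exp \<xi>) - u k (exp \<xi>))) p)" by (simp add: p(1))
    fix \<xi> assume "\<xi> \<in> \<Gamma>"
    then have "exp \<xi> \<in> ball 0 \<epsilon>" using K\<epsilon> \<Gamma>subK by blast
    then have "u i (exp \<xi>) \<noteq> u k (exp \<xi>)" using inj[of "exp \<xi>"] p unfolding inj_on_def by auto
    then show "0 < (\<lambda>(i, k) \<xi>. cmod (u i (exp \<xi>) - u k (exp \<xi>))) p \<xi>" by (simp add: p(1))
  qed blast
  have D4: "0 < D / 4" using D(1) by simp
  obtain \<delta> where \<delta>: "0 < \<delta>" and fac:
    "\<And>\<tau> \<kappa> E w z. \<tau> \<in> ball 0 \<epsilon> \<Longrightarrow> (\<And>i k. i \<in> J \<Longrightarrow> k \<in> J \<Longrightarrow> i \<noteq> k \<Longrightarrow> 4 * (D / 4) \<le> cmod (u i \<tau> - u k \<tau>)) \<Longrightarrow>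
       (\<And>j. j \<in> J \<Longrightarrow> u j \<tau> \<in> X) \<Longrightarrow> \<kappa> \<le> \<delta> \<Longrightarrow> bounded_lipschitz X \<kappa> E \<Longrightarrow>
       (\<And>j. j \<in> J \<Longrightarrow> w j \<in> X \<and> laurent r s c (w j) + E (w j) = \<mu> + \<tau> ^ N \<and> cmod (w j - u j \<tau>) \<le> \<kappa>) \<Longrightarrow>
       z \<in> X \<Longrightarrow>
       cmod (laurent r s c z + E z - (\<mu> + \<tau> ^ N) - c (int s) / z ^ r * (\<Prod>j\<in>J. z - w j))
         \<le> 1 / 2 * cmod (c (int s) / z ^ r * (\<Prod>j\<in>J. z - w j))"
    by (fact perturbed_factor[OF \<rho>12(1) D4, of \<rho>2, folded X_def])
  obtain L where L: "0 < L" "\<And>\<kappa> E. L * \<kappa> \<le> 1 \<Longrightarrow> bounded_lipschitz X \<kappa> E \<Longrightarrow>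
       \<exists>w. \<forall>j\<in>J. continuous_on \<Gamma> (w j) \<and> (\<forall>\<xi>\<in>\<Gamma>. w j \<xi> \<in> X \<and>
          laurent r s c (w j \<xi>) + E (w j \<xi>) = \<mu> + exp \<xi> ^ N \<and> cmod (w j \<xi> - u j (exp \<xi>)) \<le> L * \<kappa>)"
  proof (rule perturbed_branches[of K \<Gamma> \<eta> X])
    fix L assume L: "0 < L" "\<And>\<kappa> E. L * \<kappa> \<le> 1 \<Longrightarrow> bounded_lipschitz X \<kappa> E \<Longrightarrow>
       \<exists>w. \<forall>j\<in>J. continuous_on \<Gamma> (w j) \<and> (\<forall>\<xi>\<in>\<Gamma>. w j \<xi> \<in> X \<and>
          laurent r s c (w j \<xi>) + E (w j \<xi>) = \<mu> + exp \<xi> ^ N \<and> cmod (w j \<xi> - u j (exp \<xi>)) \<le> L * \<kappa>)"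
    show thesis by (rule that[OF L])
  qed (rule K K\<epsilon> \<Gamma>K \<eta> uX, assumption?, assumption?)+
  obtain ga where ga: "ga > 0" "\<And>y. (\<And>j. j \<in> J \<Longrightarrow> cmod (y j - u j \<tau>a) < ga) \<Longrightarrow> separates \<rho>a y J Sa"
    using separates_stable[OF J(1) ab(3,8)] by blast
  obtain gb where gb: "gb > 0" "\<And>y. (\<And>j. j \<in> J \<Longrightarrow> cmod (y j - u j \<tau>b) < gb) \<Longrightarrow> separates \<rho>b y J Sb"
    using separates_stable[OF J(1) ab(4,9)] by blast
  define q where "q = min (min 1 \<delta>) (min (ga / 2) (gb / 2))"
  have q: "0 < q" "q \<le> 1" "q \<le> \<delta>" "q < ga" "q < gb" using \<delta> ga(1) gb(1) by (auto simp: q_def min_def)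
  define \<kappa> where "\<kappa> = q / (L + 1)"
  have \<kappa>: "0 < \<kappa>" "L * \<kappa> \<le> q" "\<kappa> \<le> q"
    using q(1) L(1) by (auto simp: \<kappa>_def field_simps)
  show ?thesis
  proof (rule that[OF \<kappa>(1) \<rho>12])
    fix E assume "bounded_lipschitz (annulus \<rho>1 \<rho>2) \<kappa> E"
    then have E: "bounded_lipschitz X \<kappa> E" by (simp add: X_def)
    obtain w where w: "\<And>j. j \<in> J \<Longrightarrow> continuous_on \<Gamma> (w j)" "\<And>j \<xi>. j \<in> J \<Longrightarrow> \<xi> \<in> \<Gamma> \<Longrightarrow> w j \<xi> \<in> X \<and>
          laurent r s c (w j \<xi>) + E (w j \<xi>) = \<mu> + exp \<xi> ^ N \<and> cmod (w j \<xi> - u j (exp \<xi>)) \<le> L * \<kappa>"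
      using L(2)[OF order_trans[OF \<kappa>(2) q(2)] E] by blast
    have sa: "separates \<rho>a (\<lambda>j. w j \<xi>a) J Sa"
    proof (rule ga(2))
      fix j assume "j \<in> J"
      from w(2)[OF this \<Gamma>(4)] show "cmod (w j \<xi>a - u j \<tau>a) < ga" using \<kappa>(2) q(4) unfolding ex(1) by linarith
    qed
    have sb: "separates \<rho>b (\<lambda>j. w j \<xi>b) J Sb"
    proof (rule gb(2))
      fix j assume "j \<in> J"
      from w(2)[OF this \<Gamma>(5)] show "cmod (w j \<xi>b - u j \<tau>b) < gb" using \<kappa>(2) q(5) unfolding ex(2) by linarith
    qed
    have "\<exists>\<xi>\<in>\<Gamma>. \<not> (\<exists>\<rho> S. S \<subseteq> J \<and> card S = r \<and> separates \<rho> (\<lambda>j. w j \<xi>) J S)"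
    proof (rule ccontr)
      assume no: "\<not> ?thesis"
      have "Sa = Sb"
        by (rule selection_constant[OF J(1) \<Gamma>(3) w(1) _ \<Gamma>(4) ab(3,6) sa \<Gamma>(5) ab(4,7) sb]) (use no in blast)+
      then show False using ab(5) by simp
    qed
    then obtain \<xi> where \<xi>: "\<xi> \<in> \<Gamma>" "\<not> (\<exists>\<rho> S. S \<subseteq> J \<and> card S = r \<and> separates \<rho> (\<lambda>j. w j \<xi>) J S)" by blast
    have \<xi>K: "\<xi> \<in> K" using \<xi>(1) \<Gamma>subK by blast
    have Eq: "bounded_lipschitz X q E" by (rule bounded_lipschitz_mono[OF E \<kappa>(3)])
    have close: "cmod (laurent r s c z + E z - (\<mu> + exp \<xi> ^ N) - c (int s) / z ^ r * (\<Prod>j\<in>J. z - w j \<xi>))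
         \<le> 1 / 2 * cmod (c (int s) / z ^ r * (\<Prod>j\<in>J. z - w j \<xi>))" if "z \<in> X" for z
    proof (rule fac[OF K\<epsilon>[OF \<xi>K] _ _ q(3) Eq _ that])
      show "4 * (D / 4) \<le> cmod (u i (exp \<xi>) - u k (exp \<xi>))" if "i \<in> J" "k \<in> J" "i \<noteq> k" for i k
        using D(2)[of "(i, k)" \<xi>] that \<xi>(1) by (simp add: P_def)
      show "u j (exp \<xi>) \<in> X" if "j \<in> J" for j by (rule uX[OF that \<xi>K])
      show "w j \<xi> \<in> X \<and> laurent r s c (w j \<xi>) + E (w j \<xi>) = \<mu> + exp \<xi> ^ N \<and> cmod (w j \<xi> - u j (exp \<xi>)) \<le> q"
        if "j \<in> J" for j using w(2)[OF that \<xi>(1)] \<kappa>(2) by auto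
    qed
    have "\<not> invertible_l2 (toeplitz (\<lambda>t. laurent r s c (of_real \<rho> * t) + E (of_real \<rho> * t) - (\<mu> + exp \<xi> ^ N)))"
      if "\<rho> \<in> {\<rho>l..\<rho>h}" for \<rho>
      by (rule unseparated_not_invertible[OF \<rho>12(1) E[unfolded X_def] close[unfolded X_def] \<xi>(2)])
        (use that \<rho>12 in auto)
    then show "\<exists>\<tau>\<in>ball 0 \<epsilon>. \<forall>\<rho>\<in>{\<rho>l..\<rho>h}. \<not> invertible_l2 (toeplitz (\<lambda>t. laurent r s c (of_real \<rho> * t) + E (of_real \<rho> * t) - (\<mu> + \<tau> ^ N)))"
      using K\<epsilon>[OF \<xi>K] by blast
  qed
qed

end

text \<open>Shrinking the disc of parameters makes \<open>\<tau>\<^sup>N\<close> as small as desired.\<close>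

lemma limit_set_stable:
  fixes c :: "int \<Rightarrow> complex"
  assumes "0 < r" "0 < s" "c (- int r) \<noteq> 0" "c (int s) \<noteq> 0" and \<rho>: "0 < \<rho>l" "\<rho>l \<le> \<rho>h"
    and \<mu>: "\<mu> \<in> limit_set r s c" and e: "0 < e"
  obtains \<kappa> \<rho>1 \<rho>2 where "0 < \<kappa>" "0 < \<rho>1" "\<rho>1 < \<rho>l" "\<rho>h < \<rho>2"
    "\<And>E. bounded_lipschitz (annulus \<rho>1 \<rho>2) \<kappa> E \<Longrightarrow>
       \<exists>\<nu>. cmod (\<nu> - \<mu>) \<le> e \<and> (\<forall>\<rho>\<in>{\<rho>l..\<rho>h}. \<not> invertible_l2 (toeplitz (\<lambda>t. laurent r s c (of_real \<rho> * t) + E (of_real \<rho> * t) - \<nu>)))"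
proof -
  obtain N \<epsilon> and J :: "(complex \<times> nat) set" and u where br: "N > 0" "\<epsilon> > 0" "finite J" "card J = r + s"
    "\<And>j. j \<in> J \<Longrightarrow> u j holomorphic_on ball 0 \<epsilon>"
    "\<And>\<tau>. \<tau> \<in> ball 0 \<epsilon> \<Longrightarrow> shifted_poly r s c (\<mu> + \<tau> ^ N) = smult (c (int s)) (\<Prod>j\<in>J. [:- u j \<tau>, 1:])"
    "\<And>\<tau>. \<tau> \<in> ball 0 \<epsilon> \<Longrightarrow> \<tau> \<noteq> 0 \<Longrightarrow> inj_on (\<lambda>j. u j \<tau>) J"
    by (fact puiseux_branches[OF assms(1-4), of \<mu>])
  define \<epsilon>' where "\<epsilon>' = min \<epsilon> (min 1 e)"
  have sub: "ball 0 \<epsilon>' \<subseteq> ball (0::complex) \<epsilon>" by (auto simp: \<epsilon>'_def)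
  interpret laurent_branches r s c \<mu> N \<epsilon>' J u
    by unfold_locales
      (use assms br e sub holomorphic_on_subset[OF br(5) sub] in \<open>auto simp: \<epsilon>'_def subset_iff\<close>)
  obtain \<kappa> \<rho>1 \<rho>2 where k: "0 < \<kappa>" "0 < \<rho>1" "\<rho>1 < \<rho>l" "\<rho>h < \<rho>2"
    "\<And>E. bounded_lipschitz (annulus \<rho>1 \<rho>2) \<kappa> E \<Longrightarrow>
       \<exists>\<tau>\<in>ball 0 \<epsilon>'. \<forall>\<rho>\<in>{\<rho>l..\<rho>h}. \<not> invertible_l2 (toeplitz (\<lambda>t. laurent r s c (of_real \<rho> * t) + E (of_real \<rho> * t) - (\<mu> + \<tau> ^ N)))"
    by (fact limit_point_survives[OF \<mu> \<rho>])
  show ?thesis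
  proof (rule that[OF k(1-4)])
    fix E assume "bounded_lipschitz (annulus \<rho>1 \<rho>2) \<kappa> E"
    from k(5)[OF this] obtain \<tau> where \<tau>: "\<tau> \<in> ball 0 \<epsilon>'"
      "\<forall>\<rho>\<in>{\<rho>l..\<rho>h}. \<not> invertible_l2 (toeplitz (\<lambda>t. laurent r s c (of_real \<rho> * t) + E (of_real \<rho> * t) - (\<mu> + \<tau> ^ N)))" by blast
    have "cmod (\<tau> ^ N) \<le> cmod \<tau> ^ 1"
      unfolding norm_power using \<tau>(1) br(1) by (intro power_decreasing) (auto simp: \<epsilon>'_def)
    then have "cmod ((\<mu> + \<tau> ^ N) - \<mu>) \<le> e" using \<tau>(1) by (simp add: \<epsilon>'_def)
    then show "\<exists>\<nu>. cmod (\<nu> - \<mu>) \<le> e \<and> (\<forall>\<rho>\<in>{\<rho>l..\<rho>h}. \<not> invertible_l2 (toeplitz (\<lambda>t. laurent r s c (of_real \<rho> * t) + E (of_real \<rho> * t) - \<nu>)))"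
      using \<tau>(2) by blast
  qed
qed

section \<open>The two inclusions\<close>

lemma toeplitz_spectrum_bounded:
  assumes a: "continuous_on (sphere 0 1) a" and M: "\<And>t. cmod t = 1 \<Longrightarrow> cmod (a t) \<le> M"
    and \<mu>: "\<mu> \<in> spectrum_l2 (toeplitz a)"
  shows "cmod \<mu> \<le> M"
proof (rule ccontr)
  assume "\<not> cmod \<mu> \<le> M"
  then have gt: "M < cmod \<mu>" by simp
  have M0: "0 \<le> M" using order_trans[OF norm_ge_zero M[of 1]] by simp
  then have \<mu>0: "\<mu> \<noteq> 0" using gt by auto
  have c: "continuous_on (sphere 0 1) (\<lambda>t. 1 - a t / \<mu>)" using \<mu>0 by (intro continuous_intros a) auto
  have "invertible_l2 (toeplitz (\<lambda>t. 1 - a t / \<mu>))"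
  proof (rule toeplitz_invertible_near_one[OF c])
    show "M / cmod \<mu> < 1" using gt \<mu>0 by (simp add: divide_less_eq)
    show "cmod (1 - a t / \<mu> - 1) \<le> M / cmod \<mu>" if "cmod t = 1" for t
      using M[OF that] by (simp add: norm_divide divide_right_mono)
  qed
  from toeplitz_scale_invertible[OF c _ this, of "- \<mu>"]
  have "invertible_l2 (toeplitz (\<lambda>t. - \<mu> * (1 - a t / \<mu>)))" using \<mu>0 by simp
  moreover have "(\<lambda>t. - \<mu> * (1 - a t / \<mu>)) = (\<lambda>t. a t - \<mu>)" using \<mu>0 by (auto simp: field_simps)
  ultimately have "invertible_l2 (toeplitz (\<lambda>t. a t - \<mu>))" by simp
  then show False using not_in_toeplitz_spectrum_iff[OF a] \<mu> by blast
qed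

lemma dilated_laurent_continuous:
  assumes "0 < \<rho>"
  shows "continuous_on (sphere 0 1) (dilate (laurent r s c) \<rho>)"
proof -
  obtain B where B: "bounded_lipschitz {z. \<rho> \<le> cmod z \<and> cmod z \<le> \<rho>} B (laurent r s c)"
    by (fact bounded_lipschitz_laurent[OF assms])
  show ?thesis unfolding dilate_def[abs_def]
    by (rule circle_dilate_continuous[OF B]) (use assms in auto)
qed

lemma polygon_dilated_laurent_continuous:
  assumes \<rho>: "0 < \<rho>" and vs: "vs \<in> partitions 0 (2 * pi) \<Delta>"
  shows "continuous_on (sphere 0 1) (polygon (dilate (laurent r s c) \<rho>) vs)"
proof -
  obtain C where C: "0 < C" "\<And>\<Delta> vs. vs \<in> partitions 0 (2 * pi) \<Delta> \<Longrightarrow>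
       bounded_lipschitz (annulus \<rho> \<rho>) (C * \<Delta>) (polygon_error (laurent r s c) vs)"
    by (fact polygon_error_lipschitz[OF \<rho>])
  obtain B where B: "bounded_lipschitz (annulus \<rho> \<rho>) B (laurent r s c)"
    by (fact bounded_lipschitz_laurent[OF \<rho>])
  have "continuous_on (sphere 0 1)
      (\<lambda>t. laurent r s c (of_real \<rho> * t) + polygon_error (laurent r s c) vs (of_real \<rho> * t))"
    by (rule circle_dilate_continuous[OF bounded_lipschitz_add[OF B C(2)[OF vs]]]) (use \<rho> in auto)
  then show ?thesis
    by (rule continuous_on_eq) (simp add: polygon_dilate_eq[OF \<rho>])
qed

text \<open>The threshold for the mesh depends on the point of the limit set; a finite net of points makes it
  uniform.\<close>

lemma limit_set_near_polygon_spectra: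
  fixes r s :: nat and c :: "int \<Rightarrow> complex" and \<rho>l \<rho>h :: real
  assumes rs: "0 < r" "0 < s" "c (- int r) \<noteq> 0" "c (int s) \<noteq> 0" and \<rho>: "0 < \<rho>l" "\<rho>l \<le> \<rho>h"
    and bdd: "bounded (limit_set r s c)" and e: "0 < e"
  obtains \<delta> where "0 < \<delta>"
    "\<And>\<Delta> vs \<mu>. \<Delta> < \<delta> \<Longrightarrow> vs \<in> partitions 0 (2 * pi) \<Delta> \<Longrightarrow> \<mu> \<in> limit_set r s c \<Longrightarrow>
       \<exists>\<nu>. cmod (\<nu> - \<mu>) \<le> e \<and> (\<forall>\<rho>\<in>{\<rho>l..\<rho>h}. \<nu> \<in> spectrum_l2 (toeplitz (polygon (dilate (laurent r s c) \<rho>) vs)))"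
proof -
  let ?sp = "\<lambda>\<rho> vs. spectrum_l2 (toeplitz (polygon (dilate (laurent r s c) \<rho>) vs))"
  have pointwise: "\<exists>\<delta>>0. \<forall>\<Delta> vs. \<Delta> < \<delta> \<longrightarrow> vs \<in> partitions 0 (2 * pi) \<Delta> \<longrightarrow>
      (\<exists>\<nu>. cmod (\<nu> - \<mu>) \<le> e / 2 \<and> (\<forall>\<rho>\<in>{\<rho>l..\<rho>h}. \<nu> \<in> ?sp \<rho> vs))" if \<mu>: "\<mu> \<in> limit_set r s c" for \<mu>
  proof -
    have e2: "0 < e / 2" using e by simp
    obtain \<kappa> \<rho>1 \<rho>2 where k: "0 < \<kappa>" "0 < \<rho>1" "\<rho>1 < \<rho>l" "\<rho>h < \<rho>2"
      "\<And>E. bounded_lipschitz (annulus \<rho>1 \<rho>2) \<kappa> E \<Longrightarrow>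
         \<exists>\<nu>. cmod (\<nu> - \<mu>) \<le> e / 2 \<and> (\<forall>\<rho>\<in>{\<rho>l..\<rho>h}. \<not> invertible_l2 (toeplitz (\<lambda>t. laurent r s c (of_real \<rho> * t) + E (of_real \<rho> * t) - \<nu>)))"
      by (fact limit_set_stable[OF rs \<rho> \<mu> e2])
    let ?E = "polygon_error (laurent r s c)"
    obtain C where C: "0 < C" "\<And>\<Delta> vs. vs \<in> partitions 0 (2 * pi) \<Delta> \<Longrightarrow>
       bounded_lipschitz (annulus \<rho>1 \<rho>2) (C * \<Delta>) (?E vs)"
      by (fact polygon_error_lipschitz[OF k(2)])
    show ?thesis
    proof (intro exI[of _ "\<kappa> / C"] conjI allI impI)
      show "0 < \<kappa> / C" using k(1) C(1) by simp
      fix \<Delta> vs assume \<Delta>: "\<Delta> < \<kappa> / C" and vs: "vs \<in> partitions 0 (2 * pi) \<Delta>"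
      have "C * \<Delta> \<le> \<kappa>" using \<Delta> C(1) by (simp add: field_simps)
      from k(5)[OF bounded_lipschitz_mono[OF C(2)[OF vs] this]]
      obtain \<nu> where \<nu>: "cmod (\<nu> - \<mu>) \<le> e / 2" "\<And>\<rho>. \<rho> \<in> {\<rho>l..\<rho>h} \<Longrightarrow>
          \<not> invertible_l2 (toeplitz (\<lambda>t. laurent r s c (of_real \<rho> * t) + ?E vs (of_real \<rho> * t) - \<nu>))" by blast
      have "\<nu> \<in> ?sp \<rho> vs" if \<rho>': "\<rho> \<in> {\<rho>l..\<rho>h}" for \<rho>
      proof -
        have \<rho>0: "0 < \<rho>" using \<rho>' \<rho> by auto
        have "toeplitz (\<lambda>t. polygon (dilate (laurent r s c) \<rho>) vs t - \<nu>) =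
            toeplitz (\<lambda>t. laurent r s c (of_real \<rho> * t) + ?E vs (of_real \<rho> * t) - \<nu>)"
          by (rule toeplitz_cong) (simp add: polygon_dilate_eq[OF \<rho>0])
        then show ?thesis
          using not_in_toeplitz_spectrum_iff[OF polygon_dilated_laurent_continuous[OF \<rho>0 vs], where \<mu> = \<nu>] \<nu>(2)[OF \<rho>']
          by metis
      qed
      then show "\<exists>\<nu>. cmod (\<nu> - \<mu>) \<le> e / 2 \<and> (\<forall>\<rho>\<in>{\<rho>l..\<rho>h}. \<nu> \<in> ?sp \<rho> vs)" using \<nu>(1) by blast
    qed
  qed
  then obtain d where d: "\<And>\<mu>. \<mu> \<in> limit_set r s c \<Longrightarrow> d \<mu> > 0"
    "\<And>\<mu> \<Delta> vs. \<mu> \<in> limit_set r s c \<Longrightarrow> \<Delta> < d \<mu> \<Longrightarrow> vs \<in> partitions 0 (2 * pi) \<Delta> \<Longrightarrow>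
      \<exists>\<nu>. cmod (\<nu> - \<mu>) \<le> e / 2 \<and> (\<forall>\<rho>\<in>{\<rho>l..\<rho>h}. \<nu> \<in> ?sp \<rho> vs)"
    by metis
  have "compact (closure (limit_set r s c))" using bdd by simp
  moreover have "closure (limit_set r s c) \<subseteq> (\<Union>\<mu>\<in>limit_set r s c. ball \<mu> (e / 2))"
  proof
    fix x assume "x \<in> closure (limit_set r s c)"
    then obtain \<mu> where "\<mu> \<in> limit_set r s c" "dist \<mu> x < e / 2"
      using e unfolding closure_approachable by (meson half_gt_zero)
    then show "x \<in> (\<Union>\<mu>\<in>limit_set r s c. ball \<mu> (e / 2))" by auto
  qed
  ultimately obtain F where F: "F \<subseteq> limit_set r s c" "finite F"
    "closure (limit_set r s c) \<subseteq> (\<Union>\<mu>\<in>F. ball \<mu> (e / 2))"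
    using compactE_image[of "closure (limit_set r s c)" "limit_set r s c" "\<lambda>\<mu>. ball \<mu> (e / 2)"] by auto
  define \<delta> where "\<delta> = Min (insert 1 (d ` F))"
  have \<delta>: "0 < \<delta>" "\<And>\<mu>. \<mu> \<in> F \<Longrightarrow> \<delta> \<le> d \<mu>"
    using F d(1) by (auto simp: \<delta>_def)
  show ?thesis
  proof (rule that[OF \<delta>(1)])
    fix \<Delta> vs \<mu> assume \<Delta>: "\<Delta> < \<delta>" and vs: "vs \<in> partitions 0 (2 * pi) \<Delta>" and \<mu>: "\<mu> \<in> limit_set r s c"
    have "\<mu> \<in> closure (limit_set r s c)" using \<mu> closure_subset by blast
    then obtain \<mu>' where \<mu>': "\<mu>' \<in> F" "dist \<mu>' \<mu> < e / 2" using F(3) by auto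
    obtain \<nu> where \<nu>: "cmod (\<nu> - \<mu>') \<le> e / 2" "\<forall>\<rho>\<in>{\<rho>l..\<rho>h}. \<nu> \<in> ?sp \<rho> vs"
      using d(2)[of \<mu>' \<Delta> vs] F(1) \<mu>'(1) \<Delta> \<delta>(2)[OF \<mu>'(1)] vs by auto
    have "cmod (\<nu> - \<mu>) \<le> cmod (\<nu> - \<mu>') + cmod (\<mu>' - \<mu>)"
      using norm_triangle_ineq[of "\<nu> - \<mu>'" "\<mu>' - \<mu>"] by simp
    then have "cmod (\<nu> - \<mu>) \<le> e" using \<nu>(1) \<mu>'(2) by (simp add: dist_norm)
    then show "\<exists>\<nu>. cmod (\<nu> - \<mu>) \<le> e \<and> (\<forall>\<rho>\<in>{\<rho>l..\<rho>h}. \<nu> \<in> ?sp \<rho> vs)" using \<nu>(2) by blast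
  qed
qed

text \<open>\<open>K\<close> consists of the points away from \<open>\<Lambda>\<close> in a disc that contains all spectra in question. Every \<open>\<nu>\<close> in \<open>K\<close>
  comes with a radius \<open>R \<nu>\<close> and a tolerance \<open>\<eta> \<nu>\<close> for changes of the symbol of radius \<open>R \<nu>\<close> minus \<open>\<nu>\<close>. One third of it is
  spent on each of the moves to a nearby \<open>\<mu>\<close>, to a radius of the partition, and to the polygon.\<close>

lemma polygon_spectra_near_intersection:
  fixes r s :: nat and c :: "int \<Rightarrow> complex" and \<rho>l \<rho>h :: real
  assumes \<rho>: "0 < \<rho>l" "\<rho>l \<le> \<rho>h" and e: "0 < e"
    and \<Lambda>: "\<Lambda> = (\<Inter>\<rho>\<in>{\<rho>l..\<rho>h}. spectrum_l2 (toeplitz (dilate (laurent r s c) \<rho>)))"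
  obtains \<delta> where "0 < \<delta>"
    "\<And>\<Delta>\<rho> \<Delta>v \<rho>s vs \<mu>. \<Delta>\<rho> < \<delta> \<Longrightarrow> \<Delta>v < \<delta> \<Longrightarrow> \<rho>s \<in> partitions \<rho>l \<rho>h \<Delta>\<rho> \<Longrightarrow> vs \<in> partitions 0 (2 * pi) \<Delta>v \<Longrightarrow>
       (\<And>\<rho>. \<rho> \<in> set \<rho>s \<Longrightarrow> \<mu> \<in> spectrum_l2 (toeplitz (polygon (dilate (laurent r s c) \<rho>) vs))) \<Longrightarrow>
       \<exists>x\<in>\<Lambda>. cmod (x - \<mu>) < e"
proof -
  define b where "b = laurent r s c"
  let ?X = "annulus \<rho>l \<rho>h"
  obtain B where B: "bounded_lipschitz ?X B b" unfolding b_def by (fact bounded_lipschitz_laurent[OF \<rho>(1)])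
  have B0: "0 \<le> B" by (rule bounded_lipschitzD(1)[OF B])
  obtain C where C: "0 < C" "\<And>\<Delta> vs. vs \<in> partitions 0 (2 * pi) \<Delta> \<Longrightarrow>
       bounded_lipschitz ?X (C * \<Delta>) (polygon_error b vs)"
    unfolding b_def by (fact polygon_error_lipschitz[OF \<rho>(1)])
  have inX: "of_real \<rho> * t \<in> ?X" if "\<rho> \<in> {\<rho>l..\<rho>h}" "cmod t = 1" for \<rho> t
    using that \<rho> by (auto simp: norm_mult)
  have blip: "cmod (dilate b \<rho> t - dilate b \<rho>' t) \<le> B * \<bar>\<rho> - \<rho>'\<bar>"
    if "\<rho> \<in> {\<rho>l..\<rho>h}" "\<rho>' \<in> {\<rho>l..\<rho>h}" "cmod t = 1" for \<rho> \<rho>' t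
  proof -
    have "dist (of_real \<rho> * t) (of_real \<rho>' * t) = cmod (of_real (\<rho> - \<rho>') * t)"
      by (simp add: dist_norm left_diff_distrib)
    also have "\<dots> = \<bar>\<rho> - \<rho>'\<bar>" unfolding norm_mult norm_of_real using that(3) by simp
    finally show ?thesis
      using bounded_lipschitzD(3)[OF B inX[OF that(1,3)] inX[OF that(2,3)]] by (simp add: dilate_def)
  qed
  have cont: "continuous_on (sphere 0 1) (dilate b \<rho>)" if "\<rho> \<in> {\<rho>l..\<rho>h}" for \<rho>
    unfolding b_def by (rule dilated_laurent_continuous) (use that \<rho> in auto)
  define K where "K = cball 0 (B + C) - (\<Union>x\<in>\<Lambda>. ball x e)"
  have K: "compact K" unfolding K_def by (intro compact_diff compact_cball open_UN) auto
  have "\<exists>\<eta> \<rho>. 0 < \<eta> \<and> \<rho> \<in> {\<rho>l..\<rho>h} \<and> (\<forall>a'. continuous_on (sphere 0 1) a' \<longrightarrow>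
      (\<forall>t. cmod t = 1 \<longrightarrow> cmod (dilate b \<rho> t - \<mu> - a' t) \<le> \<eta>) \<longrightarrow> invertible_l2 (toeplitz a'))" if \<mu>: "\<mu> \<in> K" for \<mu>
  proof -
    have "\<mu> \<notin> \<Lambda>" using \<mu> e by (force simp: K_def)
    then obtain \<rho> where \<rho>': "\<rho> \<in> {\<rho>l..\<rho>h}" "\<mu> \<notin> spectrum_l2 (toeplitz (dilate b \<rho>))"
      unfolding \<Lambda> b_def by blast
    then have "invertible_l2 (toeplitz (\<lambda>t. dilate b \<rho> t - \<mu>))"
      using not_in_toeplitz_spectrum_iff[OF cont] by blast
    moreover have "continuous_on (sphere 0 1) (\<lambda>t. dilate b \<rho> t - \<mu>)" by (intro continuous_intros cont \<rho>')
    ultimately obtain \<eta> where "\<eta> > 0" "\<And>a'. continuous_on (sphere 0 1) a' \<Longrightarrow>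
      (\<And>t. cmod t = 1 \<Longrightarrow> cmod (dilate b \<rho> t - \<mu> - a' t) \<le> \<eta>) \<Longrightarrow> invertible_l2 (toeplitz a')"
      using toeplitz_invertible_perturb[of "\<lambda>t. dilate b \<rho> t - \<mu>"] by blast
    then show ?thesis using \<rho>'(1) by blast
  qed
  then obtain \<eta> R where \<eta>: "\<And>\<mu>. \<mu> \<in> K \<Longrightarrow> 0 < \<eta> \<mu>" "\<And>\<mu>. \<mu> \<in> K \<Longrightarrow> R \<mu> \<in> {\<rho>l..\<rho>h}"
    "\<And>\<mu> a'. \<mu> \<in> K \<Longrightarrow> continuous_on (sphere 0 1) a' \<Longrightarrow>
      (\<forall>t. cmod t = 1 \<longrightarrow> cmod (dilate b (R \<mu>) t - \<mu> - a' t) \<le> \<eta> \<mu>) \<Longrightarrow> invertible_l2 (toeplitz a')"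
    by metis
  have "K \<subseteq> (\<Union>\<mu>\<in>K. ball \<mu> (\<eta> \<mu> / 3))" using \<eta>(1) by force
  then obtain F where F: "F \<subseteq> K" "finite F" "K \<subseteq> (\<Union>\<mu>\<in>F. ball \<mu> (\<eta> \<mu> / 3))"
    using compactE_image[OF K, of K "\<lambda>\<mu>. ball \<mu> (\<eta> \<mu> / 3)"] by auto
  define \<eta>0 where "\<eta>0 = Min (insert 1 (\<eta> ` F))"
  have \<eta>0: "0 < \<eta>0" "\<And>\<mu>. \<mu> \<in> F \<Longrightarrow> \<eta>0 \<le> \<eta> \<mu>" using F \<eta>(1) by (auto simp: \<eta>0_def)
  define \<delta> where "\<delta> = min 1 (\<eta>0 / (3 * (B + C)))"
  have BC: "0 < B + C" using B0 C(1) by simp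
  have \<delta>: "0 < \<delta>" "\<delta> \<le> 1" "(B + C) * \<delta> \<le> \<eta>0 / 3"
  proof -
    show "0 < \<delta>" "\<delta> \<le> 1" using \<eta>0 BC by (auto simp: \<delta>_def)
    have "\<delta> \<le> \<eta>0 / (3 * (B + C))" by (simp add: \<delta>_def)
    moreover have "0 < 3 * (B + C)" using BC by simp
    ultimately have "\<delta> * (3 * (B + C)) \<le> \<eta>0" by (simp only: pos_le_divide_eq)
    then show "(B + C) * \<delta> \<le> \<eta>0 / 3" by (simp add: mult_ac)
  qed
  have small: "B * x \<le> \<eta>0 / 3" "C * x \<le> \<eta>0 / 3" if "x \<le> \<delta>" "0 \<le> x" for x
  proof -
    have "B * x \<le> (B + C) * \<delta>" "C * x \<le> (B + C) * \<delta>"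
      using that B0 C(1) by (intro mult_mono; simp)+
    then show "B * x \<le> \<eta>0 / 3" "C * x \<le> \<eta>0 / 3" using \<delta>(3) by auto
  qed
  show ?thesis
  proof (rule that[OF \<delta>(1)])
    fix \<Delta>\<rho> \<Delta>v \<rho>s vs \<mu>
    assume \<Delta>: "\<Delta>\<rho> < \<delta>" "\<Delta>v < \<delta>" and \<rho>s: "\<rho>s \<in> partitions \<rho>l \<rho>h \<Delta>\<rho>" and vs: "vs \<in> partitions 0 (2 * pi) \<Delta>v"
      and sp: "\<And>\<rho>. \<rho> \<in> set \<rho>s \<Longrightarrow> \<mu> \<in> spectrum_l2 (toeplitz (polygon (dilate (laurent r s c) \<rho>) vs))"
    have \<Delta>0: "0 \<le> \<Delta>\<rho>" "0 \<le> \<Delta>v"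
      using partition_mesh_nonneg \<rho>s vs by blast+
    have pc: "continuous_on (sphere 0 1) (polygon (dilate b \<rho>) vs)" if "\<rho> \<in> {\<rho>l..\<rho>h}" for \<rho>
      unfolding b_def by (rule polygon_dilated_laurent_continuous[OF _ vs]) (use that \<rho> in auto)
    have poly: "cmod (polygon (dilate b \<rho>) vs t - dilate b \<rho> t) \<le> C * \<Delta>v"
      if "\<rho> \<in> {\<rho>l..\<rho>h}" "cmod t = 1" for \<rho> t
    proof -
      have "0 < \<rho>" using that(1) \<rho> by auto
      then show ?thesis
        using bounded_lipschitzD(2)[OF C(2)[OF vs] inX[OF that]] polygon_dilate_eq[of \<rho> t b vs] that(2)
        by (simp add: dilate_def)
    qed
    show "\<exists>x\<in>\<Lambda>. cmod (x - \<mu>) < e"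
    proof (rule ccontr)
      assume "\<not> ?thesis"
      then have far: "\<mu> \<notin> (\<Union>x\<in>\<Lambda>. ball x e)" by (auto simp: dist_norm)
      have "cmod \<mu> \<le> B + C"
      proof -
        obtain \<rho> where \<rho>1: "\<rho> \<in> set \<rho>s" using partition_ends(1)[OF \<rho>s] by (meson list.set_sel(1))
        have \<rho>2: "\<rho> \<in> {\<rho>l..\<rho>h}" using partition_subset[OF \<rho>s \<rho>1] by simp
        have "cmod (polygon (dilate b \<rho>) vs t) \<le> B + C" if t: "cmod t = 1" for t
        proof -
          have "cmod (dilate b \<rho> t) \<le> B"
            unfolding dilate_def by (rule bounded_lipschitzD(2)[OF B inX[OF \<rho>2 t]])
          moreover have "cmod (polygon (dilate b \<rho>) vs t - dilate b \<rho> t) \<le> C * \<Delta>v" by (rule poly[OF \<rho>2 t])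
          moreover have "C * \<Delta>v \<le> C * 1" using \<Delta>(2) \<delta>(2) C(1) by (intro mult_left_mono) auto
          ultimately show ?thesis
            using norm_triangle_ineq2[of "polygon (dilate b \<rho>) vs t" "dilate b \<rho> t"] by linarith
        qed
        then show ?thesis
          using toeplitz_spectrum_bounded[of "polygon (dilate b \<rho>) vs" "B + C" \<mu>] pc[OF \<rho>2] sp[OF \<rho>1]
          by (simp add: b_def)
      qed
      then have "\<mu> \<in> K" using far by (simp add: K_def)
      then obtain \<nu> where \<nu>: "\<nu> \<in> F" "dist \<nu> \<mu> < \<eta> \<nu> / 3" using F(3) by auto
      then have \<nu>K: "\<nu> \<in> K" using F(1) by blast
      obtain \<rho> where \<rho>1: "\<rho> \<in> set \<rho>s" "\<bar>\<rho> - R \<nu>\<bar> \<le> \<Delta>\<rho>"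
        using partition_approximates[OF \<rho>s, of "R \<nu>"] \<eta>(2)[OF \<nu>K] \<Delta>0(1) by auto
      have \<rho>2: "\<rho> \<in> {\<rho>l..\<rho>h}" using partition_subset[OF \<rho>s \<rho>1(1)] by simp
      have "invertible_l2 (toeplitz (\<lambda>t. polygon (dilate b \<rho>) vs t - \<mu>))"
      proof (rule \<eta>(3)[OF \<nu>K], intro continuous_intros pc[OF \<rho>2], intro allI impI)
        fix t :: complex assume t: "cmod t = 1"
        have 1: "cmod (dilate b (R \<nu>) t - dilate b \<rho> t) \<le> \<eta>0 / 3"
        proof -
          have "cmod (dilate b (R \<nu>) t - dilate b \<rho> t) \<le> B * \<bar>R \<nu> - \<rho>\<bar>" by (rule blip[OF \<eta>(2)[OF \<nu>K] \<rho>2 t])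
          also have "\<dots> \<le> \<eta>0 / 3" by (rule small(1)) (use \<rho>1(2) \<Delta>(1) in auto)
          finally show ?thesis .
        qed
        have 2: "cmod (polygon (dilate b \<rho>) vs t - dilate b \<rho> t) \<le> \<eta>0 / 3"
          using poly[OF \<rho>2 t] small(2)[of \<Delta>v] \<Delta>(2) \<Delta>0(2) by simp
        have "dilate b (R \<nu>) t - \<nu> - (polygon (dilate b \<rho>) vs t - \<mu>) =
            (dilate b (R \<nu>) t - dilate b \<rho> t) - (polygon (dilate b \<rho>) vs t - dilate b \<rho> t) + (\<mu> - \<nu>)" by simp
        also have "cmod \<dots> \<le> cmod (dilate b (R \<nu>) t - dilate b \<rho> t) + cmod (polygon (dilate b \<rho>) vs t - dilate b \<rho> t) + cmod (\<mu> - \<nu>)"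
          by (intro norm_triangle_le add_right_mono norm_triangle_ineq4)
        also have "\<dots> \<le> \<eta> \<nu>"
          using 1 2 \<nu>(2) \<eta>0(2)[OF \<nu>(1)] by (simp add: dist_norm norm_minus_commute)
        finally show "cmod (dilate b (R \<nu>) t - \<nu> - (polygon (dilate b \<rho>) vs t - \<mu>)) \<le> \<eta> \<nu>" .
      qed
      then have "\<mu> \<notin> spectrum_l2 (toeplitz (polygon (dilate b \<rho>) vs))"
        using not_in_toeplitz_spectrum_iff[OF pc[OF \<rho>2]] by blast
      then show False using sp[OF \<rho>1(1)] by (simp add: b_def)
    qed
  qed
qed

text \<open>The distance is at most \<open>e\<close> for all partitions with meshes below a common threshold, and the supremum
  inherits this bound.\<close>

theorem theorem2p7:
  fixes r s :: nat and c :: "int \<Rightarrow> complex" and \<rho>l \<rho>h :: real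
  defines "b \<equiv> laurent r s c"
  assumes "0 < r" and "0 < s"
    and "c (- int r) \<noteq> 0" and "c (int s) \<noteq> 0"
    and "0 < \<rho>l" and "\<rho>l \<le> \<rho>h"
    and "limit_set r s c = (\<Inter>\<rho>\<in>{\<rho>l..\<rho>h}. spectrum_l2 (toeplitz (dilate b \<rho>)))"
  shows "((\<lambda>(\<Delta>\<rho>, \<Delta>v).
            SUP (\<rho>s, vs)\<in>partitions \<rho>l \<rho>h \<Delta>\<rho> \<times> partitions 0 (2 * pi) \<Delta>v.
              hausdorff_distance
                (\<Inter>\<rho>\<in>set \<rho>s. spectrum_l2 (toeplitz (polygon (dilate b \<rho>) vs)))
                (limit_set r s c))
          \<longlongrightarrow> (0 :: ennreal)) (at_right 0 \<times>\<^sub>F at_right 0)"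
proof (rule order_tendstoI)
  fix a :: ennreal assume "0 < a"
  then obtain a' where a': "0 < a'" "a' < a" using dense by blast
  define e where "e = enn2real a'"
  have "a' < top" using a' by (metis less_trans top.not_eq_extremum not_less_iff_gr_or_eq less_top)
  then have e: "ennreal e = a'" "0 < e" using a' by (auto simp: e_def enn2real_positive_iff)
  have \<Lambda>: "limit_set r s c = (\<Inter>\<rho>\<in>{\<rho>l..\<rho>h}. spectrum_l2 (toeplitz (dilate (laurent r s c) \<rho>)))"
    using assms(8) unfolding b_def .
  have bdd: "bounded (limit_set r s c)"
  proof -
    have cont: "continuous_on (sphere 0 1) (dilate (laurent r s c) \<rho>l)"
      by (rule dilated_laurent_continuous[OF assms(6)])
    then have "compact (dilate (laurent r s c) \<rho>l ` sphere 0 1)"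
      by (intro compact_continuous_image) auto
    then obtain M where "\<And>t. cmod t = 1 \<Longrightarrow> cmod (dilate (laurent r s c) \<rho>l t) \<le> M"
      using compact_imp_bounded[of "dilate (laurent r s c) \<rho>l ` sphere 0 1"] unfolding bounded_iff
      by (metis imageI mem_sphere_0)
    then have "spectrum_l2 (toeplitz (dilate (laurent r s c) \<rho>l)) \<subseteq> cball 0 M"
      using toeplitz_spectrum_bounded[OF cont] by auto
    then show ?thesis using \<Lambda> assms(7) by (intro bounded_subset[OF bounded_cball[of 0 M]]) auto
  qed
  obtain \<delta>1 where \<delta>1: "0 < \<delta>1"
    "\<And>\<Delta> vs \<mu>. \<Delta> < \<delta>1 \<Longrightarrow> vs \<in> partitions 0 (2 * pi) \<Delta> \<Longrightarrow> \<mu> \<in> limit_set r s c \<Longrightarrow>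
       \<exists>\<nu>. cmod (\<nu> - \<mu>) \<le> e \<and> (\<forall>\<rho>\<in>{\<rho>l..\<rho>h}. \<nu> \<in> spectrum_l2 (toeplitz (polygon (dilate (laurent r s c) \<rho>) vs)))"
    by (fact limit_set_near_polygon_spectra[OF assms(2-7) bdd e(2)])
  obtain \<delta>2 where \<delta>2: "0 < \<delta>2"
    "\<And>\<Delta>\<rho> \<Delta>v \<rho>s vs \<mu>. \<Delta>\<rho> < \<delta>2 \<Longrightarrow> \<Delta>v < \<delta>2 \<Longrightarrow> \<rho>s \<in> partitions \<rho>l \<rho>h \<Delta>\<rho> \<Longrightarrow> vs \<in> partitions 0 (2 * pi) \<Delta>v \<Longrightarrow>
       (\<And>\<rho>. \<rho> \<in> set \<rho>s \<Longrightarrow> \<mu> \<in> spectrum_l2 (toeplitz (polygon (dilate (laurent r s c) \<rho>) vs))) \<Longrightarrow>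
       \<exists>x\<in>limit_set r s c. cmod (x - \<mu>) < e"
    by (fact polygon_spectra_near_intersection[OF assms(6,7) e(2) \<Lambda>])
  define \<delta> where "\<delta> = min \<delta>1 \<delta>2"
  have \<delta>: "0 < \<delta>" "\<delta> \<le> \<delta>1" "\<delta> \<le> \<delta>2" using \<delta>1(1) \<delta>2(1) by (auto simp: \<delta>_def)
  have dist: "hausdorff_distance (\<Inter>\<rho>\<in>set \<rho>s. spectrum_l2 (toeplitz (polygon (dilate b \<rho>) vs))) (limit_set r s c) \<le> ennreal e"
    if \<Delta>: "\<Delta>\<rho> < \<delta>" "\<Delta>v < \<delta>" and P: "\<rho>s \<in> partitions \<rho>l \<rho>h \<Delta>\<rho>" "vs \<in> partitions 0 (2 * pi) \<Delta>v" for \<Delta>\<rho> \<Delta>v \<rho>s vs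
    unfolding hausdorff_distance_def
  proof (rule INF_lower, intro CollectI conjI subsetI)
    show "0 \<le> e" using e by simp
    fix \<mu> assume "\<mu> \<in> (\<Inter>\<rho>\<in>set \<rho>s. spectrum_l2 (toeplitz (polygon (dilate b \<rho>) vs)))"
    then have "\<exists>x\<in>limit_set r s c. cmod (x - \<mu>) < e"
      by (intro \<delta>2(2)[OF _ _ P]) (use \<Delta> \<delta> in \<open>auto simp: b_def\<close>)
    then show "\<mu> \<in> (\<Union>x\<in>limit_set r s c. cball x e)" by (force simp: dist_norm)
  next
    fix \<mu> assume \<mu>: "\<mu> \<in> limit_set r s c"
    have "\<Delta>v < \<delta>1" using \<Delta> \<delta> by simp
    from \<delta>1(2)[OF this P(2) \<mu>] obtain \<nu> where \<nu>: "cmod (\<nu> - \<mu>) \<le> e"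
      "\<forall>\<rho>\<in>{\<rho>l..\<rho>h}. \<nu> \<in> spectrum_l2 (toeplitz (polygon (dilate (laurent r s c) \<rho>) vs))" by blast
    then have "\<nu> \<in> (\<Inter>\<rho>\<in>set \<rho>s. spectrum_l2 (toeplitz (polygon (dilate b \<rho>) vs)))"
      using partition_subset[OF P(1)] by (auto simp: b_def)
    moreover have "\<mu> \<in> cball \<nu> e" using \<nu>(1) by (simp add: dist_norm)
    ultimately show "\<mu> \<in> (\<Union>x\<in>(\<Inter>\<rho>\<in>set \<rho>s. spectrum_l2 (toeplitz (polygon (dilate b \<rho>) vs))). cball x e)" by blast
  qed
  have ev: "\<forall>\<^sub>F x in at_right 0. x < \<delta>"
    using \<delta>(1) by (auto simp: eventually_at_right_field)
  show "\<forall>\<^sub>F x in at_right 0 \<times>\<^sub>F at_right 0.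
      (case x of (\<Delta>\<rho>, \<Delta>v) \<Rightarrow> SUP (\<rho>s, vs)\<in>partitions \<rho>l \<rho>h \<Delta>\<rho> \<times> partitions 0 (2 * pi) \<Delta>v.
              hausdorff_distance (\<Inter>\<rho>\<in>set \<rho>s. spectrum_l2 (toeplitz (polygon (dilate b \<rho>) vs))) (limit_set r s c)) < a"
    unfolding eventually_prod_filter
  proof (intro exI conjI allI impI)
    show "\<forall>\<^sub>F x in at_right 0. x < \<delta>" "\<forall>\<^sub>F x in at_right 0. x < \<delta>" by (rule ev)+
    fix \<Delta>\<rho> \<Delta>v assume \<Delta>: "\<Delta>\<rho> < \<delta>" "\<Delta>v < \<delta>"
    have "(SUP (\<rho>s, vs)\<in>partitions \<rho>l \<rho>h \<Delta>\<rho> \<times> partitions 0 (2 * pi) \<Delta>v.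
              hausdorff_distance (\<Inter>\<rho>\<in>set \<rho>s. spectrum_l2 (toeplitz (polygon (dilate b \<rho>) vs))) (limit_set r s c)) \<le> ennreal e"
      by (rule SUP_least) (use dist[OF \<Delta>] in auto)
    then show "(case (\<Delta>\<rho>, \<Delta>v) of (\<Delta>\<rho>, \<Delta>v) \<Rightarrow> SUP (\<rho>s, vs)\<in>partitions \<rho>l \<rho>h \<Delta>\<rho> \<times> partitions 0 (2 * pi) \<Delta>v.
              hausdorff_distance (\<Inter>\<rho>\<in>set \<rho>s. spectrum_l2 (toeplitz (polygon (dilate b \<rho>) vs))) (limit_set r s c)) < a"
      using a'(2) e(1) by (simp add: le_less_trans)
  qed
qed simp

end
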